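(* Let $k$ be a field of characteristic zero, let $t, m, n \ge 1$ be integers, and let $\mathrm{G}(-)$ be one of $\mathrm{GL}_t(-)$, $\mathrm{SL}_t(-)$, $\mathrm{O}_t(-)$, or $\mathrm{Sp}_t(-)$ (with $t$ even in the last case). Let $C := \mathrm{G}(\mathbb{C}) \cap \mathrm{U}_t(\mathbb{C})$, a compact Lie group. Let $X$ and $Y$ be $m \times t$ and $t \times n$ matrices of indeterminates, and let $\mathrm{G}(k)$ act on $k[X, Y]$ by $k$-algebra automorphisms, where $M \in \mathrm{G}(k)$ acts by $X \mapsto XM^{-1}$, $Y \mapsto MY$. Let $U = [u_{ij}]$ and $\overline{U} = [\overline{u}_{ij}]$ be $t \times t$ matrices of new (independent) indeterminates, and let $\phi \colon k[X, Y] \to k[X, Y][U, \overline{U}]$ be the $k$-algebra homomorphism with $X \mapsto X \overline{U}^{\mathrm{tr}}$, $Y \mapsto UY$. For $f \in k[X, Y]$ write $\phi(f) = \sum_{I, J} \alpha_{I, J}(f)\, u^I \overline{u}^J$ with $\alpha_{I,J}(f) \in k[X, Y]$, where $I, J$ run over multi-indices in $\mathbb{N}^{t^2}$. Then the Reynolds operator $\mathcal{R} \colon k[X, Y] \to k[X, Y]^{\mathrm{G}(k)}$ is given by $$\mathcal{R}(f) = \sum_{I, J} \alpha_{I, J}(f) \int_C u^I \overline{u}^J,$$ where $u^I \overline{u}^J$ is regarded as a smooth function $C \to \mathbb{C}$ (with $u_{ij}$ the $(i,j)$ entry function and $\overline{u}_{ij}$ its complex conjugate) and the integrals, which are rational numbers,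 are regarded as elements of $k$.
   Context: $\mathrm{O}_t(k) = \{M \in \mathrm{GL}_t(k) : M^{\mathrm{tr}} M = I_t\}$; for $t = 2s$, $\mathrm{Sp}_t(k) = \{M \in \mathrm{GL}_t(k) : M^{\mathrm{tr}} \Omega M = \Omega\}$ with $\Omega = \begin{pmatrix} O & I_s \\ -I_s & O\end{pmatrix}$; $\mathrm{U}_t(\mathbb{C})$ is the unitary group. Actions and maps written on matrices are meant entrywise, e.g. $Y \mapsto MY$ means $y_{ij} \mapsto [MY]_{ij}$. The integral $\int_C$ is with respect to the normalised Haar measure on $C$ (total mass $1$). The Reynolds operator for the action of $G = \mathrm{G}(k)$ on a polynomial ring $S$ is the unique $k$-linear map $\mathcal{R} \colon S \to S^G$ with $\mathcal{R}(r) = r$ for all $r \in S^G$ and $\mathcal{R}(g(s)) = \mathcal{R}(s)$ for all $g \in G$, $s \in S$; it exists and is unique because these groups are linearly reductive in characteristic zero, and it is $S^G$-linear. *)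

theory Defs
  imports "HOL-Probability.Probability" "HOL-Library.Poly_Mapping"
begin

section \<open>Polynomial rings as monoid algebras\<close>

text \<open>
  Polynomials in variables \<open>'v\<close> over \<open>'a\<close> are the finitely supported functions from
  exponents \<open>'v \<Rightarrow>\<^sub>0 nat\<close> to \<open>'a\<close>, multiplied by convolution.
\<close>

type_synonym ('v, 'a) mpoly = "('v \<Rightarrow>\<^sub>0 nat) \<Rightarrow>\<^sub>0 'a"

definition Const :: "'a::zero \<Rightarrow> 'e::zero \<Rightarrow>\<^sub>0 'a" where
  "Const c = Poly_Mapping.single 0 c"

definition Var :: "'v \<Rightarrow> ('v, 'a::zero_neq_one) mpoly" where
  "Var v = Poly_Mapping.single (Poly_Mapping.single v 1) 1"

definition monom_eval :: "('v \<Rightarrow> 'b::comm_monoid_mult) \<Rightarrow> ('v \<Rightarrow>\<^sub>0 nat) \<Rightarrow> 'b" where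
  "monom_eval x e = (\<Prod>v\<in>Poly_Mapping.keys e. x v ^ Poly_Mapping.lookup e v)"

text \<open>
  The ring homomorphism on polynomials that extends \<open>h\<close> on coefficients and sends \<open>Var v\<close>
  to \<open>x v\<close>.
\<close>

definition poly_subst ::
    "('a::zero \<Rightarrow> 'b::comm_semiring_1) \<Rightarrow> ('v \<Rightarrow> 'b) \<Rightarrow> ('v, 'a) mpoly \<Rightarrow> 'b" where
  "poly_subst h x p =
     (\<Sum>e\<in>Poly_Mapping.keys p. h (Poly_Mapping.lookup p e) * monom_eval x e)"


section \<open>The classical groups\<close>

datatype classical_type = GL | SL | Orth | Symp

text \<open>
  Rows and columns are indexed by a finite linearly ordered type \<open>'t\<close>; the order is used
  only to locate the blocks of \<open>\<Omega>\<close>. For \<open>CARD('t) = 2 * s\<close> this is the block matrix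
  with block rows \<open>(0, I_s)\<close> and \<open>(-I_s, 0)\<close>.
\<close>

definition position :: "'t::{finite,linorder} \<Rightarrow> nat" where
  "position i = card {l. l < i}"

definition Omega :: "'a::ring_1^('t::{finite,linorder})^('t::{finite,linorder})" where
  "Omega = (\<chi> i j. if position j = position i + CARD('t) div 2 then 1
                   else if position i = position j + CARD('t) div 2 then - 1
                   else 0)"

fun classical_group ::
    "classical_type \<Rightarrow> ('a::field^('t::{finite,linorder})^('t::{finite,linorder})) set" where
  "classical_group GL = {M. invertible M}"
| "classical_group SL = {M. invertible M \<and> det M = 1}"
| "classical_group Orth = {M. invertible M \<and> transpose M ** M = mat 1}"
| "classical_group Symp = {M. invertible M \<and> transpose M ** Omega ** M = Omega}"

definition unitary_group :: "(complex^'t^'t) set" where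
  "unitary_group = {M. invertible M \<and> transpose (map_matrix cnj M) ** M = mat 1}"

definition compact_form ::
    "classical_type \<Rightarrow> (complex^('t::{finite,linorder})^('t::{finite,linorder})) set" where
  "compact_form G = classical_group G \<inter> unitary_group"

definition normalised_haar_measure ::
    "(complex^'t^'t) set \<Rightarrow> (complex^'t^'t) measure \<Rightarrow> bool" where
  "normalised_haar_measure C \<mu> \<longleftrightarrow>
     prob_space \<mu> \<and> sets \<mu> = sets (restrict_space borel C) \<and>
     (\<forall>A\<in>C. distr \<mu> \<mu> (\<lambda>B. A ** B) = \<mu>)"


section \<open>The action and the Reynolds operator\<close>

datatype ('m, 't, 'n) xy_var = XVar 'm 't | YVar 't 'n

type_synonym ('m, 't, 'n, 'k) kXY = "(('m, 't, 'n) xy_var, 'k) mpoly"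

definition X_mat :: "('m, 't, 'n, 'k::field) kXY^'t^'m" where
  "X_mat = (\<chi> i j. Var (XVar i j))"

definition Y_mat :: "('m, 't, 'n, 'k::field) kXY^'n^'t" where
  "Y_mat = (\<chi> i j. Var (YVar i j))"

definition act ::
    "'k::field^'t^'t \<Rightarrow> ('m::finite, 't::finite, 'n::finite, 'k) kXY \<Rightarrow> ('m, 't, 'n, 'k) kXY" where
  "act M = poly_subst Const (\<lambda>v. case v of
       XVar i j \<Rightarrow> (X_mat ** map_matrix Const (matrix_inv M)) $ i $ j
     | YVar i j \<Rightarrow> (map_matrix Const M ** Y_mat) $ i $ j)"

definition invariants ::
    "('k::field^'t^'t) set \<Rightarrow> ('m::finite, 't::finite, 'n::finite, 'k) kXY set" where
  "invariants G = {f. \<forall>M\<in>G. act M f = f}"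

definition is_reynolds_operator ::
    "('k::field^'t^'t) set \<Rightarrow>
     (('m::finite, 't::finite, 'n::finite, 'k) kXY \<Rightarrow> ('m, 't, 'n, 'k) kXY) \<Rightarrow> bool" where
  "is_reynolds_operator G R \<longleftrightarrow>
     (\<forall>f g. R (f + g) = R f + R g) \<and>
     (\<forall>c f. R (Const c * f) = Const c * R f) \<and>
     (\<forall>f. R f \<in> invariants G) \<and>
     (\<forall>r\<in>invariants G. R r = r) \<and>
     (\<forall>M\<in>G. \<forall>s. R (act M s) = R s)"


section \<open>The homomorphism \<open>\<phi>\<close>, its coefficients, and the moments\<close>

text \<open>
  A monomial \<open>u^I ubar^J\<close> is represented by the pair of exponents \<open>(I, J)\<close>, so that
  \<open>k[X, Y][U, Ubar]\<close> is the monoid algebra over \<open>k[X, Y]\<close> of the monoid of such pairs.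
\<close>

type_synonym 't multi_index = "'t \<times> 't \<Rightarrow>\<^sub>0 nat"

type_synonym ('m, 't, 'n, 'k) kXYU =
  "('t multi_index \<times> 't multi_index) \<Rightarrow>\<^sub>0 ('m, 't, 'n, 'k) kXY"

definition U_mat :: "('m, 't, 'n, 'k::field) kXYU^'t^'t" where
  "U_mat = (\<chi> i j. Poly_Mapping.single (Poly_Mapping.single (i, j) 1, 0) 1)"

definition Ubar_mat :: "('m, 't, 'n, 'k::field) kXYU^'t^'t" where
  "Ubar_mat = (\<chi> i j. Poly_Mapping.single (0, Poly_Mapping.single (i, j) 1) 1)"

definition phi ::
    "('m::finite, 't::finite, 'n::finite, 'k::field) kXY \<Rightarrow> ('m, 't, 'n, 'k) kXYU" where
  "phi = poly_subst (\<lambda>c. Const (Const c)) (\<lambda>v. case v of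
       XVar i j \<Rightarrow> (map_matrix Const X_mat ** transpose Ubar_mat) $ i $ j
     | YVar i j \<Rightarrow> (U_mat ** map_matrix Const Y_mat) $ i $ j)"

definition alpha ::
    "'t multi_index \<Rightarrow> 't multi_index \<Rightarrow>
     ('m::finite, 't::finite, 'n::finite, 'k::field) kXY \<Rightarrow> ('m, 't, 'n, 'k) kXY" where
  "alpha I J f = Poly_Mapping.lookup (phi f) (I, J)"

definition moment ::
    "(complex^'t^'t) measure \<Rightarrow> 't multi_index \<Rightarrow> 't multi_index \<Rightarrow> complex" where
  "moment \<mu> I J =
     (LINT M|\<mu>. monom_eval (\<lambda>(i, j). M $ i $ j) I * monom_eval (\<lambda>(i, j). cnj (M $ i $ j)) J)"

text \<open>Transport of a rational complex number to another field of characteristic zero.\<close>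

definition rational_in :: "complex \<Rightarrow> 'k::field_char_0" where
  "rational_in z = of_rat (THE q. of_rat q = z)"

end

(*
  Every finite set of moments is reproduced by a rational cubature: there are finitely many M_i in
  G(Q) and rational weights l_i with sum 1 such that the integral of u^I ubar^J over C equals the
  sum of the l_i times the value of u^I ubar^J at (M_i, M_i^-tr). Since phi(f) evaluated at
  (M, M^-tr) is the image of f under M, the formula for R(f) becomes the finite average of the
  l_i M_i(f), which fixes invariants and agrees with any other Reynolds operator.

  The cubature exists by duality in a finite-dimensional space of polynomials, because G(Q) is
  Zariski dense in G(K) for every field K of characteristic zero. This density is proved from
  generators in one-parameter families (elementary matrices and dilations for GL, reflections for
  O, transvections for Sp, and a retraction GL -> SL). The moments are invariant under translation
  by C, hence by G(Q), since C is Zariski dense as well: its circle subgroups extend to complex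
  tori, and the KAK decomposition of SL(2) then yields the unipotent generators. Rationality
  follows since an invariant rational functional with value 1 at the constant 1 is unique.
*)
theory Submission
  imports Defs "HOL-Library.Function_Algebras"
begin

text \<open>Nothing can be integrated over k, and k has only the rationals in common with
  \<complex>. So every fact has to cross from \<complex> to k as an identity with rational
  coefficients tested on G(Q), whose image lies in both groups. A rational cubature seems to
  presuppose rational moments, while their rationality is to follow from invariance. The circle is
  broken by a Q-linear map \<pi> from \<complex> to Q with \<pi> 1 = 1: the composition of \<pi>
  with the integral has a rational cubature and is still invariant, and comparing it with the
  integral shows that \<pi> fixes every moment. Exactness on the given monomials is not enough for a
  Reynolds operator. The cubature is also made exact on all monomials occurring in their translates,
  which turns invariance into a finite identity over Q. Invariance under right translation makes
  R(f) invariant, and invariance under left translation gives R(g f) = R(f). The Haar measure is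
  given as left invariant only, so inversion has to supply the other side.\<close>

type_synonym ('a, 't) sqmat = "(('a, 't) vec, 't) vec"

section \<open>Polynomial functions on pairs of matrices\<close>

text \<open>
  A group element \<open>M\<close> is represented by the pair of \<open>M\<close> and its inverse transpose, so that
  regular functions on \<open>GL\<close> become polynomial functions of the pair. The constants are
  restricted to \<open>R\<close> in order to keep track of rationality.
\<close>

inductive polyfun :: "'a::comm_ring_1 set \<Rightarrow> ('a^'t^'t \<Rightarrow> 'a^'t^'t \<Rightarrow> 'a) \<Rightarrow> bool" for R where
  const: "c \<in> R \<Longrightarrow> polyfun R (\<lambda>A B. c)"
| entry_fst: "polyfun R (\<lambda>A B. A $ i $ j)"
| entry_snd: "polyfun R (\<lambda>A B. B $ i $ j)"
| add: "polyfun R f \<Longrightarrow> polyfun R g \<Longrightarrow> polyfun R (\<lambda>A B. f A B + g A B)"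
| mult: "polyfun R f \<Longrightarrow> polyfun R g \<Longrightarrow> polyfun R (\<lambda>A B. f A B * g A B)"

lemma polyfun_mono:
  assumes "polyfun R f" "R \<subseteq> R'"
  shows "polyfun R' f"
  using assms(1) by induction (use assms(2) in \<open>auto intro: polyfun.intros\<close>)

lemma polyfun_sum:
  assumes "finite S" "0 \<in> R" "\<And>i. i \<in> S \<Longrightarrow> polyfun R (f i)"
  shows "polyfun R (\<lambda>A B. \<Sum>i\<in>S. f i A B)"
  using assms by (induction S rule: finite_induct) (auto intro: polyfun.intros)

lemma polyfun_prod:
  assumes "finite S" "1 \<in> R" "\<And>i. i \<in> S \<Longrightarrow> polyfun R (f i)"
  shows "polyfun R (\<lambda>A B. \<Prod>i\<in>S. f i A B)"
  using assms by (induction S rule: finite_induct) (auto intro: polyfun.intros)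

lemma polyfun_power:
  assumes "1 \<in> R" "polyfun R f"
  shows "polyfun R (\<lambda>A B. f A B ^ n)"
  using assms by (induction n) (auto intro: polyfun.intros)

lemma polyfun_diff:
  assumes "polyfun UNIV f" "polyfun UNIV g"
  shows "polyfun UNIV (\<lambda>A B. f A B - g A B)"
proof -
  have "polyfun UNIV (\<lambda>A B. f A B + (- 1) * g A B)"
    by (intro polyfun.intros assms) auto
  then show ?thesis by simp
qed

lemma polyfun_subst:
  assumes "polyfun R f"
    "\<And>i j. polyfun R (\<lambda>A B. g A B $ i $ j)" "\<And>i j. polyfun R (\<lambda>A B. h A B $ i $ j)"
  shows "polyfun R (\<lambda>A B. f (g A B) (h A B))"
  using assms(1) by induction (auto intro: polyfun.intros assms(2,3))

lemma polyfun_translate_left: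
  assumes "polyfun UNIV f"
  shows "polyfun UNIV (\<lambda>A B. f (M ** A) (N ** B))"
  by (rule polyfun_subst[OF assms])
    (auto simp: matrix_matrix_mult_def intro!: polyfun_sum polyfun.intros)

lemma polyfun_translate_right:
  assumes "polyfun UNIV f"
  shows "polyfun UNIV (\<lambda>A B. f (A ** M) (B ** N))"
  by (rule polyfun_subst[OF assms])
    (auto simp: matrix_matrix_mult_def intro!: polyfun_sum polyfun.intros)

lemma polyfun_det:
  assumes "\<And>i j. polyfun UNIV (\<lambda>A B. g A B $ i $ j)"
  shows "polyfun UNIV (\<lambda>A B. det (g A B))"
  unfolding det_def
  by (intro polyfun_sum polyfun.mult polyfun_prod polyfun.const assms) (auto simp: finite_permutations)

lemma polyfun_Rats:
  fixes f :: "'a::field_char_0^'t^'t \<Rightarrow> 'a^'t^'t \<Rightarrow> 'a"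
  assumes "polyfun \<rat> f" "\<And>i j. A $ i $ j \<in> \<rat>" "\<And>i j. B $ i $ j \<in> \<rat>"
  shows "f A B \<in> \<rat>"
  using assms by induction auto

text \<open>The value of the monomial with exponents (I, J) at U = A, Ubar = B. With B the conjugate
  of A it is the integrand of a moment; with B the inverse transpose of A it is the factor that
  multiplies \<open>alpha I J f\<close> in the action of A. For unitary A the two agree.\<close>

definition mono_val :: "'a::comm_ring_1^'t^'t \<Rightarrow> 'a^'t^'t \<Rightarrow> 't multi_index \<times> 't multi_index \<Rightarrow> 'a" where
  "mono_val A B a = monom_eval (\<lambda>(i, j). A $ i $ j) (fst a) * monom_eval (\<lambda>(i, j). B $ i $ j) (snd a)"

lemma monom_eval_superset:
  assumes "finite S" "Poly_Mapping.keys e \<subseteq> S"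
  shows "monom_eval x e = (\<Prod>v\<in>S. x v ^ Poly_Mapping.lookup e v)"
  unfolding monom_eval_def using assms
  by (intro prod.mono_neutral_left) (auto simp: in_keys_iff)

lemma monom_eval_0 [simp]: "monom_eval x 0 = 1"
  by (simp add: monom_eval_def)

lemma monom_eval_single [simp]: "monom_eval x (Poly_Mapping.single v n) = x v ^ n"
  by (simp add: monom_eval_def)

lemma monom_eval_add: "monom_eval x (d + e) = monom_eval x d * monom_eval x e"
proof -
  let ?S = "Poly_Mapping.keys d \<union> Poly_Mapping.keys e"
  have "finite ?S" "Poly_Mapping.keys (d + e) \<subseteq> ?S"
    by (auto dest: subsetD[OF Poly_Mapping.keys_add])
  then show ?thesis
    by (simp add: monom_eval_superset[of ?S] lookup_add power_add prod.distrib)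
qed

lemma mono_val_0 [simp]: "mono_val A B 0 = 1"
  by (simp add: mono_val_def)

lemma mono_val_add: "mono_val A B (a + b) = mono_val A B a * mono_val A B b"
  by (simp add: mono_val_def monom_eval_add)

lemma polyfun_mono_val:
  assumes "1 \<in> R"
  shows "polyfun R (\<lambda>A B. mono_val A B a)"
  unfolding mono_val_def monom_eval_def
  by (intro polyfun.mult polyfun_prod polyfun_power assms)
    (auto simp: split_beta intro: polyfun.intros)


section \<open>Rational one-parameter families\<close>

text \<open>Regular functions on the open subset of the line where q is nonzero: f is p / q^n there,
  and arbitrary at the zeros of q. Fixing q in advance provides a common denominator for all entries
  of a matrix family.\<close>

definition rat_along :: "'a::field_char_0 poly \<Rightarrow> ('a \<Rightarrow> 'a) \<Rightarrow> bool" where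
  "rat_along q f \<longleftrightarrow> (\<exists>p n. \<forall>s. poly q s \<noteq> 0 \<longrightarrow> f s * poly q s ^ n = poly p s)"

lemma rat_along_poly: "rat_along q (poly p)"
  unfolding rat_along_def by (rule exI[of _ p], rule exI[of _ 0]) simp

lemma rat_along_const: "rat_along q (\<lambda>s. c)"
  using rat_along_poly[of q "[:c:]"] by (simp add: rat_along_def)

lemma rat_along_id: "rat_along q (\<lambda>s. s)"
  using rat_along_poly[of q "[:0, 1:]"] by (simp add: rat_along_def)

lemma rat_along_add:
  assumes "rat_along q f" "rat_along q g"
  shows "rat_along q (\<lambda>s. f s + g s)"
proof -
  obtain p n p' n' where
    f: "\<And>s. poly q s \<noteq> 0 \<Longrightarrow> f s * poly q s ^ n = poly p s" and
    g: "\<And>s. poly q s \<noteq> 0 \<Longrightarrow> g s * poly q s ^ n' = poly p' s"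
    using assms unfolding rat_along_def by metis
  have "(f s + g s) * poly q s ^ (n + n') = poly (p * q ^ n' + p' * q ^ n) s" if "poly q s \<noteq> 0" for s
    unfolding poly_add poly_mult poly_power f[OF that, symmetric] g[OF that, symmetric]
    by (simp add: power_add algebra_simps)
  then show ?thesis unfolding rat_along_def by blast
qed

lemma rat_along_mult:
  assumes "rat_along q f" "rat_along q g"
  shows "rat_along q (\<lambda>s. f s * g s)"
proof -
  obtain p n p' n' where
    f: "\<And>s. poly q s \<noteq> 0 \<Longrightarrow> f s * poly q s ^ n = poly p s" and
    g: "\<And>s. poly q s \<noteq> 0 \<Longrightarrow> g s * poly q s ^ n' = poly p' s"
    using assms unfolding rat_along_def by metis
  have "(f s * g s) * poly q s ^ (n + n') = poly (p * p') s" if "poly q s \<noteq> 0" for s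
    unfolding poly_mult f[OF that, symmetric] g[OF that, symmetric]
    by (simp add: power_add mult_ac)
  then show ?thesis unfolding rat_along_def by blast
qed

lemma rat_along_divide:
  assumes "rat_along q f"
  shows "rat_along q (\<lambda>s. f s / poly q s)"
proof -
  obtain p n where f: "\<And>s. poly q s \<noteq> 0 \<Longrightarrow> f s * poly q s ^ n = poly p s"
    using assms unfolding rat_along_def by metis
  have "(f s / poly q s) * poly q s ^ Suc n = poly p s" if "poly q s \<noteq> 0" for s
    using f[OF that] that by simp
  then show ?thesis unfolding rat_along_def by blast
qed

lemma rat_along_uminus: "rat_along q f \<Longrightarrow> rat_along q (\<lambda>s. - f s)"
  using rat_along_mult[OF rat_along_const[of q "-1"], of f] by simp

lemma rat_along_diff: "rat_along q f \<Longrightarrow> rat_along q g \<Longrightarrow> rat_along q (\<lambda>s. f s - g s)"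
  using rat_along_add[OF _ rat_along_uminus, of q f g] by simp

lemma rat_along_sum:
  assumes "\<And>i. i \<in> S \<Longrightarrow> rat_along q (f i)"
  shows "rat_along q (\<lambda>s. \<Sum>i\<in>S. f i s)"
  using assms
  by (induction S rule: infinite_finite_induct) (auto intro: rat_along_const rat_along_add)

lemmas rat_along_intros = rat_along_const rat_along_id rat_along_add rat_along_mult
  rat_along_uminus rat_along_diff rat_along_sum

lemma rat_along_polyfun:
  assumes "polyfun UNIV f"
    "\<And>i j. rat_along q (\<lambda>s. g s $ i $ j)" "\<And>i j. rat_along q (\<lambda>s. h s $ i $ j)"
  shows "rat_along q (\<lambda>s. f (g s) (h s))"
  using assms(1) by induction (auto intro: rat_along_intros assms(2,3))

text \<open>Infinitely many zeros of f are roots of its numerator, which is therefore the zero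
  polynomial.\<close>

lemma rat_along_eq_0:
  assumes "rat_along q f" "infinite {s. poly q s \<noteq> 0 \<and> f s = 0}" "poly q s \<noteq> 0"
  shows "f s = 0"
proof -
  obtain p n where f: "\<And>s. poly q s \<noteq> 0 \<Longrightarrow> f s * poly q s ^ n = poly p s"
    using assms unfolding rat_along_def by metis
  have "{s. poly q s \<noteq> 0 \<and> f s = 0} \<subseteq> {s. poly p s = 0}"
    using f by force
  then have "p = 0"
    using assms(2) poly_roots_finite infinite_super by blast
  then show ?thesis
    using f[OF assms(3)] assms(3) by simp
qed


section \<open>Translations preserving a vanishing ideal\<close>

definition vanishes_on :: "('a \<Rightarrow> 'b \<Rightarrow> 'c::zero) \<Rightarrow> ('a \<times> 'b) set \<Rightarrow> bool" where
  "vanishes_on f Z \<longleftrightarrow> (\<forall>(A, B)\<in>Z. f A B = 0)"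

text \<open>The left translations that map the vanishing ideal of Z into itself. For a
  multiplicatively closed Z containing the identity this is the Zariski closure of Z, but in this
  form closure under products is immediate.\<close>

definition transporter :: "(('a::field_char_0^'t^'t) \<times> ('a^'t^'t)) set \<Rightarrow> (('a^'t^'t) \<times> ('a^'t^'t)) set" where
  "transporter Z = {(M, N). \<forall>f. polyfun UNIV f \<longrightarrow> vanishes_on f Z \<longrightarrow>
     vanishes_on (\<lambda>A B. f (M ** A) (N ** B)) Z}"

lemma transporter_mult:
  assumes "(M, N) \<in> transporter Z" "(M', N') \<in> transporter Z"
  shows "(M ** M', N ** N') \<in> transporter Z"
  unfolding transporter_def
proof clarify
  fix f assume f: "polyfun UNIV f" "vanishes_on f Z"
  have "vanishes_on (\<lambda>A B. f (M ** A) (N ** B)) Z"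
    using assms(1) f unfolding transporter_def by blast
  with assms(2) polyfun_translate_left[OF f(1), of M N]
  have "vanishes_on (\<lambda>A B. f (M ** (M' ** A)) (N ** (N' ** B))) Z"
    unfolding transporter_def by blast
  then show "vanishes_on (\<lambda>A B. f ((M ** M') ** A) ((N ** N') ** B)) Z"
    by (simp add: matrix_mul_assoc)
qed

text \<open>The translate of f still vanishes on Z; evaluate it at the identity.\<close>

lemma transporter_vanishes:
  assumes "polyfun UNIV f" "vanishes_on f Z" "(mat 1, mat 1) \<in> Z" "(M, N) \<in> transporter Z"
  shows "f M N = 0"
proof -
  have "vanishes_on (\<lambda>A B. f (M ** A) (N ** B)) Z"
    using assms unfolding transporter_def by blast
  then show ?thesis
    using assms(3) unfolding vanishes_on_def by fastforce
qed

text \<open>For a fixed f in the ideal and a fixed point of Z, the translated value is a rational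
  function of s with infinitely many zeros.\<close>

lemma transporter_line:
  assumes g: "\<And>i j. rat_along q (\<lambda>s. g s $ i $ j)" and h: "\<And>i j. rat_along q (\<lambda>s. h s $ i $ j)"
    and inf: "infinite {s. poly q s \<noteq> 0 \<and> (g s, h s) \<in> transporter Z}"
    and nz: "poly q s \<noteq> 0"
  shows "(g s, h s) \<in> transporter Z"
  unfolding transporter_def vanishes_on_def
proof clarify
  fix f A B assume f: "polyfun UNIV f" and van: "\<forall>(A, B)\<in>Z. f A B = 0" and AB: "(A, B) \<in> Z"
  have "rat_along q (\<lambda>s. f (g s ** A) (h s ** B))"
    by (rule rat_along_polyfun[OF f])
      (auto simp: matrix_matrix_mult_def intro!: rat_along_intros g h)
  moreover have "{s. poly q s \<noteq> 0 \<and> (g s, h s) \<in> transporter Z}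
      \<subseteq> {s. poly q s \<noteq> 0 \<and> f (g s ** A) (h s ** B) = 0}"
    using f van AB unfolding transporter_def vanishes_on_def by blast
  ultimately show "f (g s ** A) (h s ** B) = 0"
    using rat_along_eq_0[OF _ _ nz] inf infinite_super by blast
qed

definition upd :: "'a^'n \<Rightarrow> 'n \<Rightarrow> 'a \<Rightarrow> 'a^'n" where
  "upd v i s = (\<chi> j. if j = i then s else v $ j)"

lemma upd_nth [simp]: "upd v i s $ j = (if j = i then s else v $ j)"
  by (simp add: upd_def)

lemma upd_same [simp]: "upd v i (v $ i) = v"
  by (simp add: vec_eq_iff)

lemma rat_along_upd: "rat_along q (\<lambda>s. upd v i s $ j)"
  by (cases "j = i") (auto intro: rat_along_intros)

text \<open>The many-parameter version: the coordinates are freed from D one at a time. On each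
  coordinate line the restriction of d is a nonzero polynomial, so discarding its roots leaves
  infinitely many points of D.\<close>

lemma transporter_multiline:
  fixes g h :: "'a::field_char_0^'n \<Rightarrow> 'a^'t^'t"
  assumes rat: "\<And>v i. \<exists>q. (\<forall>s. poly q s = d (upd v i s)) \<and>
      (\<forall>a b. rat_along q (\<lambda>s. g (upd v i s) $ a $ b)) \<and>
      (\<forall>a b. rat_along q (\<lambda>s. h (upd v i s) $ a $ b))"
    and inf: "infinite D"
    and D: "\<And>v. (\<And>i. v $ i \<in> D) \<Longrightarrow> d v \<noteq> 0 \<Longrightarrow> (g v, h v) \<in> transporter Z"
    and nz: "d v \<noteq> 0"
  shows "(g v, h v) \<in> transporter Z"
proof -
  \<comment> \<open>S collects the coordinates that are already allowed to leave D.\<close>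
  have "\<forall>v. d v \<noteq> 0 \<longrightarrow> {i. v $ i \<notin> D} \<subseteq> S \<longrightarrow> (g v, h v) \<in> transporter Z" if "finite S" for S
    using that
  proof (induction S rule: finite_induct)
    case empty
    then show ?case using D by auto
  next
    case (insert i S)
    show ?case
    proof (intro allI impI)
      fix v assume v: "d v \<noteq> 0" "{i. v $ i \<notin> D} \<subseteq> insert i S"
      obtain q where q: "\<And>s. poly q s = d (upd v i s)"
        and gh: "\<And>a b. rat_along q (\<lambda>s. g (upd v i s) $ a $ b)"
          "\<And>a b. rat_along q (\<lambda>s. h (upd v i s) $ a $ b)"
        using rat[of v i] by blast
      have q0: "poly q (v $ i) \<noteq> 0" using v q by simp
      then have "finite {s. poly q s = 0}" by (intro poly_roots_finite) auto
      then have "infinite (D - {s. poly q s = 0})" using inf by simp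
      moreover have "D - {s. poly q s = 0}
          \<subseteq> {s. poly q s \<noteq> 0 \<and> (g (upd v i s), h (upd v i s)) \<in> transporter Z}"
      proof clarify
        fix s assume s: "s \<in> D" "poly q s \<noteq> 0"
        have "{j. upd v i s $ j \<notin> D} \<subseteq> S"
          using v(2) s(1) by auto
        then show "(g (upd v i s), h (upd v i s)) \<in> transporter Z"
          using insert.IH q s by auto
      qed
      ultimately have "infinite {s. poly q s \<noteq> 0 \<and> (g (upd v i s), h (upd v i s)) \<in> transporter Z}"
        using infinite_super by blast
      from transporter_line[OF gh this q0] show "(g v, h v) \<in> transporter Z" by simp
    qed
  qed
  from this[of UNIV] nz show ?thesis by simp
qed


section \<open>Rank-one perturbations of the identity\<close>

text \<open>The matrix I + a b^tr. Elementary matrices, dilations, reflections and transvections all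
  have this shape, so their products and inverses are computed only once.\<close>

definition pert :: "'a::comm_ring_1^'t \<Rightarrow> 'a^'t \<Rightarrow> 'a^'t^'t" where
  "pert a b = (\<chi> i j. of_bool (i = j) + a $ i * b $ j)"

lemma scalar_product_commute: "scalar_product x y = scalar_product y (x::'a::comm_semiring_1^'t)"
  by (simp add: scalar_product_def mult.commute)

lemma scalar_product_add_right:
  "scalar_product x (y + z) = scalar_product x y + scalar_product x (z::'a::comm_ring_1^'t)"
  by (simp add: scalar_product_def sum.distrib algebra_simps)

lemma scalar_product_add_left:
  "scalar_product (y + z) x = scalar_product y x + scalar_product z (x::'a::comm_ring_1^'t)"
  by (simp add: scalar_product_def sum.distrib algebra_simps)

lemma scalar_product_diff_right:
  "scalar_product x (y - z) = scalar_product x y - scalar_product x (z::'a::comm_ring_1^'t)"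
  by (simp add: scalar_product_def sum_subtractf algebra_simps)

lemma scalar_product_diff_left:
  "scalar_product (y - z) x = scalar_product y x - scalar_product z (x::'a::comm_ring_1^'t)"
  by (simp add: scalar_product_def sum_subtractf algebra_simps)

lemma scalar_product_scale_right:
  "scalar_product x (c *s y) = c * scalar_product x (y::'a::comm_ring_1^'t)"
  by (simp add: scalar_product_def sum_distrib_left mult_ac)

lemma scalar_product_scale_left:
  "scalar_product (c *s x) y = c * scalar_product x (y::'a::comm_ring_1^'t)"
  by (simp add: scalar_product_def sum_distrib_left mult_ac)

lemma scalar_product_minus_right:
  "scalar_product x (- y) = - scalar_product x (y::'a::comm_ring_1^'t)"
  by (simp add: scalar_product_def sum_negf)

lemma scalar_product_minus_left:
  "scalar_product (- x) y = - scalar_product x (y::'a::comm_ring_1^'t)"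
  by (simp add: scalar_product_def sum_negf)

lemma scalar_product_axis_right [simp]: "scalar_product x (axis i 1) = (x::'a::comm_ring_1^'t) $ i"
  by (simp add: scalar_product_def axis_def if_distrib[of "\<lambda>z. _ * z"] cong: if_cong)

lemma scalar_product_axis_left [simp]: "scalar_product (axis i 1) x = (x::'a::comm_ring_1^'t) $ i"
  by (simp add: scalar_product_commute[of "axis i 1"])

lemmas scalar_product_simps = scalar_product_add_left scalar_product_add_right
  scalar_product_diff_left scalar_product_diff_right scalar_product_scale_left
  scalar_product_scale_right scalar_product_minus_left scalar_product_minus_right

lemma axis_one_nth: "axis i 1 $ j = of_bool (j = i)"
  by (simp add: axis_def)

lemma sum_of_bool_left: "(\<Sum>k\<in>UNIV. of_bool (i = k) * f k) = (f (i::'t::finite) :: 'a::comm_ring_1)"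
  by (simp add: of_bool_def if_distrib[of "\<lambda>z. z * _"] cong: if_cong)

lemma pert_mult_vec: "pert a b *v x = x + scalar_product b x *s a"
proof -
  have "(\<Sum>j\<in>UNIV. (of_bool (i = j) + a $ i * b $ j) * x $ j) =
      (\<Sum>j\<in>UNIV. of_bool (i = j) * x $ j) + (\<Sum>j\<in>UNIV. b $ j * x $ j) * a $ i" for i
    unfolding sum_distrib_right sum.distrib[symmetric]
    by (intro sum.cong refl) (simp add: algebra_simps)
  then show ?thesis
    by (simp add: vec_eq_iff pert_def matrix_vector_mult_def scalar_product_def sum_of_bool_left)
qed

lemma column_matrix_mult: "column j (A ** B) = A *v column j (B::'a::comm_ring_1^'n^'t)"
  by (simp add: vec_eq_iff column_def matrix_matrix_mult_def matrix_vector_mult_def)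

lemma matrix_eq_columns: "(\<And>j. column j A = column j B) \<Longrightarrow> A = B"
  by (auto simp: vec_eq_iff column_def)

lemma pert_mult_pert:
  "pert a b ** pert c b = pert (a + c + scalar_product b c *s a) b"
proof (rule matrix_eq_columns)
  fix j
  have col: "column j (pert c b) = axis j 1 + (b $ j) *s c" for c
    by (simp add: vec_eq_iff column_def pert_def axis_one_nth)
  show "column j (pert a b ** pert c b) = column j (pert (a + c + scalar_product b c *s a) b)"
    by (simp add: column_matrix_mult col pert_mult_vec scalar_product_simps vec_eq_iff algebra_simps)
qed

lemma pert_0: "pert 0 b = mat 1"
  by (simp add: pert_def mat_def vec_eq_iff)

lemma transpose_pert: "transpose (pert a b) = pert b a"
  by (auto simp: pert_def transpose_def vec_eq_iff mult.commute)

text \<open>The Sherman-Morrison formula: the inverse perturbs along the same line, with a factor c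
  determined by 1 + c + c (b . a) = 0.\<close>

lemma pert_inverse:
  fixes a b :: "'a::field^'t"
  assumes "1 + scalar_product b a \<noteq> 0"
  shows "pert a b ** pert ((- 1 / (1 + scalar_product b a)) *s a) b = mat 1"
proof -
  define c where "c = - 1 / (1 + scalar_product b a)"
  have c: "1 + c + scalar_product b a * c = 0"
    using assms by (simp add: c_def divide_simps)
  have "a + c *s a + scalar_product b (c *s a) *s a = (1 + c + scalar_product b a * c) *s a"
    by (simp add: vec_eq_iff scalar_product_scale_right algebra_simps)
  then show ?thesis unfolding c_def[symmetric] by (simp add: pert_mult_pert pert_0 c)
qed

lemma pert_inverse':
  fixes a b :: "'a::field^'t"
  assumes "1 + scalar_product b a \<noteq> 0"
  shows "pert ((- 1 / (1 + scalar_product b a)) *s a) b ** pert a b = mat 1"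
  using pert_inverse[OF assms] matrix_left_right_inverse by blast

lemma invertible_pert:
  fixes a b :: "'a::field^'t"
  assumes "1 + scalar_product b a \<noteq> 0"
  shows "invertible (pert a b)"
  using pert_inverse[OF assms] pert_inverse'[OF assms] unfolding invertible_def by blast


section \<open>Generators of the classical groups\<close>

lemma eq_mat_1_columnsI: "(\<And>j. column j A = axis j 1) \<Longrightarrow> A = mat 1"
  by (rule matrix_eq_columns) (auto simp: vec_eq_iff column_def mat_def axis_def)

lemma column_eq_axis_iff: "column j A = axis j 1 \<longleftrightarrow> (\<forall>i. A $ i $ j = of_bool (i = j))"
  by (simp add: vec_eq_iff column_def axis_one_nth)

lemma pert_axis_mult_nth:
  "(pert (s *s axis i 1) (axis j 1) ** A) $ a $ b = A $ a $ b + (if a = i then s * A $ j $ b else 0)"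
proof -
  have "column b (pert (s *s axis i 1) (axis j 1) ** A) $ a
      = A $ a $ b + (if a = i then s * A $ j $ b else 0)"
    by (simp add: column_matrix_mult pert_mult_vec) (simp add: column_def axis_def)
  then show ?thesis by (simp add: column_def)
qed

text \<open>Row operations clear column k. The finished columns in F survive because their entries
  in the row being added (or scaled) are zero: that row is k itself, or a row outside F. The
  property P is pulled back along each operation.\<close>

lemma GL_induct_step:
  fixes A :: "'a::field^'t^'t"
  assumes IH: "\<And>B. invertible B \<Longrightarrow> \<forall>j\<in>insert k F. column j B = axis j 1 \<Longrightarrow> P B"
    and add: "\<And>i j s A. i \<noteq> j \<Longrightarrow> P (pert (s *s axis i 1) (axis j 1) ** A) \<Longrightarrow> P A"
    and scale: "\<And>i s A. s \<noteq> 0 \<Longrightarrow> P (pert ((s - 1) *s axis i 1) (axis i 1) ** A) \<Longrightarrow> P A"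
    and A: "invertible A" "\<forall>j\<in>F. column j A = axis j 1" and k: "k \<notin> F"
  shows "P A"
proof -
  have inv_add: "invertible (pert (s *s axis i 1) (axis j 1) ** A)"
    if "i \<noteq> j" "invertible A" for i j s and A :: "'a^'t^'t"
    using that
    by (intro invertible_mult invertible_pert)
      (auto simp: scalar_product_simps axis_one_nth)
  have one: "P A" if "invertible A" "\<forall>j\<in>F. column j A = axis j 1" "A $ k $ k = 1" for A
    using that
  proof (induction "card {l. l \<noteq> k \<and> A $ l $ k \<noteq> 0}" arbitrary: A rule: less_induct)
    case less
    show ?case
    proof (cases "{l. l \<noteq> k \<and> A $ l $ k \<noteq> 0} = {}")
      case True
      then have "column k A = axis k 1"
        using less.prems(3) by (auto simp: column_eq_axis_iff)
      then show ?thesis using less.prems by (intro IH) auto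
    next
      case False
      then obtain l where l: "l \<noteq> k" "A $ l $ k \<noteq> 0" by blast
      define B where "B = pert ((- A $ l $ k) *s axis l 1) (axis k 1) ** A"
      have nth: "B $ a $ b = A $ a $ b + (if a = l then (- A $ l $ k) * A $ k $ b else 0)" for a b
        unfolding B_def by (rule pert_axis_mult_nth)
      have "{m. m \<noteq> k \<and> B $ m $ k \<noteq> 0} \<subset> {m. m \<noteq> k \<and> A $ m $ k \<noteq> 0}"
        using l less.prems(3) by (auto simp: nth split: if_splits)
      then have "P B"
      proof (intro less.hyps psubset_card_mono)
        show "invertible B"
          unfolding B_def using l(1) less.prems(1) by (rule inv_add)
        show "\<forall>j\<in>F. column j B = axis j 1" "B $ k $ k = 1"
          using l less.prems k by (auto simp: nth column_eq_axis_iff)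
      qed simp
      then show ?thesis unfolding B_def by (rule add[rotated]) (use l in auto)
    qed
  qed
  have nonzero: "P A" if A: "invertible A" "\<forall>j\<in>F. column j A = axis j 1" "A $ k $ k \<noteq> 0" for A
  proof -
    define s where "s = 1 / A $ k $ k"
    have s: "s \<noteq> 0" using A(3) by (simp add: s_def)
    define B where "B = pert ((s - 1) *s axis k 1) (axis k 1) ** A"
    have nth: "B $ a $ b = A $ a $ b + (if a = k then (s - 1) * A $ k $ b else 0)" for a b
      unfolding B_def by (rule pert_axis_mult_nth)
    have "P B"
    proof (rule one)
      show "invertible B"
        unfolding B_def using A(1) s
        by (intro invertible_mult invertible_pert) (auto simp: scalar_product_simps axis_one_nth)
      show "\<forall>j\<in>F. column j B = axis j 1"
        using A(2) k by (auto simp: nth column_eq_axis_iff)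
      show "B $ k $ k = 1"
        using A(3) by (simp add: nth s_def field_simps)
    qed
    then show ?thesis unfolding B_def by (rule scale[rotated]) (use s in auto)
  qed
  show "P A"
  proof (cases "A $ k $ k = 0")
    case False
    then show ?thesis using nonzero A by blast
  next
    case True
    \<comment> \<open>Otherwise column k is a combination of basis vectors fixed by A, so A sends
      both it and \<open>axis k 1\<close> to column k. Injectivity makes the two equal,
      contradicting the zero pivot.\<close>
    have "\<exists>l. l \<notin> F \<and> A $ l $ k \<noteq> 0"
    proof (rule ccontr)
      assume "\<not> ?thesis"
      then have 0: "A $ l $ k = 0" if "l \<notin> F" for l using that by blast
      define x where "x = axis k 1 - (\<chi> j. A $ j $ k)"
      have "A *v (\<chi> j. A $ j $ k) = (\<chi> j. A $ j $ k)"
      proof -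
        have "(\<Sum>j\<in>UNIV. A $ i $ j * A $ j $ k) = (\<Sum>j\<in>UNIV. of_bool (i = j) * A $ j $ k)" for i
        proof (intro sum.cong refl)
          fix j
          show "A $ i $ j * A $ j $ k = of_bool (i = j) * A $ j $ k"
            using A(2) 0[of j] by (cases "j \<in> F") (simp_all add: column_eq_axis_iff)
        qed
        then show ?thesis by (simp add: vec_eq_iff matrix_vector_mult_def sum_of_bool_left)
      qed
      moreover have "A *v axis k 1 = (\<chi> j. A $ j $ k)"
        by (simp add: vec_eq_iff matrix_vector_mult_def axis_def if_distrib[of "\<lambda>z. _ * z"] cong: if_cong)
      ultimately have "A *v x = 0" by (simp add: x_def matrix_vector_mult_diff_distrib)
      then have "x = 0"
        using A(1) matrix_left_invertible_ker unfolding invertible_def by blast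
      then have "x $ k = 0" by simp
      then show False using True by (simp add: x_def axis_def)
    qed
    then obtain l where l: "l \<notin> F" "A $ l $ k \<noteq> 0" by blast
    with True have "l \<noteq> k" by auto
    \<comment> \<open>Adding row l to row k produces a nonzero pivot.\<close>
    define B where "B = pert (1 *s axis k 1) (axis l 1) ** A"
    have nth: "B $ a $ b = A $ a $ b + (if a = k then 1 * A $ l $ b else 0)" for a b
      unfolding B_def by (rule pert_axis_mult_nth)
    have "P B"
    proof (rule nonzero)
      show "invertible B" unfolding B_def by (rule inv_add) (use A(1) \<open>l \<noteq> k\<close> in auto)
      show "\<forall>j\<in>F. column j B = axis j 1"
        using A(2) k l by (auto simp: nth column_eq_axis_iff)
      show "B $ k $ k \<noteq> 0" using True l by (simp add: nth)
    qed
    then show ?thesis unfolding B_def by (rule add[rotated]) (use \<open>l \<noteq> k\<close> in auto)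
  qed
qed

lemma GL_induct [consumes 1, case_names one add scale]:
  fixes A :: "'a::field^'t^'t"
  assumes "invertible A" and one: "P (mat 1)"
    and add: "\<And>i j s A. i \<noteq> j \<Longrightarrow> P (pert (s *s axis i 1) (axis j 1) ** A) \<Longrightarrow> P A"
    and scale: "\<And>i s A. s \<noteq> 0 \<Longrightarrow> P (pert ((s - 1) *s axis i 1) (axis i 1) ** A) \<Longrightarrow> P A"
  shows "P A"
proof -
  have "\<forall>A. invertible A \<longrightarrow> (\<forall>j\<in>-S. column j A = axis j 1) \<longrightarrow> P A" if "finite S" for S
    using that
  proof (induction S rule: finite_induct)
    case empty
    have "A = mat 1" if "\<forall>j. column j A = axis j 1" for A :: "'a^'t^'t"
      using that by (intro eq_mat_1_columnsI) auto
    then show ?case using one by auto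
  next
    case (insert k S)
    then have *: "insert k (- insert k S) = - S" by auto
    show ?case
    proof (intro allI impI)
      fix A :: "'a^'t^'t"
      assume A: "invertible A" "\<forall>j\<in>-insert k S. column j A = axis j 1"
      show "P A"
      proof (rule GL_induct_step[where k = k and F = "- insert k S"])
        show "P B" if "invertible B" "\<forall>j\<in>insert k (- insert k S). column j B = axis j 1" for B
          using insert.IH that unfolding * by blast
      qed (fact A add scale | simp)+
    qed
  qed
  from this[of UNIV] assms(1) show ?thesis by auto
qed

definition refl_mat :: "'a::field^'t \<Rightarrow> 'a^'t^'t" where
  "refl_mat u = pert ((- 2 / scalar_product u u) *s u) u"

lemma refl_mat_vec: "refl_mat u *v x = x - (2 * scalar_product u x / scalar_product u u) *s u"
  by (simp add: refl_mat_def pert_mult_vec vec_eq_iff algebra_simps)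

lemma refl_mat_refl_mat:
  assumes "scalar_product u u \<noteq> 0"
  shows "refl_mat u ** refl_mat u = mat 1"
  using pert_inverse[of u "(- 2 / scalar_product u u) *s u"] assms
  by (simp add: refl_mat_def scalar_product_simps)

lemma transpose_refl_mat [simp]: "transpose (refl_mat u) = refl_mat u"
  by (simp add: refl_mat_def transpose_pert) (simp add: pert_def vec_eq_iff)

lemma orthogonal_mult:
  fixes A B :: "'a::comm_ring_1^'t^'t"
  assumes "transpose A ** A = mat 1" "transpose B ** B = mat 1"
  shows "transpose (A ** B) ** (A ** B) = mat 1"
proof -
  have "transpose (A ** B) ** (A ** B) = transpose B ** (transpose A ** A) ** B"
    by (simp only: matrix_transpose_mul matrix_mul_assoc)
  then show ?thesis by (simp add: assms)
qed

lemma transpose_mult_nth: "(transpose A ** B) $ i $ j = scalar_product (column i A) (column j B)"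
  by (simp add: transpose_def matrix_matrix_mult_def scalar_product_def column_def)

text \<open>
  A vector of norm one is moved to a basis vector by the reflection in their difference, or, if
  that difference is isotropic, by the reflection in their sum followed by a sign change.
\<close>

lemma orthogonal_induct [consumes 1, case_names one refl_mat]:
  fixes A :: "'a::field_char_0^'t^'t"
  assumes "transpose A ** A = mat 1" and one: "P (mat 1)"
    and refl_mat: "\<And>u A. scalar_product u u \<noteq> 0 \<Longrightarrow> P (refl_mat u ** A) \<Longrightarrow> P A"
  shows "P A"
  using assms(1)
proof (induction "card {j. column j A \<noteq> axis j 1}" arbitrary: A rule: less_induct)
  case less
  have orth: "scalar_product (column i A) (column j A) = of_bool (i = j)"
    if "transpose A ** A = mat 1" for i j and A :: "'a^'t^'t"
    using arg_cong[OF that, of "\<lambda>M. M $ i $ j"] by (simp add: transpose_mult_nth mat_def)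
  have step: "P B" if B: "transpose B ** B = mat 1" "column i B = axis i 1" "column i A \<noteq> axis i 1"
    "\<And>j. column j A = axis j 1 \<Longrightarrow> column j B = axis j 1" for B i
    using B by (intro less.hyps psubset_card_mono) auto
  show ?case
  proof (cases "{j. column j A \<noteq> axis j 1} = {}")
    case True
    then have "A = mat 1"
      by (intro eq_mat_1_columnsI) auto
    then show ?thesis using one by simp
  next
    case False
    then obtain i where i: "column i A \<noteq> axis i 1" by blast
    define v where "v = column i A"
    have vv: "scalar_product v v = 1" using orth[OF less.prems, of i i] by (simp add: v_def)
    \<comment> \<open>Column i is orthogonal to the finished columns, so the vectors v - e_i and v +
      e_i vanish in those coordinates and their reflections keep those columns.\<close>
    have v0: "v $ j = 0" if "column j A = axis j 1" for j
      using orth[OF less.prems, of i j] that i by (auto simp: v_def)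
    have orth_refl: "transpose (refl_mat u ** B) ** (refl_mat u ** B) = mat 1"
      if "scalar_product u u \<noteq> 0" "transpose B ** B = mat 1" for u and B :: "'a^'t^'t"
      using that by (intro orthogonal_mult) (auto simp: refl_mat_refl_mat)
    define u where "u = v - axis i 1"
    have uu: "scalar_product u u = 2 - 2 * v $ i"
      by (simp add: u_def scalar_product_simps vv axis_one_nth)
    show ?thesis
    proof (cases "scalar_product u u = 0")
      case False
      have "P (refl_mat u ** A)"
      proof (rule step[OF _ _ i])
        show "transpose (refl_mat u ** A) ** (refl_mat u ** A) = mat 1"
          using orth_refl False less.prems by blast
        have "scalar_product u v = 1 - v $ i"
          by (simp add: u_def scalar_product_simps vv)
        then have "2 * scalar_product u v / scalar_product u u = 1"
          using False uu by (simp add: divide_simps)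
        then show "column i (refl_mat u ** A) = axis i 1"
          unfolding column_matrix_mult refl_mat_vec v_def[symmetric]
          by (simp add: u_def)
        fix j assume j: "column j A = axis j 1"
        moreover have "u $ j = 0" using v0[OF j] j i by (auto simp: u_def axis_def)
        ultimately show "column j (refl_mat u ** A) = axis j 1"
          by (simp add: column_matrix_mult refl_mat_vec)
      qed
      then show ?thesis by (rule refl_mat[rotated]) (use False in auto)
    next
      case True
      then have vi: "v $ i = 1" using uu by simp
      \<comment> \<open>In the isotropic case v $ i = 1, hence w has norm 4, which is nonzero in
        characteristic zero. The reflection in w sends v to -e_i.\<close>
      define w where "w = v + axis i 1"
      have ww: "scalar_product w w = 4"
        by (simp add: w_def scalar_product_simps vv vi axis_one_nth)
      have wv: "scalar_product w v = 2"
        by (simp add: w_def scalar_product_simps vv vi)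
      have ii: "scalar_product (axis i 1) (axis i 1 :: 'a^'t) = 1"
        by (simp add: axis_one_nth)
      have "P (refl_mat (axis i 1) ** (refl_mat w ** A))"
      proof (rule step[OF _ _ i])
        show "transpose (refl_mat (axis i 1) ** (refl_mat w ** A)) **
            (refl_mat (axis i 1) ** (refl_mat w ** A)) = mat 1"
          using orth_refl ww ii less.prems by simp
        show "column i (refl_mat (axis i 1) ** (refl_mat w ** A)) = axis i 1"
          unfolding column_matrix_mult refl_mat_vec v_def[symmetric] ww wv ii
          by (simp add: w_def vec_eq_iff axis_one_nth vi)
        fix j assume j: "column j A = axis j 1"
        moreover have "w $ j = 0" using v0[OF j] j i by (auto simp: w_def axis_def)
        moreover have "axis i 1 $ j = (0::'a)" using j i by (auto simp: axis_def)
        ultimately show "column j (refl_mat (axis i 1) ** (refl_mat w ** A)) = axis j 1"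
          by (simp add: column_matrix_mult refl_mat_vec)
      qed
      then have "P (refl_mat w ** A)" by (rule refl_mat[rotated]) (use ii in auto)
      then show ?thesis by (rule refl_mat[rotated]) (use ww in auto)
    qed
  qed
qed


subsection \<open>The symplectic group\<close>

lemma position_less: "position (i::'t::{finite,linorder}) < CARD('t)"
  unfolding position_def by (intro psubset_card_mono) auto

lemma position_inj: "inj (position :: 't::{finite,linorder} \<Rightarrow> nat)"
proof (rule injI)
  have less: "position i < position j" if "i < j" for i j :: 't
    unfolding position_def using that by (intro psubset_card_mono) (auto intro: less_trans)
  fix i j :: 't assume "position i = position j"
  then show "i = j" using less[of i j] less[of j i] by (metis less_irrefl linorder_cases)
qed

lemma position_range: "range (position :: 't::{finite,linorder} \<Rightarrow> nat) = {..<CARD('t)}"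
proof (rule card_subset_eq)
  show "range (position :: 't \<Rightarrow> nat) \<subseteq> {..<CARD('t)}" using position_less by auto
  show "card (range (position :: 't \<Rightarrow> nat)) = card {..<CARD('t)}"
    by (simp add: card_image position_inj)
qed simp

text \<open>The fixed-point-free involution pairing the two basis vectors of each hyperbolic plane;
  \<open>Omega\<close> is a signed permutation matrix along it. A partner map replaces the parity
  assumption and all later arithmetic with positions.\<close>

definition is_partner :: "('t::{finite,linorder} \<Rightarrow> 't::{finite,linorder}) \<Rightarrow> bool" where
  "is_partner \<sigma> \<longleftrightarrow> even CARD('t::{finite,linorder}) \<and> (\<forall>i. \<sigma> (\<sigma> i) = i \<and> \<sigma> i \<noteq> i \<and>
     (position (\<sigma> i) = position i + CARD('t::{finite,linorder}) div 2 \<or> position i = position (\<sigma> i) + CARD('t::{finite,linorder}) div 2))"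

lemma ex_partner:
  assumes "even CARD('t::{finite,linorder})"
  shows "\<exists>\<sigma>::'t \<Rightarrow> 't. is_partner \<sigma>"
proof -
  let ?s = "CARD('t) div 2"
  have s: "CARD('t) = 2 * ?s" "?s > 0" using assms zero_less_card_finite[where 'a = 't] by (auto elim!: evenE simp del: zero_less_card_finite)
  define \<tau> where "\<tau> p = (if p < ?s then p + ?s else p - ?s)" for p
  define \<sigma> :: "'t \<Rightarrow> 't" where "\<sigma> i = inv position (\<tau> (position i))" for i
  have \<sigma>: "position (\<sigma> i) = \<tau> (position i)" for i
  proof -
    have "\<tau> (position i) < CARD('t)" using position_less[of i] s by (auto simp: \<tau>_def)
    then have "\<tau> (position i) \<in> range (position :: 't \<Rightarrow> nat)" by (simp add: position_range)
    then show ?thesis unfolding \<sigma>_def by (rule f_inv_into_f)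
  qed
  have "is_partner \<sigma>"
    unfolding is_partner_def
  proof (intro allI conjI assms)
    fix i
    have "position (\<sigma> (\<sigma> i)) = position i"
      using position_less[of i] s by (auto simp: \<sigma> \<tau>_def)
    then show "\<sigma> (\<sigma> i) = i" by (rule injD[OF position_inj])
    have "position (\<sigma> i) \<noteq> position i"
      using s by (auto simp: \<sigma> \<tau>_def)
    then show "\<sigma> i \<noteq> i" by auto
    show "position (\<sigma> i) = position i + ?s \<or> position i = position (\<sigma> i) + ?s"
      by (auto simp: \<sigma> \<tau>_def)
  qed
  then show ?thesis by blast
qed

definition sform :: "'a::ring_1^('t::{finite,linorder}) \<Rightarrow> 'a^('t::{finite,linorder}) \<Rightarrow> 'a" where
  "sform x y = scalar_product x (Omega *v y)"

context
  fixes \<sigma> :: "'t::{finite,linorder} \<Rightarrow> 't"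
  assumes \<sigma>: "is_partner \<sigma>"
begin

lemma partner_partner: "\<sigma> (\<sigma> i) = i" and partner_neq: "\<sigma> i \<noteq> i"
  using \<sigma> by (auto simp: is_partner_def)

lemma half_pos: "CARD('t) div 2 > 0"
  using partner_neq[of undefined] \<sigma> injD[OF position_inj, of "\<sigma> undefined" undefined]
  unfolding is_partner_def by (metis add.right_neutral gr0I)

lemma Omega_partner_cases:
  "(Omega $ i $ \<sigma> i = (1::'a::ring_1) \<and> Omega $ \<sigma> i $ i = (-1::'a)) \<or>
   (Omega $ i $ \<sigma> i = (-1::'a) \<and> Omega $ \<sigma> i $ i = (1::'a))"
proof -
  have "position (\<sigma> i) = position i + CARD('t) div 2 \<or> position i = position (\<sigma> i) + CARD('t) div 2"
    using \<sigma> unfolding is_partner_def by blast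
  then show ?thesis using half_pos by (auto simp: Omega_def)
qed

lemma Omega_partner_neq_0: "Omega $ i $ \<sigma> i \<noteq> (0::'a::ring_1)"
  using Omega_partner_cases[of i, where 'a = 'a] by auto

lemma Omega_eq_0:
  assumes "j \<noteq> \<sigma> i"
  shows "Omega $ i $ j = (0::'a::ring_1)"
proof (rule ccontr)
  let ?s = "CARD('t) div 2"
  assume "\<not> ?thesis"
  then have 1: "position j = position i + ?s \<or> position i = position j + ?s"
    by (auto simp: Omega_def split: if_splits)
  have 2: "position (\<sigma> i) = position i + ?s \<or> position i = position (\<sigma> i) + ?s"
    using \<sigma> unfolding is_partner_def by blast
  \<comment> \<open>Since all positions lie below twice the half size, only one index is at distance
    exactly the half size from i.\<close>
  have 3: "position j < 2 * ?s" "position i < 2 * ?s" "position (\<sigma> i) < 2 * ?s"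
  proof -
    have "even CARD('t)" using \<sigma> unfolding is_partner_def by blast
    then show "position j < 2 * ?s" "position i < 2 * ?s" "position (\<sigma> i) < 2 * ?s"
      using position_less[of j] position_less[of i] position_less[of "\<sigma> i"] by auto
  qed
  have "position j = position (\<sigma> i)" using 1 2 3 by auto
  then show False using assms injD[OF position_inj] by blast
qed

lemma Omega_mult_vec_nth: "(Omega *v (x::('a::comm_ring_1, 't) vec)) $ i = Omega $ i $ \<sigma> i * x $ \<sigma> i"
proof -
  have "(\<Sum>j\<in>UNIV. Omega $ i $ j * x $ j) = (\<Sum>j\<in>{\<sigma> i}. Omega $ i $ j * x $ j)"
    by (rule sum.mono_neutral_right) (auto simp: Omega_eq_0)
  then show ?thesis by (simp add: matrix_vector_mult_def)
qed

lemma Omega_antisym: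
  fixes i j :: "'t"
  shows "Omega $ i $ j = - (Omega $ j $ i :: 'a::ring_1)"
proof (cases "j = \<sigma> i")
  case True
  then show ?thesis using Omega_partner_cases[of i, where 'a = 'a] by auto
next
  case False
  then have "i \<noteq> \<sigma> j" using partner_partner by metis
  with False show ?thesis by (simp add: Omega_eq_0)
qed

lemma Omega_Omega: "Omega *v (Omega *v (x::('a::comm_ring_1, 't) vec)) = - x"
  using Omega_partner_cases[where 'a = 'a]
  by (auto simp: vec_eq_iff Omega_mult_vec_nth partner_partner) (metis mult_minus1 mult_1 mult_minus_left)

lemma sform_antisym: "sform x y = - sform y (x::('a::comm_ring_1, 't) vec)"
proof -
  have "sform x y = (\<Sum>i\<in>UNIV. \<Sum>j\<in>UNIV. x $ i * Omega $ i $ j * y $ j)"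
    by (simp add: sform_def scalar_product_def matrix_vector_mult_def sum_distrib_left mult.assoc)
  also have "\<dots> = (\<Sum>j\<in>UNIV. \<Sum>i\<in>UNIV. x $ i * Omega $ i $ j * y $ j)"
    by (rule sum.swap)
  also have "\<dots> = (\<Sum>j\<in>UNIV. \<Sum>i\<in>UNIV. - (y $ j * Omega $ j $ i * x $ i))"
    by (intro sum.cong refl, subst Omega_antisym) (simp add: mult_ac)
  also have "\<dots> = - sform y x"
    by (simp add: sform_def scalar_product_def matrix_vector_mult_def sum_distrib_left mult.assoc sum_negf)
  finally show ?thesis .
qed

lemma sform_self: "sform x (x::('a::field_char_0, 't) vec) = 0"
  using sform_antisym[of x x] by simp

lemma sform_axis_axis: "sform (axis i 1) (axis j (1::'a::comm_ring_1)) = Omega $ i $ j"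
  by (simp add: sform_def) (simp add: matrix_vector_mult_def axis_def if_distrib[of "\<lambda>z. _ * z"] cong: if_cong)

lemma sform_axis_left: "sform (axis i 1) x = Omega $ i $ \<sigma> i * (x::('a::comm_ring_1, 't) vec) $ \<sigma> i"
  by (simp add: sform_def Omega_mult_vec_nth)

end

lemma matrix_vector_scale: "A *v (c *s x) = c *s (A *v (x::'a::comm_ring_1^'t))"
  by (simp add: vec_eq_iff matrix_vector_mult_def sum_distrib_left mult_ac)

lemma sform_simps:
  fixes x y z :: "'a::comm_ring_1^('t::{finite,linorder})"
  shows "sform (x + y) z = sform x z + sform y z" "sform z (x + y) = sform z x + sform z y"
    "sform (x - y) z = sform x z - sform y z" "sform z (x - y) = sform z x - sform z y"
    "sform (c *s x) z = c * sform x z" "sform z (c *s x) = c * sform z x"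
  by (simp_all add: sform_def scalar_product_simps matrix_vector_right_distrib
      matrix_vector_mult_diff_distrib matrix_vector_scale)

text \<open>The transvection \<open>x \<mapsto> x + s \<omega>(x, u) u\<close>.\<close>

definition transvec :: "'a::comm_ring_1^('t::{finite,linorder}) \<Rightarrow> 'a \<Rightarrow> ('a, 't::{finite,linorder}) sqmat" where
  "transvec u s = pert (s *s u) (Omega *v u)"

lemma transvec_vec: "transvec u s *v x = x + (s * sform x u) *s u"
  by (simp add: transvec_def pert_mult_vec sform_def scalar_product_commute vec_eq_iff mult_ac)

lemma symplectic_iff:
  "transpose A ** Omega ** A = Omega \<longleftrightarrow>
     (\<forall>i j. sform (column i A) (column j A) = (Omega $ i $ j :: 'a::comm_ring_1))"
proof -
  have "(transpose A ** Omega ** A) $ i $ j = sform (column i A) (column j A)" for i j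
    unfolding matrix_mul_assoc[symmetric] transpose_mult_nth column_matrix_mult sform_def ..
  then show ?thesis by (simp add: vec_eq_iff)
qed

lemma symplectic_mult:
  fixes A B :: "('a::comm_ring_1, 't::{finite,linorder}) sqmat"
  assumes "transpose A ** Omega ** A = Omega" "transpose B ** Omega ** B = Omega"
  shows "transpose (A ** B) ** Omega ** (A ** B) = Omega"
proof -
  have "transpose (A ** B) ** Omega ** (A ** B) = transpose B ** (transpose A ** Omega ** A) ** B"
    by (simp only: matrix_transpose_mul matrix_mul_assoc)
  then show ?thesis by (simp add: assms)
qed

lemma symplectic_transvec_mult:
  fixes A :: "('a::field_char_0, 't::{finite,linorder}) sqmat"
  assumes "is_partner (\<sigma>::'t \<Rightarrow> 't)" "transpose A ** Omega ** A = Omega"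
  shows "transpose (transvec u s ** A) ** Omega ** (transvec u s ** A) = Omega"
proof -
  have "sform (x + (s * sform x u) *s u) (y + (s * sform y u) *s u) = sform x y" for x y
    by (simp add: sform_simps sform_self[OF assms(1)] sform_antisym[OF assms(1), of u] algebra_simps)
  then show ?thesis
    using assms(2) unfolding symplectic_iff column_matrix_mult transvec_vec by simp
qed

text \<open>
  The basis vectors are fixed one hyperbolic pair at a time. A vector \<open>v\<close> is moved to \<open>z\<close> by the
  transvection along \<open>z - v\<close> if \<open>\<omega>(v, z) \<noteq> 0\<close>, and through an intermediate vector otherwise.
\<close>

lemma symplectic_induct [consumes 2, case_names one transvec]:
  fixes A :: "('a::field_char_0, 't::{finite,linorder}) sqmat"
  assumes "is_partner (\<sigma>::'t \<Rightarrow> 't)" "transpose A ** Omega ** A = Omega"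
    and one: "P (mat 1)" and transvec: "\<And>u s A. P (transvec u s ** A) \<Longrightarrow> P A"
  shows "P A"
proof -
  define sp where "sp A \<longleftrightarrow> transpose A ** Omega ** A = Omega" for A :: "('a, 't) sqmat"
  note \<sigma> = assms(1)
  have form: "sform (column i A) (column j A) = Omega $ i $ j" if "sp A" for A i j
    using that unfolding sp_def symplectic_iff by blast
  define fixed where "fixed S A \<longleftrightarrow> (\<forall>j. j \<notin> S \<longrightarrow> column j A = axis j 1)" for S and A :: "('a, 't) sqmat"
  have move: "P A" if A: "sp A" "sform (column i A) z \<noteq> 0"
    and B: "\<And>B. sp B \<Longrightarrow> column i B = z \<Longrightarrow>
      (\<And>j. sform (column j A) z = sform (column j A) (column i A) \<Longrightarrow> column j B = column j A) \<Longrightarrow> P B"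
    for A i z
  proof -
    define v where "v = column i A"
    \<comment> \<open>The coefficient solves v + c \<omega>(v, z - v) (z - v) = z, because
      \<omega>(v, v) = 0. A column stays put if its form with z - v vanishes.\<close>
    define B where "B = transvec (z - v) (1 / sform v z) ** A"
    have "P B"
    proof (rule B)
      show "sp B" using A(1) symplectic_transvec_mult[OF \<sigma>] unfolding B_def sp_def by blast
      show "column i B = z"
        using A(2) unfolding B_def column_matrix_mult transvec_vec v_def
        by (simp add: sform_simps sform_self[OF \<sigma>] vec_eq_iff)
      show "column j B = column j A" if "sform (column j A) z = sform (column j A) (column i A)" for j
        using that unfolding B_def column_matrix_mult transvec_vec v_def by (simp add: sform_simps)
    qed
    then show ?thesis unfolding B_def by (rule transvec)
  qed
  \<comment> \<open>S contains the indices whose columns may still be wrong. It is closed under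
    \<sigma>, so that whole hyperbolic pairs are removed from it.\<close>
  have "\<forall>A. sp A \<longrightarrow> fixed S A \<longrightarrow> P A" if "\<forall>i\<in>S. \<sigma> i \<in> S" for S
    using that
  proof (induction "card S" arbitrary: S rule: less_induct)
    case less
    show ?case
    proof (cases "S = {}")
      case True
      then show ?thesis using one eq_mat_1_columnsI unfolding fixed_def by blast
    next
      case False
      then obtain i where i: "i \<in> S" by blast
      define i' where "i' = \<sigma> i"
      have i': "i' \<in> S" "i' \<noteq> i" "\<sigma> i' = i"
        using i less.prems partner_neq[OF \<sigma>] partner_partner[OF \<sigma>] by (auto simp: i'_def)
      have O0: "Omega $ j $ i = (0::'a)" "Omega $ j $ i' = (0::'a)" if "j \<notin> S" for j
      proof -
        have "i \<noteq> \<sigma> j" "i' \<noteq> \<sigma> j"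
          using that i i' partner_partner[OF \<sigma>] by metis+
        then show "Omega $ j $ i = (0::'a)" "Omega $ j $ i' = (0::'a)"
          by (auto simp: Omega_eq_0[OF \<sigma>])
      qed
      have Oii': "Omega $ i $ i' \<noteq> (0::'a)" "Omega $ i' $ i \<noteq> (0::'a)"
        using Omega_partner_neq_0[OF \<sigma>] i'(3) by (metis i'_def)+
      have Oii: "Omega $ i $ i = (0::'a)" "Omega $ i' $ i' = (0::'a)"
        using Omega_eq_0[OF \<sigma>] i' i'_def by metis+
      have sub: "S - {i, i'} \<subset> S" using i by auto
      have IH: "P A" if "sp A" "fixed (S - {i, i'}) A" for A
      proof -
        have "card (S - {i, i'}) < card S" using sub by (intro psubset_card_mono) auto
        moreover have "\<forall>j\<in>S - {i, i'}. \<sigma> j \<in> S - {i, i'}"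
          using less.prems i' i'_def partner_partner[OF \<sigma>] by (metis Diff_iff insert_iff empty_iff)
        ultimately show ?thesis using less.hyps that by blast
      qed
      \<comment> \<open>The next facts run the procedure backwards: \<open>three\<close> places
        column i', \<open>two\<close> first makes that possible, \<open>one'\<close> places column
        i, and the final case first makes that possible.\<close>
      have three: "P A" if A: "sp A" "fixed S A" "column i A = axis i 1"
        "sform (column i' A) (axis i' 1) \<noteq> 0" for A
      proof (rule move[OF A(1,4)])
        fix B assume B: "sp B" "column i' B = axis i' 1"
          and keep: "\<And>j. sform (column j A) (axis i' 1) = sform (column j A) (column i' A) \<Longrightarrow>
            column j B = column j A"
        have "column j B = axis j 1" if "j \<notin> S \<or> j = i" for j
        proof -
          have c: "column j A = axis j 1" using that A unfolding fixed_def by blast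
          then have "sform (column j A) (axis i' 1) = sform (column j A) (column i' A)"
            unfolding form[OF A(1)] by (simp add: sform_axis_axis[OF \<sigma>])
          from keep[OF this] c show ?thesis by simp
        qed
        then have "fixed (S - {i, i'}) B" using B(2) unfolding fixed_def by auto
        then show "P B" using IH B(1) by blast
      qed
      have two: "P A" if A: "sp A" "fixed S A" "column i A = axis i 1" for A
      proof (cases "sform (column i' A) (axis i' 1) = 0")
        case False
        then show ?thesis using three A by blast
      next
        case True
        \<comment> \<open>This pairing is nonzero, so column i' can move to e_i' + e_i. The vector
          e_i is kept, since the added e_i does not change its form with the target, and from there
          e_i' is within reach.\<close>
        have e: "sform (column i' A) (axis i 1) = Omega $ i' $ i"
          using form[OF A(1), of i' i] A(3) by simp
        show ?thesis
        proof (rule move[OF A(1), of i' "axis i' 1 + axis i 1"])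
          show "sform (column i' A) (axis i' 1 + axis i 1) \<noteq> 0"
            using True e Oii' by (simp add: sform_simps)
          fix B assume B: "sp B" "column i' B = axis i' 1 + axis i 1"
            and keep: "\<And>j. sform (column j A) (axis i' 1 + axis i 1) = sform (column j A) (column i' A) \<Longrightarrow>
              column j B = column j A"
          have *: "column j B = axis j 1" if "j \<notin> S \<or> j = i" for j
          proof -
            have c: "column j A = axis j 1" using that A unfolding fixed_def by blast
            then have "sform (column j A) (axis i' 1 + axis i 1) = sform (column j A) (column i' A)"
              using that O0 Oii unfolding form[OF A(1)] 
              by (auto simp: sform_axis_axis[OF \<sigma>] sform_simps)
            from keep[OF this] c show ?thesis by simp
          qed
          show "P B"
          proof (rule three[OF B(1)])
            show "fixed S B" "column i B = axis i 1" using * unfolding fixed_def by auto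
            show "sform (column i' B) (axis i' 1) \<noteq> 0"
              unfolding B(2) using Oii' Oii by (simp add: sform_simps sform_axis_axis[OF \<sigma>])
          qed
        qed
      qed
      have one': "P A" if A: "sp A" "fixed S A" "sform (column i A) (axis i 1) \<noteq> 0" for A
      proof (rule move[OF A(1,3)])
        fix B assume B: "sp B" "column i B = axis i 1"
          and keep: "\<And>j. sform (column j A) (axis i 1) = sform (column j A) (column i A) \<Longrightarrow>
            column j B = column j A"
        have "column j B = axis j 1" if "j \<notin> S" for j
        proof -
          have c: "column j A = axis j 1" using that A unfolding fixed_def by blast
          then have "sform (column j A) (axis i 1) = sform (column j A) (column i A)"
            unfolding form[OF A(1)] by (simp add: sform_axis_axis[OF \<sigma>])
          from keep[OF this] c show ?thesis by simp
        qed
        then show "P B" using two B unfolding fixed_def by blast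
      qed
      have "P A" if A: "sp A" "fixed S A" for A
      proof (cases "sform (column i A) (axis i 1) = 0")
        case False
        then show ?thesis using one' A by blast
      next
        case True
        define v where "v = column i A"
        have v0: "v $ \<sigma> j = 0" if "j \<notin> S" for j
        proof -
          have "column j A = axis j 1" using that A unfolding fixed_def by blast
          then have "sform (axis j 1) v = 0"
            using form[OF A(1), of j i] O0[OF that] by (simp add: v_def)
          then show ?thesis
            using Omega_partner_neq_0[OF \<sigma>, of j, where 'a = 'a] by (simp add: sform_axis_left[OF \<sigma>])
        qed
        \<comment> \<open>The intermediate vector must pair nontrivially with both v and e_i and be
          orthogonal to the finished basis vectors. If e_i' fails on v, it is corrected by e_l,
          where l is the partner of a nonzero coordinate of v; l lies in S because v vanishes at the
          partners of finished indices.\<close>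
        have "\<exists>z. sform v z \<noteq> 0 \<and> sform z (axis i 1) \<noteq> 0 \<and> (\<forall>j. j \<notin> S \<longrightarrow> sform (axis j 1) z = 0)"
        proof (cases "sform v (axis i' 1) = 0")
          case False
          then show ?thesis
            using Oii' O0 by (intro exI[of _ "axis i' 1"]) (auto simp: sform_axis_axis[OF \<sigma>])
        next
          case v: True
          have "v \<noteq> 0"
          proof
            assume "v = 0"
            then have "sform v (column i' A) = 0" by (simp add: sform_def scalar_product_def)
            then show False using form[OF A(1), of i i'] Oii' by (simp add: v_def)
          qed
          then obtain m where m: "v $ m \<noteq> 0" by (auto simp: vec_eq_iff)
          define l where "l = \<sigma> m"
          have l: "\<sigma> l = m" "l \<in> S"
            using m v0 partner_partner[OF \<sigma>] less.prems unfolding l_def by metis+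
          have "sform v (axis l 1) \<noteq> 0"
            using m l Omega_partner_neq_0[OF \<sigma>, of l, where 'a = 'a]
            by (simp add: sform_antisym[OF \<sigma>, of v] sform_axis_left[OF \<sigma>])
          moreover have "l \<noteq> i'" using v calculation by auto
          then have "Omega $ l $ i = (0::'a)"
            using Omega_eq_0[OF \<sigma>] i' partner_partner[OF \<sigma>] by (metis i'_def)
          moreover have "Omega $ j $ l = (0::'a)" if "j \<notin> S" for j
            using Omega_eq_0[OF \<sigma>] l less.prems that partner_partner[OF \<sigma>] by metis
          ultimately show ?thesis
            using Oii' O0 v
            by (intro exI[of _ "axis l 1 + axis i' 1"]) (auto simp: sform_simps sform_axis_axis[OF \<sigma>])
        qed
        then obtain z where z: "sform v z \<noteq> 0" "sform z (axis i 1) \<noteq> 0"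
          "\<And>j. j \<notin> S \<Longrightarrow> sform (axis j 1) z = 0" by blast
        show ?thesis
        proof (rule move[OF A(1), of i z])
          show "sform (column i A) z \<noteq> 0" using z(1) by (simp add: v_def)
          fix B assume B: "sp B" "column i B = z"
            and keep: "\<And>j. sform (column j A) z = sform (column j A) (column i A) \<Longrightarrow>
              column j B = column j A"
          have "column j B = axis j 1" if "j \<notin> S" for j
          proof -
            have c: "column j A = axis j 1" using that A unfolding fixed_def by blast
            then have "sform (column j A) z = sform (column j A) (column i A)"
              using z(3)[OF that] O0[OF that] unfolding form[OF A(1)] by simp
            from keep[OF this] c show ?thesis by simp
          qed
          then show "P B" using one' B z(2) unfolding fixed_def by blast
        qed
      qed
      then show ?thesis by blast
    qed
  qed
  from this[of UNIV] assms(2) show ?thesis unfolding sp_def fixed_def by blast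
qed


section \<open>Density of the rational points\<close>

definition group_pairs ::
    "classical_type \<Rightarrow> ((('a::field, 't::{finite,linorder}) sqmat) \<times> (('a, 't::{finite,linorder}) sqmat)) set" where
  "group_pairs G = {(A, B). A \<in> classical_group G \<and> transpose B ** A = mat 1}"

definition rational_pairs ::
    "classical_type \<Rightarrow> ((('a::field_char_0, 't::{finite,linorder}) sqmat) \<times> (('a, 't::{finite,linorder}) sqmat)) set" where
  "rational_pairs G = {(A, B) \<in> group_pairs G. \<forall>i j. A $ i $ j \<in> \<rat> \<and> B $ i $ j \<in> \<rat>}"

text \<open>The conjugate of a unitary matrix is its inverse transpose, so these are among the pairs
  of the complex group.\<close>

definition compact_pairs ::
    "classical_type \<Rightarrow> (((complex, 't::{finite,linorder}) sqmat) \<times> ((complex, 't::{finite,linorder}) sqmat)) set" where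
  "compact_pairs G = (\<lambda>M. (M, map_matrix cnj M)) ` compact_form G"

lemma inverse_transpose_mult:
  fixes A B A' B' :: "'a::comm_ring_1^'t^'t"
  assumes "transpose B ** A = mat 1" "transpose B' ** A' = mat 1"
  shows "transpose (B ** B') ** (A ** A') = mat 1"
proof -
  have "transpose (B ** B') ** (A ** A') = transpose B' ** (transpose B ** A) ** A'"
    by (simp only: matrix_transpose_mul matrix_mul_assoc)
  then show ?thesis by (simp add: assms)
qed

lemma inverse_transpose_unique:
  fixes A B B' :: "'a::field^'t^'t"
  assumes "transpose B ** A = mat 1" "transpose B' ** A = mat 1"
  shows "B = B'"
proof -
  have "A ** transpose B' = mat 1" using assms(2) matrix_left_right_inverse by blast
  then have "transpose B = transpose B ** A ** transpose B'"
    by (simp add: matrix_mul_assoc[symmetric])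
  then show ?thesis using assms(1) by simp
qed

lemma inverse_transpose_invertible:
  fixes A B :: "'a::field^'t^'t"
  assumes "transpose B ** A = mat 1"
  shows "invertible A"
  using assms invertible_left_inverse by blast

lemma classical_group_invertible: "A \<in> classical_group G \<Longrightarrow> invertible A"
  by (cases G) auto

lemma classical_group_mult:
  fixes A B :: "('a::field, 't::{finite,linorder}) sqmat"
  assumes "A \<in> classical_group G" "B \<in> classical_group G"
  shows "A ** B \<in> classical_group G"
  using assms
  by (cases G) (auto simp: det_mul orthogonal_mult symplectic_mult intro: invertible_mult)

lemma invertible_mat_1: "invertible (mat 1 :: 'a::semiring_1^'t^'t)"
  unfolding invertible_def by (metis matrix_mul_lid)

lemma classical_group_one:
  "mat 1 \<in> (classical_group G :: (('a::field, 't::{finite,linorder}) sqmat) set)"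
  by (cases G) (auto simp: invertible_mat_1)

lemma group_pairs_mult:
  assumes "(A, B) \<in> group_pairs G" "(A', B') \<in> group_pairs G"
  shows "(A ** A', B ** B') \<in> group_pairs G"
  using assms by (auto simp: group_pairs_def classical_group_mult inverse_transpose_mult)

lemma rational_pairs_mult:
  assumes "(A, B) \<in> rational_pairs G" "(A', B') \<in> rational_pairs G"
  shows "(A ** A', B ** B') \<in> rational_pairs G"
  using assms group_pairs_mult[of A B G A' B']
  by (auto simp: rational_pairs_def matrix_matrix_mult_def intro!: Rats_sum Rats_mult)

lemma mat_1_group_pairs: "(mat 1, mat 1) \<in> group_pairs G"
  by (simp add: group_pairs_def classical_group_one)

lemma mat_1_rational_pairs: "(mat 1, mat 1) \<in> rational_pairs G"
  by (simp add: rational_pairs_def mat_1_group_pairs) (simp add: mat_def)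

section \<open>Reduction of density to generators\<close>

lemma closed_subset_transporter:
  assumes "\<And>A B A' B'. (A, B) \<in> Z \<Longrightarrow> (A', B') \<in> Z \<Longrightarrow> (A ** A', B ** B') \<in> Z"
  shows "Z \<subseteq> transporter Z"
  using assms unfolding transporter_def vanishes_on_def by fast

text \<open>The second component is determined by the first, so the transporter becomes a set of
  matrices closed under products, to which the generation theorems apply.\<close>

definition reach :: "(('a::field_char_0^'t^'t) \<times> ('a^'t^'t)) set \<Rightarrow> ('a^'t^'t) set" where
  "reach Z = {A. \<exists>B. transpose B ** A = mat 1 \<and> (A, B) \<in> transporter Z}"

lemma reachI: "transpose B ** A = mat 1 \<Longrightarrow> (A, B) \<in> transporter Z \<Longrightarrow> A \<in> reach Z"
  unfolding reach_def by blast

lemma reachD: "A \<in> reach Z \<Longrightarrow> transpose B ** A = mat 1 \<Longrightarrow> (A, B) \<in> transporter Z"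
  unfolding reach_def using inverse_transpose_unique by blast

lemma reach_mult: "A \<in> reach Z \<Longrightarrow> A' \<in> reach Z \<Longrightarrow> A ** A' \<in> reach Z"
  unfolding reach_def using transporter_mult inverse_transpose_mult by blast

text \<open>The form of the inductive steps: A is a generator, B its inverse, and the reduced matrix
  A ** M is already reached.\<close>

lemma reach_cancel:
  assumes "B ** A = mat 1" "B \<in> reach Z" "A ** M \<in> reach Z"
  shows "M \<in> reach Z"
  using reach_mult[OF assms(2,3)] assms(1) by (simp add: matrix_mul_assoc)

lemma transporter_one: "(mat 1, mat 1) \<in> transporter Z"
  unfolding transporter_def by simp

lemma reach_one: "mat 1 \<in> reach Z"
  by (rule reachI[OF _ transporter_one]) simp

text \<open>The density criterion: once the transporter of Z contains the whole group, Z is dense in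
  it.\<close>

lemma vanishes_on_group_pairs:
  assumes "polyfun UNIV f" "vanishes_on f Z" "(mat 1, mat 1) \<in> Z" "classical_group G \<subseteq> reach Z"
  shows "vanishes_on f (group_pairs G)"
  unfolding vanishes_on_def group_pairs_def
  using transporter_vanishes[OF assms(1-3)] reachD assms(4) by blast

lemma elementary_inverse_transpose:
  fixes s :: "'a::field"
  assumes "i \<noteq> j"
  shows "transpose (pert ((- s) *s axis j 1) (axis i 1)) ** pert (s *s axis i 1) (axis j 1) = mat 1"
proof -
  have "transpose (pert ((- s) *s axis j 1) (axis i 1)) = pert ((- s) *s axis i 1) (axis j 1)"
    by (simp add: transpose_pert) (simp add: pert_def vec_eq_iff)
  then show ?thesis
    using assms by (simp add: pert_mult_pert scalar_product_simps axis_one_nth pert_0)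
qed

lemma dilation_mult:
  "pert ((r - 1) *s axis i 1) (axis i 1) ** pert ((s - 1) *s axis i 1) (axis i 1) =
    pert ((r * s - 1) *s axis i (1::'a::comm_ring_1)) (axis i 1)"
proof -
  have "(r - 1) *s axis i 1 + (s - 1) *s axis i 1 +
      scalar_product (axis i 1) ((s - 1) *s axis i 1) *s ((r - 1) *s axis i 1) = (r * s - 1) *s axis i 1"
    by (simp add: vec_eq_iff axis_one_nth algebra_simps del: vec.scale_left_diff_distrib)
  then show ?thesis by (simp only: pert_mult_pert)
qed

lemma dilation_1: "pert ((1 - 1) *s axis i 1) (axis i 1) = mat (1::'a::comm_ring_1)"
  by (simp add: pert_def mat_def vec_eq_iff)

lemma dilation_inverse_transpose:
  fixes s :: "'a::field"
  assumes "s \<noteq> 0"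
  shows "transpose (pert ((1 / s - 1) *s axis i 1) (axis i 1)) ** pert ((s - 1) *s axis i 1) (axis i 1) = mat 1"
proof -
  have "transpose (pert ((1 / s - 1) *s axis i 1) (axis i 1)) = pert ((1 / s - 1) *s axis i 1) (axis i 1)"
    by (simp only: transpose_pert) (simp add: pert_def vec_eq_iff algebra_simps)
  moreover have "1 / s * s = 1" using assms by simp
  ultimately show ?thesis
    by (simp only: dilation_mult dilation_1)
qed

lemma reach_elementary_line:
  fixes Z :: "(('a::field_char_0^'t^'t) \<times> ('a^'t^'t)) set"
  assumes "i \<noteq> j" "infinite {s. pert (s *s axis i 1) (axis j 1) \<in> reach Z}"
  shows "pert (s *s axis i 1) (axis j 1) \<in> reach Z"
proof (rule reachI[OF elementary_inverse_transpose[OF assms(1)]])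
  show "(pert (s *s axis i 1) (axis j 1), pert ((- s) *s axis j 1) (axis i 1)) \<in> transporter Z"
  proof (rule transporter_line[where q = 1 and g = "\<lambda>s. pert (s *s axis i 1) (axis j 1)"
        and h = "\<lambda>s. pert ((- s) *s axis j 1) (axis i 1)"])
    show "infinite {s. poly 1 s \<noteq> 0 \<and> (pert (s *s axis i 1) (axis j 1),
        pert ((- s) *s axis j 1) (axis i 1)) \<in> transporter Z}"
      by (rule infinite_super[OF _ assms(2)])
        (auto dest: reachD[OF _ elementary_inverse_transpose[OF assms(1)]])
  qed (auto simp: pert_def intro!: rat_along_intros)
qed

lemma reach_dilation_line:
  fixes Z :: "(('a::field_char_0^'t^'t) \<times> ('a^'t^'t)) set"
  assumes "infinite {s. s \<noteq> 0 \<and> pert ((s - 1) *s axis i 1) (axis i 1) \<in> reach Z}" "s \<noteq> 0"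
  shows "pert ((s - 1) *s axis i 1) (axis i 1) \<in> reach Z"
proof (rule reachI[OF dilation_inverse_transpose[OF assms(2)]])
  have "rat_along [:0, 1:] (\<lambda>s::'a. c / s)" for c
    using rat_along_divide[OF rat_along_const, of "[:0, 1:]" c] by simp
  note intros = rat_along_intros this
  show "(pert ((s - 1) *s axis i 1) (axis i 1), pert ((1 / s - 1) *s axis i 1) (axis i 1)) \<in> transporter Z"
  proof (rule transporter_line[where q = "[:0, 1:]" and g = "\<lambda>s. pert ((s - 1) *s axis i 1) (axis i 1)"
        and h = "\<lambda>s. pert ((1 / s - 1) *s axis i 1) (axis i 1)"])
    show "infinite {s. poly [:0, 1:] s \<noteq> 0 \<and> (pert ((s - 1) *s axis i 1) (axis i 1),
        pert ((1 / s - 1) *s axis i 1) (axis i 1)) \<in> transporter Z}"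
    proof (rule infinite_super[OF _ assms(1)], clarify)
      fix s :: 'a assume "s \<noteq> 0" "pert ((s - 1) *s axis i 1) (axis i 1) \<in> reach Z"
      then show "poly [:0, 1:] s \<noteq> 0 \<and> (pert ((s - 1) *s axis i 1) (axis i 1),
          pert ((1 / s - 1) *s axis i 1) (axis i 1)) \<in> transporter Z"
        using reachD[OF _ dilation_inverse_transpose] by fastforce
    qed
  qed (use assms(2) in \<open>auto simp: pert_def intro!: intros\<close>)
qed

text \<open>Infinitely many parameter values per generator suffice, since each family is a line.
  This serves both the rational points, with rational parameters, and the unitary group, with real
  or unimodular ones.\<close>

lemma GL_subset_reach:
  fixes Z :: "((('a::field_char_0, 't::{finite,linorder}) sqmat) \<times> (('a, 't) sqmat)) set"
  assumes add: "\<And>i j. i \<noteq> j \<Longrightarrow> infinite {s. pert (s *s axis i 1) (axis j 1) \<in> reach Z}"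
    and scale: "\<And>i. infinite {s. s \<noteq> 0 \<and> pert ((s - 1) *s axis i 1) (axis i 1) \<in> reach Z}"
  shows "classical_group GL \<subseteq> reach Z"
proof
  fix A :: "('a, 't) sqmat" assume "A \<in> classical_group GL"
  then have "invertible A" by simp
  then show "A \<in> reach Z"
  proof (induction rule: GL_induct)
    case one
    show ?case by (rule reach_one)
  next
    case (add i j s A)
    have "pert ((- s) *s axis i 1) (axis j 1) ** pert (s *s axis i 1) (axis j 1) = mat 1"
      using add(1) by (simp add: pert_mult_pert scalar_product_simps axis_one_nth pert_0)
    from reach_cancel[OF this reach_elementary_line[OF add(1) assms(1)[OF add(1)]] add(2)]
    show ?case .
  next
    case (scale i s A)
    have "1 / s \<noteq> 0" using scale(1) by simp
    have "1 / s * s = 1" using scale(1) by simp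
    then have "pert ((1 / s - 1) *s axis i 1) (axis i 1) ** pert ((s - 1) *s axis i 1) (axis i 1) = mat 1"
      by (simp only: dilation_mult dilation_1)
    from reach_cancel[OF this reach_dilation_line[OF assms(2) \<open>1 / s \<noteq> 0\<close>] scale(2)]
    show ?case .
  qed
qed

section \<open>Rational generators of GL, O and Sp\<close>

lemma infinite_Rats_field: "infinite (\<rat> :: 'a::field_char_0 set)"
proof
  assume "finite (\<rat> :: 'a set)"
  moreover have "range (of_nat :: nat \<Rightarrow> 'a) \<subseteq> \<rat>" by auto
  ultimately have "finite (range (of_nat :: nat \<Rightarrow> 'a))" by (rule finite_subset[rotated])
  then show False by (simp add: finite_image_iff inj_of_nat)
qed

lemma rational_pairs_reach:
  assumes "(A, B) \<in> rational_pairs G"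
  shows "A \<in> reach (rational_pairs G)"
proof (rule reachI)
  show "transpose B ** A = mat 1" using assms by (simp add: rational_pairs_def group_pairs_def)
  show "(A, B) \<in> transporter (rational_pairs G)"
    using closed_subset_transporter[of "rational_pairs G"] rational_pairs_mult assms by blast
qed

lemma GL_subset_reach_rational:
  "classical_group GL \<subseteq> reach (rational_pairs GL ::
    ((('a::field_char_0, 't::{finite,linorder}) sqmat) \<times> (('a, 't) sqmat)) set)"
proof (rule GL_subset_reach)
  fix i j :: 't assume ij: "i \<noteq> j"
  have "pert (s *s axis i 1) (axis j 1) \<in> reach (rational_pairs GL)" if "s \<in> \<rat>" for s :: 'a
  proof (rule rational_pairs_reach)
    show "(pert (s *s axis i 1) (axis j 1), pert ((- s) *s axis j 1) (axis i 1)) \<in> rational_pairs GL"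
      using elementary_inverse_transpose[OF ij, of s] that
        inverse_transpose_invertible[OF elementary_inverse_transpose[OF ij, of s]]
      by (auto simp: rational_pairs_def group_pairs_def) (auto simp: pert_def axis_one_nth of_bool_def)
  qed
  then have "\<rat> \<subseteq> {s::'a. pert (s *s axis i 1) (axis j 1) \<in> reach (rational_pairs GL)}" by blast
  then show "infinite {s::'a. pert (s *s axis i 1) (axis j 1) \<in> reach (rational_pairs GL)}"
    using infinite_Rats_field infinite_super by blast
next
  fix i :: 't
  have "pert ((s - 1) *s axis i 1) (axis i 1) \<in> reach (rational_pairs GL)" if "s \<in> \<rat>" "s \<noteq> 0" for s :: 'a
  proof (rule rational_pairs_reach)
    show "(pert ((s - 1) *s axis i 1) (axis i 1), pert ((1 / s - 1) *s axis i 1) (axis i 1)) \<in> rational_pairs GL"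
      using dilation_inverse_transpose[OF that(2), of i] that(1)
        inverse_transpose_invertible[OF dilation_inverse_transpose[OF that(2), of i]]
      by (auto simp: rational_pairs_def group_pairs_def) (auto simp: pert_def axis_one_nth of_bool_def)
  qed
  then have "\<rat> - {0} \<subseteq> {s::'a. s \<noteq> 0 \<and> pert ((s - 1) *s axis i 1) (axis i 1) \<in> reach (rational_pairs GL)}" by blast
  moreover have "infinite (\<rat> - {0::'a})" using infinite_Rats_field by simp
  ultimately show "infinite {s::'a. s \<noteq> 0 \<and> pert ((s - 1) *s axis i 1) (axis i 1) \<in> reach (rational_pairs GL)}"
    using infinite_super by blast
qed

text \<open>A reflection depends rationally on the coordinates of u, with denominator u . u, and it
  is a rational matrix for rational u. Freeing the coordinates one by one reaches all reflections in
  non-isotropic vectors.\<close>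

lemma orthogonal_subset_reach_rational:
  "classical_group Orth \<subseteq> reach (rational_pairs Orth ::
    ((('a::field_char_0, 't::{finite,linorder}) sqmat) \<times> (('a, 't) sqmat)) set)"
    (is "_ \<subseteq> reach ?Z")
proof
  have refl: "refl_mat u \<in> reach ?Z" if u: "scalar_product u u \<noteq> 0" for u :: "('a, 't) vec"
  proof (rule reachI)
    show "transpose (refl_mat u) ** refl_mat u = mat 1" using refl_mat_refl_mat[OF u] by simp
    have rat: "\<exists>q. (\<forall>s. poly q s = scalar_product (upd v i s) (upd v i s)) \<and>
        (\<forall>a b. rat_along q (\<lambda>s. refl_mat (upd v i s) $ a $ b))" for v :: "('a, 't) vec" and i
    proof -
      define q where "q = [:(\<Sum>j\<in>-{i}. v $ j * v $ j), 0, 1:]"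
      have q: "poly q s = scalar_product (upd v i s) (upd v i s)" for s
      proof -
        have "scalar_product (upd v i s) (upd v i s) = s * s + (\<Sum>j\<in>UNIV - {i}. upd v i s $ j * upd v i s $ j)"
          unfolding scalar_product_def by (subst sum.remove[of _ i]) auto
        also have "(\<Sum>j\<in>UNIV - {i}. upd v i s $ j * upd v i s $ j) = (\<Sum>j\<in>-{i}. v $ j * v $ j)"
          by (intro sum.cong) auto
        finally show ?thesis by (simp add: q_def)
      qed
      have "rat_along q (\<lambda>s. refl_mat (upd v i s) $ a $ b)" for a b
      proof -
        have "rat_along q (\<lambda>s. of_bool (a = b) + - (2 * upd v i s $ a * upd v i s $ b) / poly q s)"
          by (intro rat_along_intros rat_along_divide rat_along_upd)
        then show ?thesis by (simp add: q refl_mat_def pert_def)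
      qed
      with q show ?thesis by blast
    qed
    show "(refl_mat u, refl_mat u) \<in> transporter ?Z"
    proof (rule transporter_multiline[where g = refl_mat and h = refl_mat
          and d = "\<lambda>u. scalar_product u u" and D = \<rat>, OF _ infinite_Rats_field _ u])
      fix v :: "('a, 't) vec" assume v: "\<And>i. v $ i \<in> \<rat>" "scalar_product v v \<noteq> 0"
      then have "scalar_product v v \<in> \<rat>"
        unfolding scalar_product_def by (intro Rats_sum Rats_mult) auto
      with v have "refl_mat v $ i $ j \<in> \<rat>" for i j
        by (auto simp: refl_mat_def pert_def of_bool_def)
      moreover have "invertible (refl_mat v)"
        using refl_mat_refl_mat[OF v(2)] unfolding invertible_def by blast
      ultimately have "(refl_mat v, refl_mat v) \<in> ?Z"
        using refl_mat_refl_mat[OF v(2)] by (simp add: rational_pairs_def group_pairs_def)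
      then show "(refl_mat v, refl_mat v) \<in> transporter ?Z"
        using closed_subset_transporter[of ?Z] rational_pairs_mult by blast
    qed (use rat in blast)
  qed
  fix A :: "('a, 't) sqmat" assume "A \<in> classical_group Orth"
  then have "transpose A ** A = mat 1" by simp
  then show "A \<in> reach ?Z"
  proof (induction rule: orthogonal_induct)
    case one
    show ?case by (rule reach_one)
  next
    case (refl_mat u A)
    show ?case using reach_cancel[OF refl_mat_refl_mat refl] refl_mat by blast
  qed
qed

lemma transvec_0: "transvec u 0 = mat 1"
  by (simp add: transvec_def pert_0)

lemma transvec_mult:
  assumes "is_partner (\<sigma>::'t::{finite,linorder} \<Rightarrow> 't)"
  shows "transvec u r ** transvec u s = transvec (u :: ('a::field_char_0, 't) vec) (r + s)"
proof -
  have "scalar_product (Omega *v u) u = 0"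
    using sform_self[OF assms, of u] by (simp add: sform_def scalar_product_commute)
  then show ?thesis
    by (simp add: transvec_def pert_mult_pert scalar_product_simps vec.scale_left_distrib)
qed

text \<open>The double transpose is kept to exhibit the inverse transpose as a single matrix, the
  shape expected by \<open>reachI\<close>.\<close>

lemma transvec_inverse_transpose:
  assumes "is_partner (\<sigma>::'t::{finite,linorder} \<Rightarrow> 't)"
  shows "transpose (transpose (transvec u (- s))) ** transvec (u :: ('a::field_char_0, 't) vec) s = mat 1"
  by (simp add: transvec_mult[OF assms] transvec_0)

lemma symplectic_subset_reach:
  fixes Z :: "((('a::field_char_0, 't::{finite,linorder}) sqmat) \<times> (('a, 't) sqmat)) set"
  assumes \<sigma>: "is_partner (\<sigma>::'t \<Rightarrow> 't)" and t: "\<And>u s. transvec u s \<in> reach Z"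
  shows "classical_group Symp \<subseteq> reach Z"
proof
  fix A :: "('a, 't) sqmat" assume "A \<in> classical_group Symp"
  then have "transpose A ** Omega ** A = Omega" by simp
  with \<sigma> show "A \<in> reach Z"
  proof (induction rule: symplectic_induct)
    case one
    show ?case by (rule reach_one)
  next
    case (transvec u s A)
    have "transvec u (- s) ** transvec u s = mat 1" by (simp add: transvec_mult[OF \<sigma>] transvec_0)
    from reach_cancel[OF this t transvec] show ?case .
  qed
qed

text \<open>Transvections are polynomial in u and s. With s rational, u is freed from Q first;
  afterwards s is freed with u arbitrary.\<close>

lemma symplectic_subset_reach_rational:
  assumes \<sigma>: "is_partner (\<sigma>::'t::{finite,linorder} \<Rightarrow> 't)"
  shows "classical_group Symp \<subseteq> reach (rational_pairs Symp ::
    ((('a::field_char_0, 't) sqmat) \<times> (('a, 't) sqmat)) set)"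
    (is "_ \<subseteq> reach ?Z")
proof (rule symplectic_subset_reach[OF \<sigma>])
  fix u :: "('a, 't) vec" and s :: 'a
  have Om: "(Omega $ i $ j :: 'a) \<in> \<rat>" for i j :: 't by (simp add: Omega_def)
  have sp: "transpose (transvec u s) ** Omega ** transvec u s = Omega" for u :: "('a, 't) vec" and s
    using symplectic_transvec_mult[OF \<sigma>, of "mat 1" u s] by simp
  have rational: "(transvec u s, transpose (transvec u (- s))) \<in> transporter ?Z"
    if "\<And>i. u $ i \<in> \<rat>" "s \<in> \<rat>" for u :: "('a, 't) vec" and s
  proof -
    have "(Omega *v u) $ i \<in> \<rat>" for i
      using that by (auto simp: matrix_vector_mult_def intro!: Rats_mult Om)
    then have "transvec u s $ i $ j \<in> \<rat>" if "s \<in> \<rat>" for s i j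
      using that \<open>\<And>i. u $ i \<in> \<rat>\<close> by (auto simp: transvec_def pert_def of_bool_def intro!: Rats_add Rats_mult)
    then have "transvec u s $ i $ j \<in> \<rat>" "transpose (transvec u (- s)) $ i $ j \<in> \<rat>" for i j
      using \<open>s \<in> \<rat>\<close> by (auto simp: transpose_def)
    then have "(transvec u s, transpose (transvec u (- s))) \<in> ?Z"
      using sp transvec_inverse_transpose[OF \<sigma>, of u s]
        inverse_transpose_invertible[OF transvec_inverse_transpose[OF \<sigma>, of u s]]
      by (simp add: rational_pairs_def group_pairs_def)
    then show ?thesis
      using closed_subset_transporter[of ?Z] rational_pairs_mult by blast
  qed
  have line: "(transvec u s, transpose (transvec u (- s))) \<in> transporter ?Z" if "s \<in> \<rat>" for s
  proof (rule transporter_multiline[where g = "\<lambda>u. transvec u s" and h = "\<lambda>u. transpose (transvec u (- s))"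
        and d = "\<lambda>_. 1", OF _ infinite_Rats_field])
    fix v :: "('a, 't) vec" and i
    show "\<exists>q. (\<forall>s. poly q s = 1) \<and>
        (\<forall>a b. rat_along q (\<lambda>r. transvec (upd v i r) s $ a $ b)) \<and>
        (\<forall>a b. rat_along q (\<lambda>r. transpose (transvec (upd v i r) (- s)) $ a $ b))"
      by (intro exI[of _ 1])
        (auto simp: transvec_def pert_def transpose_def matrix_vector_mult_def simp del: upd_nth
          intro!: rat_along_intros rat_along_upd)
  qed (use rational that in auto)
  show "transvec u s \<in> reach ?Z"
  proof (rule reachI[OF transvec_inverse_transpose[OF \<sigma>]])
    show "(transvec u s, transpose (transvec u (- s))) \<in> transporter ?Z"
    proof (rule transporter_line[where q = 1 and g = "transvec u" and h = "\<lambda>s. transpose (transvec u (- s))"])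
      have "\<rat> \<subseteq> {s. poly 1 s \<noteq> 0 \<and> (transvec u s, transpose (transvec u (- s))) \<in> transporter ?Z}"
        using line by auto
      then show "infinite {s. poly 1 s \<noteq> 0 \<and> (transvec u s, transpose (transvec u (- s))) \<in> transporter ?Z}"
        using infinite_Rats_field infinite_super by blast
    qed (auto simp: transvec_def pert_def transpose_def intro!: rat_along_intros)
  qed
qed


section \<open>Density of the compact form\<close>

text \<open>
  The matrix that acts on the plane spanned by \<open>v\<close> and \<open>w\<close> by the entries \<open>a, b, c, d\<close> and as the
  identity on the common kernel of \<open>p\<close> and \<open>q\<close>, if \<open>p, q\<close> is dual to \<open>v, w\<close>.
\<close>

definition plane_mat ::
    "'a::comm_ring_1^'t \<Rightarrow> 'a^'t \<Rightarrow> 'a^'t \<Rightarrow> 'a^'t \<Rightarrow> 'a \<Rightarrow> 'a \<Rightarrow> 'a \<Rightarrow> 'a \<Rightarrow> 'a^'t^'t" where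
  "plane_mat v w p q a b c d = (\<chi> i j. of_bool (i = j) +
     ((a - 1) * v $ i * p $ j + b * v $ i * q $ j + c * w $ i * p $ j + (d - 1) * w $ i * q $ j))"

lemma plane_mat_vec:
  "plane_mat v w p q a b c d *v x = x +
     ((a - 1) * scalar_product p x + b * scalar_product q x) *s v +
     (c * scalar_product p x + (d - 1) * scalar_product q x) *s w"
proof -
  have "(plane_mat v w p q a b c d *v x) $ i =
     (\<Sum>j\<in>UNIV. of_bool (i = j) * x $ j) + ((a - 1) * v $ i * (\<Sum>j\<in>UNIV. p $ j * x $ j) +
      b * v $ i * (\<Sum>j\<in>UNIV. q $ j * x $ j) + c * w $ i * (\<Sum>j\<in>UNIV. p $ j * x $ j) +
      (d - 1) * w $ i * (\<Sum>j\<in>UNIV. q $ j * x $ j))" for i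
    unfolding sum_distrib_left sum.distrib[symmetric] plane_mat_def matrix_vector_mult_def vec_lambda_beta
    by (intro sum.cong refl) (simp add: algebra_simps)
  then show ?thesis
    by (simp add: vec_eq_iff sum_of_bool_left scalar_product_def algebra_simps)
qed

definition dual_basis :: "'a::comm_ring_1^'t \<Rightarrow> 'a^'t \<Rightarrow> 'a^'t \<Rightarrow> 'a^'t \<Rightarrow> bool" where
  "dual_basis v w p q \<longleftrightarrow> scalar_product p v = 1 \<and> scalar_product p w = 0 \<and>
     scalar_product q v = 0 \<and> scalar_product q w = 1"

text \<open>For dual bases this is an embedding of the 2 by 2 matrices, which reduces the
  computations below to size two.\<close>

lemma plane_mat_mult:
  assumes "dual_basis v w p q"
  shows "plane_mat v w p q a b c d ** plane_mat v w p q a' b' c' d' =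
    plane_mat v w p q (a * a' + b * c') (a * b' + b * d') (c * a' + d * c') (c * b' + d * d')"
proof (rule matrix_eq_columns)
  fix j
  have col: "column j (plane_mat v w p q a b c d) = plane_mat v w p q a b c d *v axis j 1" for a b c d
    by (simp add: vec_eq_iff column_def matrix_vector_mult_def axis_def if_distrib[of "\<lambda>z. _ * z"] cong: if_cong)
  define y where "y = plane_mat v w p q a' b' c' d' *v axis j 1"
  have "scalar_product p y = a' * p $ j + b' * q $ j" "scalar_product q y = c' * p $ j + d' * q $ j"
    unfolding y_def plane_mat_vec scalar_product_add_right scalar_product_scale_right scalar_product_axis_right
    using assms by (simp_all add: dual_basis_def algebra_simps)
  then show "column j (plane_mat v w p q a b c d ** plane_mat v w p q a' b' c' d') =
      column j (plane_mat v w p q (a * a' + b * c') (a * b' + b * d') (c * a' + d * c') (c * b' + d * d'))"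
    unfolding column_matrix_mult col y_def[symmetric] plane_mat_vec[of v w p q a b c d y]
    by (simp add: y_def plane_mat_vec vec_eq_iff algebra_simps)
qed

lemma plane_mat_1: "plane_mat v w p q 1 0 0 1 = mat 1"
  by (simp add: plane_mat_def mat_def vec_eq_iff)

lemma transpose_plane_mat: "transpose (plane_mat v w p q a b c d) = plane_mat p q v w a c b d"
  by (auto simp: plane_mat_def transpose_def vec_eq_iff algebra_simps)

definition cnjv :: "complex^'t \<Rightarrow> complex^'t" where
  "cnjv x = (\<chi> i. cnj (x $ i))"

lemma cnjv_nth [simp]: "cnjv x $ i = cnj (x $ i)"
  by (simp add: cnjv_def)

lemma cnjv_cnjv [simp]: "cnjv (cnjv x) = x"
  by (simp add: vec_eq_iff)

lemma cnj_plane_mat: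
  "map_matrix cnj (plane_mat v w p q a b c d) =
    plane_mat (cnjv v) (cnjv w) (cnjv p) (cnjv q) (cnj a) (cnj b) (cnj c) (cnj d)"
  by (simp add: plane_mat_def vec_eq_iff map_matrix_def)

text \<open>The dual basis being the conjugate one means that v, w are orthonormal; the remaining
  equations say that the 2 by 2 block is unitary.\<close>

lemma unitary_plane_mat:
  assumes "dual_basis v w p q" "p = cnjv v" "q = cnjv w"
    "cnj a * a + cnj c * c = 1" "cnj b * b + cnj d * d = 1" "cnj a * b + cnj c * d = 0"
  shows "transpose (map_matrix cnj (plane_mat v w p q a b c d)) ** plane_mat v w p q a b c d = mat 1"
proof -
  have "cnj b * a + cnj d * c = 0"
    using arg_cong[OF assms(6), of cnj] by (simp add: mult.commute add.commute)
  moreover have "transpose (map_matrix cnj (plane_mat v w p q a b c d)) =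
      plane_mat v w p q (cnj a) (cnj c) (cnj b) (cnj d)"
    using assms(2,3) by (simp add: cnj_plane_mat transpose_plane_mat)
  ultimately show ?thesis
    using assms by (simp add: plane_mat_mult plane_mat_1)
qed

lemma infinite_sphere_complex: "infinite (sphere (0::complex) 1)"
proof
  assume "finite (sphere (0::complex) 1)"
  moreover have "{0..1} \<subseteq> Re ` sphere (0::complex) 1"
  proof
    fix x :: real assume "x \<in> {0..1}"
    then have "x\<^sup>2 \<le> 1" by (simp add: power_le_one)
    then have "Complex x (sqrt (1 - x\<^sup>2)) \<in> sphere 0 1" by (simp add: cmod_def)
    then show "x \<in> Re ` sphere (0::complex) 1" by force
  qed
  ultimately have "finite {0..1::real}" by (meson finite_imageI finite_subset)
  then show False using infinite_Icc[of 0 "1::real"] by simp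
qed

text \<open>
  This is the passage from the compact form to its complexification: the torus of \<open>SU(2)\<close> extends
  from the unit circle to all nonzero scalars, and then the Cartan decomposition
  \<open>K A K\<close> produces the real unipotents of \<open>SL(2)\<close>.
\<close>

lemma plane_mat_unipotent_reach:
  fixes Z :: "((complex^'t^'t) \<times> (complex^'t^'t)) set"
  assumes dual: "dual_basis v w p q"
    and rot: "\<And>c s::real. c\<^sup>2 + s\<^sup>2 = 1 \<Longrightarrow>
      plane_mat v w p q (of_real c) (of_real (- s)) (of_real s) (of_real c) \<in> reach Z"
    and tor: "\<And>z. norm z = 1 \<Longrightarrow> plane_mat v w p q z 0 0 (1 / z) \<in> reach Z"
  shows "plane_mat v w p q 1 (of_real x) 0 1 \<in> reach Z"
proof -
  have dual': "dual_basis p q v w"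
    using dual by (simp add: dual_basis_def scalar_product_commute)
  have it: "transpose (plane_mat p q v w (1 / z) 0 0 z) ** plane_mat v w p q z 0 0 (1 / z) = mat 1"
    if "z \<noteq> 0" for z
    using that dual by (simp add: transpose_plane_mat plane_mat_mult plane_mat_1)
  have inv: "rat_along [:0, 1:] (\<lambda>s::complex. 1 / s)"
    using rat_along_divide[OF rat_along_const, of "[:0, 1:]" 1] by simp
  have torus: "plane_mat v w p q z 0 0 (1 / z) \<in> reach Z" if z: "z \<noteq> 0" for z
  proof (rule reachI[OF it[OF z]])
    show "(plane_mat v w p q z 0 0 (1 / z), plane_mat p q v w (1 / z) 0 0 z) \<in> transporter Z"
    proof (rule transporter_line[where q = "[:0, 1:]" and g = "\<lambda>z. plane_mat v w p q z 0 0 (1 / z)"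
          and h = "\<lambda>z. plane_mat p q v w (1 / z) 0 0 z"])
      have "sphere (0::complex) 1 \<subseteq> {s. poly [:0, 1:] s \<noteq> 0 \<and> (plane_mat v w p q s 0 0 (1 / s),
          plane_mat p q v w (1 / s) 0 0 s) \<in> transporter Z}"
      proof
        fix s :: complex assume "s \<in> sphere 0 1"
        then have s: "norm s = 1" "s \<noteq> 0" by auto
        from reachD[OF tor[OF s(1)] it[OF s(2)]] s(2)
        show "s \<in> {s. poly [:0, 1:] s \<noteq> 0 \<and> (plane_mat v w p q s 0 0 (1 / s),
          plane_mat p q v w (1 / s) 0 0 s) \<in> transporter Z}" by simp
      qed
      moreover have "infinite (sphere (0::complex) 1)"
        by (simp add: infinite_sphere_complex)
      ultimately show "infinite {s. poly [:0, 1:] s \<noteq> 0 \<and> (plane_mat v w p q s 0 0 (1 / s),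
          plane_mat p q v w (1 / s) 0 0 s) \<in> transporter Z}"
        using infinite_super by blast
    qed (use z inv in \<open>auto simp: plane_mat_def intro!: rat_along_intros\<close>)
  qed
  \<comment> \<open>The unipotent with entry x has singular values l and 1 / l, where l is the
    positive root of l^2 + x l = 1, that is, 1 / l - l = x.\<close>
  define l where "l = (- x + sqrt (x\<^sup>2 + 4)) / 2"
  have "sqrt (x\<^sup>2) < sqrt (x\<^sup>2 + 4)" by (rule real_sqrt_less_mono) simp
  then have l: "l > 0" by (simp add: l_def)
  have "2 * l + x = sqrt (x\<^sup>2 + 4)" by (simp add: l_def field_simps)
  then have "(2 * l + x)\<^sup>2 = x\<^sup>2 + 4" by simp
  then have lx: "l\<^sup>2 = 1 - x * l" by (simp add: power2_eq_square algebra_simps)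
  define n where "n = sqrt (l\<^sup>2 + 1)"
  have n: "n > 0" "n * n = l * l + 1"
    using l by (auto simp: n_def power2_eq_square add_nonneg_pos)
  \<comment> \<open>k1 and k2 are the rotations in the singular value decomposition k1 ** t ** k2; n
    is the length of (l, 1).\<close>
  define k1 where "k1 = plane_mat v w p q (of_real (l / n)) (of_real (1 / n)) (of_real (- 1 / n)) (of_real (l / n))"
  define k2 where "k2 = plane_mat v w p q (of_real (1 / n)) (of_real (- l / n)) (of_real (l / n)) (of_real (1 / n))"
  have "(l / n)\<^sup>2 + (1 / n)\<^sup>2 = (l * l + 1) / (n * n)"
    by (simp add: power2_eq_square add_divide_distrib)
  also have "\<dots> = 1" unfolding n(2)[symmetric] using n(1) by simp
  finally have ln: "(l / n)\<^sup>2 + (1 / n)\<^sup>2 = 1" .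
  have k1: "k1 \<in> reach Z"
    unfolding k1_def using rot[of "l / n" "- 1 / n"] ln by simp
  have k2: "k2 \<in> reach Z"
    unfolding k2_def using rot[of "1 / n" "l / n"] ln by (simp add: add.commute)
  define t where "t = plane_mat v w p q (of_real l) 0 0 (1 / of_real l)"
  have t: "t \<in> reach Z" using torus l by (simp add: t_def)
  have "k1 ** t ** k2 = plane_mat v w p q
     (of_real (l / n * l * (1 / n) + 1 / n * (1 / l) * (l / n)))
     (of_real (l / n * l * (- l / n) + 1 / n * (1 / l) * (1 / n)))
     (of_real (- 1 / n * l * (1 / n) + l / n * (1 / l) * (l / n)))
     (of_real (- 1 / n * l * (- l / n) + l / n * (1 / l) * (1 / n)))"
    by (simp add: k1_def k2_def t_def plane_mat_mult[OF dual])
  also have "l / n * l * (1 / n) + 1 / n * (1 / l) * (l / n) = (l * l + 1) / (n * n)"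
    using l n(1) by (simp add: divide_simps)
  also have "\<dots> = 1" unfolding n(2)[symmetric] using n(1) by simp
  also have "l / n * l * (- l / n) + 1 / n * (1 / l) * (1 / n) = (1 / l - l * l * l) / (n * n)"
    using l n(1) by (simp add: divide_simps)
  also have "\<dots> = (1 / l - l)"
  proof -
    have "1 / l - l * l * l = (1 / l - l) * (n * n)" 
      unfolding n(2) using l by (simp add: field_simps)
    then show ?thesis using n(1) by simp
  qed
  also have "1 / l - l = x" using lx l by (simp add: field_simps power2_eq_square)
  also have "- 1 / n * l * (1 / n) + l / n * (1 / l) * (l / n) = 0"
    using l n(1) by (simp add: divide_simps)
  also have "- 1 / n * l * (- l / n) + l / n * (1 / l) * (1 / n) = (l * l + 1) / (n * n)"
    using l n(1) by (simp add: divide_simps)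
  also have "\<dots> = 1" unfolding n(2)[symmetric] using n(1) by simp
  finally have "k1 ** t ** k2 = plane_mat v w p q 1 (of_real x) 0 1" by simp
  then show ?thesis using reach_mult[OF reach_mult[OF k1 t] k2] by simp
qed

section \<open>The compact form as a multiplicative set of pairs\<close>

lemma map_matrix_cnj_mult: "map_matrix cnj (A ** B) = map_matrix cnj A ** map_matrix cnj B"
  by (simp add: vec_eq_iff matrix_matrix_mult_def)

lemma map_matrix_cnj_cnj [simp]: "map_matrix cnj (map_matrix cnj A) = A"
  by (simp add: vec_eq_iff)

lemma map_matrix_cnj_1 [simp]: "map_matrix cnj (mat 1) = mat 1"
  by (simp add: vec_eq_iff mat_def)

lemma unitary_group_mult:
  assumes "A \<in> unitary_group" "B \<in> unitary_group"
  shows "A ** B \<in> unitary_group"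
  using assms
  by (auto simp: unitary_group_def map_matrix_cnj_mult inverse_transpose_mult intro: invertible_mult)

lemma compact_form_mult: "A \<in> compact_form G \<Longrightarrow> B \<in> compact_form G \<Longrightarrow> A ** B \<in> compact_form G"
  by (auto simp: compact_form_def unitary_group_mult classical_group_mult)

lemma compact_form_one: "mat 1 \<in> compact_form G"
  by (simp add: compact_form_def classical_group_one unitary_group_def invertible_mat_1)

lemma compact_form_unitary: "A \<in> compact_form G \<Longrightarrow> transpose (map_matrix cnj A) ** A = mat 1"
  by (simp add: compact_form_def unitary_group_def)

lemma compact_pairs_subset_group_pairs: "compact_pairs G \<subseteq> group_pairs G"
  by (auto simp: compact_pairs_def group_pairs_def compact_form_unitary) (auto simp: compact_form_def)

lemma mat_1_compact_pairs: "(mat 1, mat 1) \<in> compact_pairs G"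
  unfolding compact_pairs_def using compact_form_one by force

lemma compact_pairs_mult:
  "(A, B) \<in> compact_pairs G \<Longrightarrow> (A', B') \<in> compact_pairs G \<Longrightarrow> (A ** A', B ** B') \<in> compact_pairs G"
  by (auto simp: compact_pairs_def map_matrix_cnj_mult compact_form_mult intro!: image_eqI)

lemma compact_form_reach:
  assumes "A \<in> compact_form G"
  shows "A \<in> reach (compact_pairs G)"
proof (rule reachI[OF compact_form_unitary[OF assms]])
  have "(A, map_matrix cnj A) \<in> compact_pairs G" using assms by (auto simp: compact_pairs_def)
  then show "(A, map_matrix cnj A) \<in> transporter (compact_pairs G)"
    using closed_subset_transporter[of "compact_pairs G"] compact_pairs_mult by blast
qed

lemma unitaryI: "transpose (map_matrix cnj A) ** A = mat 1 \<Longrightarrow> A \<in> unitary_group"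
  unfolding unitary_group_def using inverse_transpose_invertible by blast

lemma compact_form_GL: "compact_form GL = unitary_group"
  by (auto simp: compact_form_def unitary_group_def)

text \<open>The coordinate plane of i and j carries a copy of SU(2), which yields the elementary
  matrices with real parameter. Dilations by unimodular scalars are already unitary.\<close>

lemma GL_subset_reach_compact:
  "classical_group GL \<subseteq> reach (compact_pairs GL ::
    (((complex, 't::{finite,linorder}) sqmat) \<times> ((complex, 't) sqmat)) set)"
    (is "_ \<subseteq> reach ?Z")
proof (rule GL_subset_reach)
  fix i j :: 't assume ij: "i \<noteq> j"
  define v w :: "(complex, 't) vec" where "v = axis i 1" and "w = axis j 1"
  have dual: "dual_basis v w v w" using ij by (simp add: dual_basis_def v_def w_def axis_one_nth)
  have cnj: "v = cnjv v" "w = cnjv w" by (auto simp: v_def w_def vec_eq_iff axis_one_nth)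
  note unitary = compact_form_reach[of _ GL, unfolded compact_form_GL, OF unitaryI, OF unitary_plane_mat[OF dual cnj]]
  have "plane_mat v w v w 1 (of_real x) 0 1 \<in> reach ?Z" for x
  proof (rule plane_mat_unipotent_reach[OF dual])
    fix c s :: real assume "c\<^sup>2 + s\<^sup>2 = 1"
    then have *: "complex_of_real c * of_real c + of_real s * of_real s = 1"
      by (metis of_real_1 of_real_add of_real_mult power2_eq_square)
    show "plane_mat v w v w (of_real c) (of_real (- s)) (of_real s) (of_real c) \<in> reach ?Z"
      by (rule unitary) (use * in \<open>auto simp: algebra_simps\<close>)
  next
    fix z :: complex assume "norm z = 1"
    then have "cnj z * z = 1" by (metis complex_norm_square mult.commute of_real_1 one_power2)
    then show "plane_mat v w v w z 0 0 (1 / z) \<in> reach ?Z"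
      by (intro unitary) (auto simp: divide_simps)
  qed
  moreover have "plane_mat v w v w 1 s 0 1 = pert (s *s axis i 1) (axis j 1)" for s
    by (simp add: plane_mat_def pert_def v_def w_def)
  ultimately have "range of_real \<subseteq> {s. pert (s *s axis i 1) (axis j 1) \<in> reach ?Z}"
    by auto
  moreover have "infinite (range (of_real :: real \<Rightarrow> complex))"
    by (simp add: finite_image_iff inj_of_real infinite_UNIV_char_0)
  ultimately show "infinite {s. pert (s *s axis i 1) (axis j 1) \<in> reach ?Z}"
    using infinite_super by blast
next
  fix i :: 't
  have "pert ((z - 1) *s axis i 1) (axis i 1) \<in> reach ?Z" if z: "norm z = 1" for z
  proof (rule compact_form_reach, unfold compact_form_GL, rule unitaryI)
    have "cnj z * z = 1" using z by (metis complex_norm_square mult.commute of_real_1 one_power2)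
    moreover have "transpose (map_matrix cnj (pert ((z - 1) *s axis i 1) (axis i 1))) =
        pert ((cnj z - 1) *s axis i 1) (axis i 1)"
      by (simp add: transpose_def pert_def vec_eq_iff axis_one_nth)
    ultimately show "transpose (map_matrix cnj (pert ((z - 1) *s axis i 1) (axis i 1))) **
        pert ((z - 1) *s axis i 1) (axis i 1) = mat 1"
      by (simp only: dilation_mult dilation_1)
  qed
  then have "sphere 0 1 \<subseteq> {s. s \<noteq> 0 \<and> pert ((s - 1) *s axis i 1) (axis i 1) \<in> reach ?Z}"
    by auto
  moreover have "infinite (sphere (0::complex) 1)" by (rule infinite_sphere_complex)
  ultimately show "infinite {s. s \<noteq> 0 \<and> pert ((s - 1) *s axis i 1) (axis i 1) \<in> reach ?Z}"
    using infinite_super by blast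
qed


text \<open>A transvection along u lies in a copy of SL(2) on the plane spanned by v = u / |u| and
  \<open>Omega\<close> applied to the conjugate of v. There it is the unipotent with real entry
  |u|^2, and the corresponding SU(2) lies in the compact form.\<close>

lemma symplectic_subset_reach_compact:
  assumes \<sigma>: "is_partner (\<sigma>::'t::{finite,linorder} \<Rightarrow> 't)"
  shows "classical_group Symp \<subseteq> reach (compact_pairs Symp ::
    (((complex, 't) sqmat) \<times> ((complex, 't) sqmat)) set)"
    (is "_ \<subseteq> reach ?Z")
proof (rule symplectic_subset_reach[OF \<sigma>])
  fix u0 :: "(complex, 't) vec" and s0 :: complex
  \<comment> \<open>A transvection depends on u and s only through s u u^tr, so a complex square
    root absorbs s.\<close>
  define u where "u = csqrt s0 *s u0"
  have u: "transvec u0 s0 = transvec u 1"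
    by (simp add: transvec_def pert_def u_def matrix_vector_scale vec_eq_iff)
      (metis (no_types, opaque_lifting) mult.assoc mult.left_commute power2_csqrt power2_eq_square)
  show "transvec u0 s0 \<in> reach ?Z"
  proof (cases "u = 0")
    case True
    then show ?thesis unfolding u by (simp add: transvec_def pert_0 reach_one)
  next
    case False
    define n where "n = (\<Sum>i\<in>UNIV. (norm (u $ i))\<^sup>2)"
    obtain i where "u $ i \<noteq> 0" using False by (auto simp: vec_eq_iff)
    then have n: "n > 0"
      unfolding n_def by (intro sum_pos2[of _ i]) auto
    define r where "r = sqrt n"
    have r: "r > 0" "r * r = n" using n by (auto simp: r_def)
    define v where "v = (1 / complex_of_real r) *s u"
    define p where "p = cnjv v"
    define q where "q = Omega *v v"
    \<comment> \<open>As the form alternates, w is orthogonal to v in the Hermitian sense, and its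
      dual vector \<open>Omega *v v\<close> is its own conjugate.\<close>
    define w where "w = Omega *v p"
    have cnjO: "cnj (Omega $ i $ j) = Omega $ i $ j" for i j :: 't by (simp add: Omega_def)
    have cnjO_mult: "cnjv (Omega *v x) = Omega *v cnjv x" for x :: "(complex, 't) vec"
      by (simp add: vec_eq_iff matrix_vector_mult_def cnjO)
    have vp: "v = cnjv p" by (simp add: p_def)
    have wq: "q = cnjv w" "w = cnjv q" by (simp_all add: w_def q_def cnjO_mult p_def)
    have Ow: "Omega *v w = - p" by (simp add: w_def Omega_Omega[OF \<sigma>])
    have Oq: "Omega *v q = - v" by (simp add: q_def Omega_Omega[OF \<sigma>])
    have pv: "scalar_product p v = 1"
    proof -
      have "scalar_product p v = (\<Sum>i\<in>UNIV. of_real ((norm (u $ i))\<^sup>2) / of_real (r * r))"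
        unfolding scalar_product_def
        by (intro sum.cong refl) (simp add: p_def v_def complex_norm_square del: of_real_power)
      also have "\<dots> = of_real (n / (r * r))"
        by (simp add: n_def sum_divide_distrib)
      finally show ?thesis using r n by simp
    qed
    have swap: "scalar_product x (Omega *v y) = - scalar_product (Omega *v x) y"
      for x y :: "(complex, 't) vec"
      using sform_antisym[OF \<sigma>, of x y] by (simp add: sform_def scalar_product_commute)
    have "scalar_product p w = 0" "scalar_product q v = 0"
      using sform_self[OF \<sigma>, of p] sform_self[OF \<sigma>, of v]
      by (simp_all add: sform_def w_def q_def scalar_product_commute)
    moreover have "scalar_product q w = 1"
      using swap[of q p] pv unfolding Oq w_def
      by (simp add: scalar_product_minus_left scalar_product_commute[of v])
    ultimately have dual: "dual_basis v w p q" using pv by (simp add: dual_basis_def)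
    \<comment> \<open>The block with rows (a, b) and (-cnj b, cnj a) is the general element of
      SU(2).\<close>
    have compact: "plane_mat v w p q a b (- cnj b) (cnj a) \<in> reach ?Z"
      if ab: "cnj a * a + cnj b * b = 1" for a b
    proof (rule compact_form_reach)
      let ?M = "plane_mat v w p q a b (- cnj b) (cnj a)"
      have unitary: "transpose (map_matrix cnj ?M) ** ?M = mat 1"
        by (rule unitary_plane_mat[OF dual p_def wq(1)]) (use ab in \<open>auto simp: algebra_simps\<close>)
      \<comment> \<open>For unitary M, being symplectic is the same as satisfying this commutation
        rule, since M^tr times the conjugate of M is the identity.\<close>
      have "Omega ** ?M = map_matrix cnj ?M ** Omega"
      proof (rule matrix_eq_columns)
        fix j
        have col: "column j A = A *v axis j 1" for A :: "(complex, 't) sqmat"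
          by (simp add: vec_eq_iff column_def matrix_vector_mult_def axis_def if_distrib[of "\<lambda>z. _ * z"] cong: if_cong)
        have "Omega *v (?M *v x) = map_matrix cnj ?M *v (Omega *v x)" for x :: "(complex, 't) vec"
        proof -
          have 1: "cnjv v = p" "cnjv p = v" "cnjv w = q" "cnjv q = w"
            using vp wq by (simp_all add: p_def)
          have 2: "scalar_product v (Omega *v x) = - scalar_product q x"
            using swap[of v x] by (simp add: q_def)
          have 3: "scalar_product w (Omega *v x) = scalar_product p x"
            using swap[of w x] Ow by (simp add: scalar_product_minus_left)
          show ?thesis
            unfolding cnj_plane_mat 1 plane_mat_vec 2 3 matrix_vector_right_distrib matrix_vector_scale
              q_def[symmetric] Ow
            by (simp add: vec_eq_iff algebra_simps)
        qed
        then show "column j (Omega ** ?M) = column j (map_matrix cnj ?M ** Omega)"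
          unfolding column_matrix_mult col .
      qed
      then have "transpose ?M ** Omega ** ?M = transpose ?M ** map_matrix cnj ?M ** Omega"
        by (simp only: matrix_mul_assoc[symmetric])
      also have "transpose ?M ** map_matrix cnj ?M = mat 1"
        using arg_cong[OF unitary, of transpose] by (simp add: matrix_transpose_mul)
      finally show "?M \<in> compact_form Symp"
        using unitaryI[OF unitary] inverse_transpose_invertible[OF unitary]
        by (simp add: compact_form_def)
    qed
    have "plane_mat v w p q 1 (of_real n) 0 1 \<in> reach ?Z"
    proof (rule plane_mat_unipotent_reach[OF dual])
      fix c s :: real assume "c\<^sup>2 + s\<^sup>2 = 1"
      then have "complex_of_real c * of_real c + of_real s * of_real s = 1"
        by (metis of_real_1 of_real_add of_real_mult power2_eq_square)
      then show "plane_mat v w p q (of_real c) (of_real (- s)) (of_real s) (of_real c) \<in> reach ?Z"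
        using compact[of "of_real c" "of_real (- s)"] by simp
    next
      fix z :: complex assume z: "norm z = 1"
      then have "cnj z * z = 1" by (metis complex_norm_square mult.commute of_real_1 one_power2)
      moreover from this have "cnj z = 1 / z" using z by (auto simp: divide_simps)
      ultimately show "plane_mat v w p q z 0 0 (1 / z) \<in> reach ?Z"
        using compact[of z 0] by simp
    qed
    have "u = of_real r *s v" using r by (simp add: v_def vec_eq_iff)
    moreover from this have "Omega *v u = of_real r *s q"
      by (simp only: matrix_vector_scale q_def)
    ultimately have "transvec u 1 = plane_mat v w p q 1 (of_real n) 0 1"
      by (simp add: transvec_def pert_def plane_mat_def vec_eq_iff r(2)[symmetric])
    with \<open>plane_mat v w p q 1 (of_real n) 0 1 \<in> reach ?Z\<close> show ?thesis unfolding u by simp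
  qed
qed


subsection \<open>The special linear group\<close>

text \<open>
  A function on \<open>SL\<close> extends to \<open>GL\<close> along the retraction that divides one column by the
  determinant.
\<close>

definition one_diag :: "'t::finite \<Rightarrow> 'a::comm_ring_1 \<Rightarrow> 'a^'t^'t" where
  "one_diag k x = (\<chi> i j. if i = j then if i = k then x else 1 else 0)"

lemma det_one_diag: "det (one_diag k x) = x"
proof -
  have "det (one_diag k x) = (\<Prod>i\<in>UNIV. one_diag k x $ i $ i)"
    by (rule det_diagonal) (simp add: one_diag_def)
  also have "\<dots> = x" by (simp add: one_diag_def)
  finally show ?thesis .
qed

lemma one_diag_mult: "one_diag k x ** one_diag k y = one_diag k (x * y)"
  by (simp add: one_diag_def matrix_matrix_mult_def vec_eq_iff if_distrib[of "\<lambda>z. z * _"] cong: if_cong)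

lemma one_diag_1: "one_diag k 1 = mat 1"
  by (simp add: one_diag_def mat_def vec_eq_iff)

lemma transpose_one_diag: "transpose (one_diag k x) = one_diag k x"
  by (auto simp: one_diag_def transpose_def vec_eq_iff)

lemma det_inverse_transpose:
  fixes A B :: "'a::comm_ring_1^'t^'t"
  assumes "transpose B ** A = mat 1"
  shows "det B * det A = 1"
  using arg_cong[OF assms, of det] by (simp add: det_mul)

text \<open>Along a pair, det B is the inverse of det A, so dividing a column by the determinant is
  polynomial.\<close>

lemma retract_inverse_transpose:
  fixes A B :: "'a::comm_ring_1^'t^'t"
  assumes "transpose B ** A = mat 1"
  shows "transpose (B ** one_diag k (det A)) ** (A ** one_diag k (det B)) = mat 1"
    and "det (A ** one_diag k (det B)) = 1"
  using assms det_inverse_transpose[OF assms]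
  by (simp_all add: inverse_transpose_mult transpose_one_diag one_diag_mult one_diag_1 det_mul det_one_diag mult.commute)

text \<open>Pull f back along the retraction: the pullback vanishes on Y, hence on
  \<open>X GL\<close> by density, and it equals f where both determinants are 1. The families X, Y,
  Z stay abstract to cover rational and compact points alike; \<open>undefined\<close> is merely
  some column index.\<close>

lemma vanishes_on_SL:
  fixes f :: "('a::field_char_0, 't::{finite,linorder}) sqmat \<Rightarrow> ('a, 't) sqmat \<Rightarrow> 'a"
  assumes f: "polyfun UNIV f" "vanishes_on f Z"
    and Z: "\<And>A B. (A, B) \<in> Y \<Longrightarrow> (A ** one_diag undefined (det B), B ** one_diag undefined (det A)) \<in> Z"
    and dense: "\<And>f. polyfun UNIV f \<Longrightarrow> vanishes_on f Y \<Longrightarrow> vanishes_on f (X GL)"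
    and sub: "X SL \<subseteq> X GL" "X SL \<subseteq> group_pairs SL"
  shows "vanishes_on f (X SL)"
proof -
  define f' where "f' A B = f (A ** one_diag undefined (det B)) (B ** one_diag undefined (det A))" for A B
  have entry: "polyfun UNIV (\<lambda>A B. one_diag undefined (g A B) $ i $ j)" if "polyfun UNIV g"
    for i j and g :: "('a, 't) sqmat \<Rightarrow> ('a, 't) sqmat \<Rightarrow> 'a"
    using that by (cases "i = j"; cases "i = undefined") (auto simp: one_diag_def intro: polyfun.intros)
  have "polyfun UNIV f'"
    unfolding f'_def
    by (rule polyfun_subst[OF f(1)])
      (auto simp: matrix_matrix_mult_def intro!: polyfun_sum polyfun.mult entry polyfun_det intro: polyfun.intros)
  moreover have "vanishes_on f' Y"
    using f(2) Z unfolding vanishes_on_def f'_def by blast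
  ultimately have "vanishes_on f' (X SL)"
    using dense sub(1) unfolding vanishes_on_def by blast
  moreover have "f' A B = f A B" if "(A, B) \<in> X SL" for A B
  proof -
    have "(A, B) \<in> group_pairs SL" using that sub(2) by blast
    then have "det A = 1" "det B = 1"
      using det_inverse_transpose[of B A] by (auto simp: group_pairs_def)
    then show ?thesis by (simp add: f'_def one_diag_1)
  qed
  ultimately show ?thesis unfolding vanishes_on_def by auto
qed

theorem rational_pairs_dense:
  fixes f :: "('a::field_char_0, 't::{finite,linorder}) sqmat \<Rightarrow> ('a, 't) sqmat \<Rightarrow> 'a"
  assumes G: "G = Symp \<Longrightarrow> even CARD('t)"
    and f: "polyfun UNIV f" "vanishes_on f (rational_pairs G)"
  shows "vanishes_on f (group_pairs G)"
proof -
  note dense = vanishes_on_group_pairs[OF _ _ mat_1_rational_pairs]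
  show ?thesis
  proof (cases G)
    case GL
    then show ?thesis using dense f GL_subset_reach_rational by blast
  next
    case Orth
    then show ?thesis using dense f orthogonal_subset_reach_rational by blast
  next
    case Symp
    then obtain \<sigma> :: "'t \<Rightarrow> 't" where "is_partner \<sigma>" using G ex_partner by blast
    then show ?thesis using Symp dense f symplectic_subset_reach_rational by blast
  next
    case SL
    have "vanishes_on f (group_pairs SL)"
    proof (rule vanishes_on_SL[where Y = "rational_pairs GL" and X = group_pairs and Z = "rational_pairs SL"])
      show "(A ** one_diag undefined (det B), B ** one_diag undefined (det A)) \<in> rational_pairs SL"
        if AB: "(A, B) \<in> rational_pairs GL" for A B :: "('a, 't) sqmat"
      proof -
      from AB have it: "transpose B ** A = mat 1" by (simp add: rational_pairs_def group_pairs_def)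
      have "det A \<in> \<rat>" "det B \<in> \<rat>"
        using AB unfolding det_def rational_pairs_def
        by (auto intro!: Rats_sum Rats_mult Rats_prod)
      then have D: "one_diag k (det A) $ i $ j \<in> \<rat>" "one_diag k (det B) $ i $ j \<in> \<rat>" for k i j
        by (auto simp: one_diag_def)
      then have "(A ** one_diag k (det B)) $ i $ j \<in> \<rat>" "(B ** one_diag k (det A)) $ i $ j \<in> \<rat>" for i j k
        using AB unfolding matrix_matrix_mult_def rational_pairs_def
        by (auto intro!: Rats_sum Rats_mult)
      then show "(A ** one_diag undefined (det B), B ** one_diag undefined (det A)) \<in> rational_pairs SL"
        using retract_inverse_transpose[OF it, of undefined]
          inverse_transpose_invertible[OF retract_inverse_transpose(1)[OF it, of undefined]]
        by (simp add: rational_pairs_def group_pairs_def)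
      qed
      show "vanishes_on f (group_pairs GL)" if "polyfun UNIV f" "vanishes_on f (rational_pairs GL)"
        for f :: "('a, 't) sqmat \<Rightarrow> ('a, 't) sqmat \<Rightarrow> 'a"
        by (rule dense[OF that GL_subset_reach_rational])
    qed (use f SL in \<open>auto simp: group_pairs_def\<close>)
    then show ?thesis using SL by simp
  qed
qed

text \<open>The conclusion concerns rational points only, which is all that the invariance of the
  mean needs. It makes the orthogonal case immediate: a rational orthogonal matrix is real, hence
  unitary, and already lies in the compact form.\<close>

theorem compact_pairs_dense:
  fixes f :: "(complex, 't::{finite,linorder}) sqmat \<Rightarrow> (complex, 't) sqmat \<Rightarrow> complex"
  assumes G: "G = Symp \<Longrightarrow> even CARD('t)"
    and f: "polyfun UNIV f" "vanishes_on f (compact_pairs G)"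
  shows "vanishes_on f (rational_pairs G)"
proof -
  have sub: "rational_pairs G \<subseteq> group_pairs G" for G by (auto simp: rational_pairs_def)
  note dense = vanishes_on_group_pairs[OF _ _ mat_1_compact_pairs]
  show ?thesis
  proof (cases G)
    case GL
    then have "vanishes_on f (group_pairs G)" using dense f GL_subset_reach_compact by blast
    then show ?thesis using sub unfolding vanishes_on_def by blast
  next
    case Symp
    then obtain \<sigma> :: "'t \<Rightarrow> 't" where "is_partner \<sigma>" using G ex_partner by blast
    then have "vanishes_on f (group_pairs G)" using Symp dense f symplectic_subset_reach_compact by blast
    then show ?thesis using sub unfolding vanishes_on_def by blast
  next
    case Orth
    have "(A, B) \<in> compact_pairs Orth" if "(A, B) \<in> rational_pairs Orth"
      for A B :: "(complex, 't) sqmat"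
    proof -
      have A: "transpose A ** A = mat 1" "transpose B ** A = mat 1" "invertible A"
        using that by (auto simp: rational_pairs_def group_pairs_def)
      have "cnj (A $ i $ j) = A $ i $ j" for i j
      proof -
        have "A $ i $ j \<in> \<rat>" using that by (simp add: rational_pairs_def)
        then obtain q where "A $ i $ j = of_rat q" by (rule Rats_cases)
        moreover have "cnj (of_rat q) = of_rat q"
          by (cases q rule: Rat_cases) (simp add: of_rat_rat)
        ultimately show ?thesis by simp
      qed
      then have "map_matrix cnj A = A" by (simp add: vec_eq_iff)
      then show ?thesis
        using A inverse_transpose_unique[OF A(1,2)]
        by (auto simp: compact_pairs_def compact_form_def unitary_group_def)
    qed
    then show ?thesis using f(2) Orth unfolding vanishes_on_def by blast
  next
    case SL
    have "vanishes_on f (rational_pairs SL)"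
    proof (rule vanishes_on_SL[where Y = "compact_pairs GL" and X = rational_pairs and Z = "compact_pairs SL"])
      fix A B :: "(complex, 't) sqmat"
      assume "(A, B) \<in> compact_pairs GL"
      then have B: "B = map_matrix cnj A" and it: "transpose (map_matrix cnj A) ** A = mat 1"
        by (auto simp: compact_pairs_def compact_form_GL unitary_group_def)
      have cnj_det: "cnj (det M) = det (map_matrix cnj M)" for M :: "(complex, 't) sqmat"
        by (simp add: det_def)
      have "map_matrix cnj (one_diag (undefined::'t) (det M)) = one_diag undefined (det (map_matrix cnj M))"
        for M :: "(complex, 't) sqmat"
        by (simp add: one_diag_def vec_eq_iff cnj_det)
      from this[of B] have eq: "map_matrix cnj (A ** one_diag undefined (det B)) = B ** one_diag undefined (det A)"
        unfolding map_matrix_cnj_mult by (simp add: B)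
      note ret = retract_inverse_transpose[OF it, of undefined, folded B]
      have "A ** one_diag undefined (det B) \<in> compact_form SL"
        using ret inverse_transpose_invertible[OF ret(1)] unitaryI[unfolded map_matrix_cnj_mult] eq
        by (auto simp: compact_form_def unitary_group_def)
      then show "(A ** one_diag undefined (det B), B ** one_diag undefined (det A)) \<in> compact_pairs SL"
        unfolding compact_pairs_def eq[symmetric] by blast
    next
      show "vanishes_on f (rational_pairs GL)" if "polyfun UNIV f" "vanishes_on f (compact_pairs GL)"
        for f :: "(complex, 't) sqmat \<Rightarrow> (complex, 't) sqmat \<Rightarrow> complex"
        using dense[OF that GL_subset_reach_compact] sub unfolding vanishes_on_def by blast
    qed (use f SL in \<open>auto simp: group_pairs_def rational_pairs_def\<close>)
    then show ?thesis using SL by simp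
  qed
qed


section \<open>Separation of variables\<close>

text \<open>A finite expansion into products of a function of (A, B) and a monomial in (A', B').
  Integrating out the primed variables then leaves a polynomial function of (A, B) whose
  coefficients are moments. Constants in R stay on the left, so rationality is preserved.\<close>

definition separable where
  "separable R \<Phi> \<longleftrightarrow> (\<exists>xs. (\<forall>(g, b)\<in>set xs. polyfun R g) \<and>
     (\<forall>A B A' B'. \<Phi> A B A' B' = (\<Sum>(g, b)\<leftarrow>xs. g A B * mono_val A' B' b)))"

lemma separable_left:
  assumes "0 \<in> R" "polyfun R g"
  shows "separable R (\<lambda>A B A' B'. g A B)"
  unfolding separable_def
  by (rule exI[of _ "[(g, 0)]"]) (use assms in auto)

lemma separable_right:
  assumes "1 \<in> R"
  shows "separable R (\<lambda>A B A' B'. mono_val A' B' b)"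
  unfolding separable_def
  by (rule exI[of _ "[(\<lambda>A B. 1, b)]"]) (use assms in \<open>auto intro: polyfun.intros\<close>)

lemma separable_add:
  assumes "separable R \<Phi>" "separable R \<Psi>"
  shows "separable R (\<lambda>A B A' B'. \<Phi> A B A' B' + \<Psi> A B A' B')"
proof -
  obtain xs ys where "\<forall>(g, b)\<in>set xs. polyfun R g" "\<forall>(g, b)\<in>set ys. polyfun R g"
    "\<And>A B A' B'. \<Phi> A B A' B' = (\<Sum>(g, b)\<leftarrow>xs. g A B * mono_val A' B' b)"
    "\<And>A B A' B'. \<Psi> A B A' B' = (\<Sum>(g, b)\<leftarrow>ys. g A B * mono_val A' B' b)"
    using assms unfolding separable_def by blast
  then show ?thesis
    unfolding separable_def by (intro exI[of _ "xs @ ys"]) auto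
qed

lemma separable_mult:
  assumes "separable R \<Phi>" "separable R \<Psi>"
  shows "separable R (\<lambda>A B A' B'. \<Phi> A B A' B' * \<Psi> A B A' B')"
proof -
  obtain xs ys where xs: "\<forall>(g, b)\<in>set xs. polyfun R g" and ys: "\<forall>(g, b)\<in>set ys. polyfun R g"
    and \<Phi>: "\<And>A B A' B'. \<Phi> A B A' B' = (\<Sum>(g, b)\<leftarrow>xs. g A B * mono_val A' B' b)"
    and \<Psi>: "\<And>A B A' B'. \<Psi> A B A' B' = (\<Sum>(g, b)\<leftarrow>ys. g A B * mono_val A' B' b)"
    using assms unfolding separable_def by blast
  define zs where "zs = concat (map (\<lambda>(g, b). map (\<lambda>(h, c). (\<lambda>A B. g A B * h A B, b + c)) ys) xs)"
  have "\<forall>(g, b)\<in>set zs. polyfun R g"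
    using xs ys unfolding zs_def by (fastforce intro: polyfun.mult)
  moreover have "\<Phi> A B A' B' * \<Psi> A B A' B' = (\<Sum>(g, b)\<leftarrow>zs. g A B * mono_val A' B' b)" for A B A' B'
  proof -
    have "(\<Sum>(g, b)\<leftarrow>map (\<lambda>(h, c). (\<lambda>A B. g A B * h A B, b + c)) ys. g A B * mono_val A' B' b) =
        g A B * mono_val A' B' b * \<Psi> A B A' B'" for g b
      unfolding \<Psi> sum_list_const_mult[symmetric]
      by (induction ys) (auto simp: mono_val_add mult_ac)
    then show ?thesis
      unfolding \<Phi> zs_def by (induction xs) (auto simp: distrib_right)
  qed
  ultimately show ?thesis unfolding separable_def by blast
qed

lemma separable_sum:
  assumes "finite S" "0 \<in> R" "\<And>i. i \<in> S \<Longrightarrow> separable R (\<Phi> i)"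
  shows "separable R (\<lambda>A B A' B'. \<Sum>i\<in>S. \<Phi> i A B A' B')"
  using assms
  by (induction S rule: finite_induct) (auto intro: separable_add separable_left polyfun.intros)

lemma separable_entry_fst: "1 \<in> R \<Longrightarrow> separable R (\<lambda>A B A' B'. A' $ i $ j)"
  using separable_right[of R "(Poly_Mapping.single (i, j) 1, 0)"] by (simp add: mono_val_def)

lemma separable_entry_snd: "1 \<in> R \<Longrightarrow> separable R (\<lambda>A B A' B'. B' $ i $ j)"
  using separable_right[of R "(0, Poly_Mapping.single (i, j) 1)"] by (simp add: mono_val_def)

lemma separable_polyfun:
  assumes "0 \<in> R" "1 \<in> R" "polyfun R f"
    and "\<And>i j. separable R (\<lambda>A B A' B'. P A B A' B' $ i $ j)"
    and "\<And>i j. separable R (\<lambda>A B A' B'. Q A B A' B' $ i $ j)"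
  shows "separable R (\<lambda>A B A' B'. f (P A B A' B') (Q A B A' B'))"
  using assms(3)
  by induction (auto intro: separable_add separable_mult separable_left polyfun.const assms)

text \<open>The third form is translation by the inverse: for a group pair,
  \<open>transpose B\<close> is the inverse of A and \<open>transpose A\<close> that of B.\<close>

lemma separable_translate:
  assumes "0 \<in> R" "1 \<in> R" "polyfun R f"
  shows "separable R (\<lambda>A B A' B'. f (A ** A') (B ** B'))"
    and "separable R (\<lambda>A B A' B'. f (A' ** A) (B' ** B))"
    and "separable R (\<lambda>A B A' B'. f (transpose B ** A') (transpose A ** B'))"
  by (rule separable_polyfun[OF assms];
      auto simp: matrix_matrix_mult_def transpose_def assms intro!: separable_sum separable_mult
        separable_entry_fst separable_entry_snd separable_left polyfun.intros)+


section \<open>Invariance of the mean under rational points\<close>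

lemma polyfun_sum_list:
  assumes "\<And>g b. (g, b) \<in> set xs \<Longrightarrow> polyfun UNIV g"
  shows "polyfun UNIV (\<lambda>A B. \<Sum>(g, b)\<leftarrow>xs. g A B * c b)"
  using assms by (induction xs) (auto intro!: polyfun.intros)

locale haar =
  fixes G :: classical_type
    and \<mu> :: "((complex, 't::{finite,linorder}) sqmat) measure"
  assumes even: "G = Symp \<Longrightarrow> even CARD('t)"
    and haar: "normalised_haar_measure (compact_form G) \<mu>"
begin

sublocale prob_space \<mu>
  using haar by (simp add: normalised_haar_measure_def)

lemma sets_eq: "sets \<mu> = sets (restrict_space borel (compact_form G))"
  using haar by (simp add: normalised_haar_measure_def)

lemma space_eq: "space \<mu> = compact_form G"
  using sets_eq_imp_space_eq[OF sets_eq] by (simp add: space_restrict_space)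

definition mean :: "((complex, 't) sqmat \<Rightarrow> (complex, 't) sqmat \<Rightarrow> complex) \<Rightarrow> complex" where
  "mean f = (LINT M|\<mu>. f M (map_matrix cnj M))"

section \<open>Integrability and linearity of the mean\<close>

lemma continuous_polyfun:
  assumes "polyfun UNIV f"
  shows "continuous_on UNIV (\<lambda>M::(complex, 't) sqmat. f M (map_matrix cnj M))"
  using assms by induction (auto intro!: continuous_intros)

lemma unitary_entry_bound:
  assumes "M \<in> (unitary_group :: ((complex, 't) sqmat) set)"
  shows "norm (M $ i $ j) \<le> 1"
proof -
  have "(transpose (map_matrix cnj M) ** M) $ j $ j = 1"
    using assms by (simp add: unitary_group_def mat_def)
  then have "(\<Sum>k\<in>UNIV. cnj (M $ k $ j) * M $ k $ j) = 1"
    by (simp add: matrix_matrix_mult_def transpose_def)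
  then have "complex_of_real (\<Sum>k\<in>UNIV. (norm (M $ k $ j))\<^sup>2) = 1"
    by (simp add: complex_norm_square mult.commute del: of_real_power)
  then have "(\<Sum>k\<in>UNIV. (norm (M $ k $ j))\<^sup>2) = 1"
    using of_real_eq_1_iff by blast
  moreover have "(norm (M $ i $ j))\<^sup>2 \<le> (\<Sum>k\<in>UNIV. (norm (M $ k $ j))\<^sup>2)"
    by (rule member_le_sum) auto
  ultimately show ?thesis by (simp add: power2_le_iff_abs_le abs_square_le_1)
qed

text \<open>The entries of a unitary matrix have modulus at most 1. With a total mass of 1,
  boundedness gives integrability.\<close>

lemma bounded_polyfun:
  assumes "polyfun UNIV f"
  shows "\<exists>K. \<forall>M\<in>(unitary_group :: ((complex, 't) sqmat) set). norm (f M (map_matrix cnj M)) \<le> K"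
  using assms
proof induction
  case (const c)
  show ?case by (intro exI[of _ "norm c"]) simp
next
  case (add f g)
  then obtain K L where "\<forall>M\<in>(unitary_group :: ((complex, 't) sqmat) set). norm (f M (map_matrix cnj M)) \<le> K"
    "\<forall>M\<in>(unitary_group :: ((complex, 't) sqmat) set). norm (g M (map_matrix cnj M)) \<le> L" by blast
  then show ?case by (intro exI[of _ "K + L"]) (auto intro: norm_triangle_le add_mono)
next
  case (mult f g)
  then obtain K L where KL: "\<forall>M\<in>(unitary_group :: ((complex, 't) sqmat) set). norm (f M (map_matrix cnj M)) \<le> K"
    "\<forall>M\<in>(unitary_group :: ((complex, 't) sqmat) set). norm (g M (map_matrix cnj M)) \<le> L" by blast
  show ?case
  proof (intro exI[of _ "K * L"] ballI)
    fix M :: "(complex, 't) sqmat" assume M: "M \<in> unitary_group"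
    then have "norm (f M (map_matrix cnj M)) \<le> K" "norm (g M (map_matrix cnj M)) \<le> L" using KL by auto
    then show "norm (f M (map_matrix cnj M) * g M (map_matrix cnj M)) \<le> K * L"
      unfolding norm_mult by (intro mult_mono) (auto intro: order_trans[OF norm_ge_zero])
  qed
qed (auto intro!: exI[of _ 1] unitary_entry_bound)

lemma integrable_polyfun:
  assumes "polyfun UNIV f"
  shows "integrable \<mu> (\<lambda>M. f M (map_matrix cnj M))"
proof -
  obtain K where K: "\<forall>M\<in>(unitary_group :: ((complex, 't) sqmat) set). norm (f M (map_matrix cnj M)) \<le> K"
    using bounded_polyfun[OF assms] by blast
  have "(\<lambda>M. f M (map_matrix cnj M)) \<in> borel_measurable (restrict_space borel (compact_form G))"
    by (intro measurable_restrict_space1 borel_measurable_continuous_onI continuous_polyfun assms)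
  then have "(\<lambda>M. f M (map_matrix cnj M)) \<in> borel_measurable \<mu>"
    by (subst measurable_cong_sets[OF sets_eq refl])
  moreover have "AE M in \<mu>. norm (f M (map_matrix cnj M)) \<le> K"
    using K by (intro AE_I2) (auto simp: space_eq compact_form_def)
  ultimately show ?thesis by (intro integrable_const_bound)
qed

lemma mean_const [simp]: "mean (\<lambda>A B. c) = c"
  by (simp add: mean_def prob_space)

lemma mean_add:
  "polyfun UNIV f \<Longrightarrow> polyfun UNIV g \<Longrightarrow> mean (\<lambda>A B. f A B + g A B) = mean f + mean g"
  unfolding mean_def by (intro Bochner_Integration.integral_add integrable_polyfun)

lemma mean_cmult: "mean (\<lambda>A B. c * f A B) = c * mean f"
  unfolding mean_def by (rule integral_mult_right_zero)

lemma mean_multc: "mean (\<lambda>A B. f A B * c) = mean f * c"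
  unfolding mean_def by (rule integral_mult_left_zero)

lemma mean_sum:
  "(\<And>i. i \<in> S \<Longrightarrow> polyfun UNIV (f i)) \<Longrightarrow> mean (\<lambda>A B. \<Sum>i\<in>S. f i A B) = (\<Sum>i\<in>S. mean (f i))"
  unfolding mean_def by (intro Bochner_Integration.integral_sum integrable_polyfun)

lemma mean_cong:
  assumes "\<And>A B. (A, B) \<in> compact_pairs G \<Longrightarrow> f A B = g A B"
  shows "mean f = mean g"
  unfolding mean_def
  by (intro Bochner_Integration.integral_cong refl) (auto simp: space_eq compact_pairs_def intro!: assms)

lemma mean_eq_0:
  assumes "vanishes_on f (compact_pairs G)"
  shows "mean f = 0"
  using mean_cong[of f "\<lambda>A B. 0"] assms unfolding vanishes_on_def by auto

lemma mean_sum_list_left: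
  assumes "\<forall>(g, b)\<in>set xs. polyfun UNIV g"
  shows "mean (\<lambda>A B. \<Sum>(g, b)\<leftarrow>xs. g A B * c b) = (\<Sum>(g, b)\<leftarrow>xs. mean g * c b)"
  using assms
proof (induction xs)
  case (Cons x xs)
  obtain g b where x: "x = (g, b)" by (cases x)
  have "polyfun UNIV (\<lambda>A B. g A B * c b)" using Cons.prems x by (intro polyfun.mult polyfun.const) auto
  moreover have "polyfun UNIV (\<lambda>A B. \<Sum>(g, b)\<leftarrow>xs. g A B * c b)"
    using Cons.prems by (intro polyfun_sum_list) auto
  ultimately show ?case
    using Cons x by (simp add: mean_add mean_multc)
qed simp

text \<open>The weight c stands for evaluation at a pair held fixed, as in \<open>c g\<close> equal
  to \<open>g A B\<close>.\<close>

lemma mean_sum_list_right: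
  "mean (\<lambda>A B. \<Sum>(g, b)\<leftarrow>xs. c g * mono_val A B b) = (\<Sum>(g, b)\<leftarrow>xs. c g * mean (\<lambda>A B. mono_val A B b))"
proof (induction xs)
  case (Cons x xs)
  obtain g b where x: "x = (g, b)" by (cases x)
  have mono: "polyfun UNIV (\<lambda>A B. mono_val A B b)" for b by (simp add: polyfun_mono_val)
  have "polyfun UNIV (\<lambda>A B. \<Sum>(g, b)\<leftarrow>xs. c g * mono_val A B b)"
    by (induction xs) (auto intro!: polyfun.intros mono)
  moreover have "polyfun UNIV (\<lambda>A B. c g * mono_val A B b)"
    by (intro polyfun.mult polyfun.const mono) auto
  ultimately show ?case
    using Cons x by (simp add: mean_add mean_cmult)
qed simp

section \<open>Invariance of the mean under the compact form\<close>

lemma measurable_translate: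
  assumes "A \<in> compact_form G"
  shows "(\<lambda>B. A ** B) \<in> measurable \<mu> \<mu>"
proof -
  have "continuous_on UNIV (\<lambda>B. A ** B)"
    unfolding matrix_matrix_mult_def by (intro continuous_intros)
  then have "(\<lambda>B. A ** B) \<in> measurable (restrict_space borel (compact_form G)) (restrict_space borel (compact_form G))"
    using assms compact_form_mult
    by (intro measurable_restrict_space2 measurable_restrict_space1 borel_measurable_continuous_onI)
      (auto simp: space_restrict_space)
  then show ?thesis
    by (subst measurable_cong_sets[OF sets_eq sets_eq])
qed

lemma mean_left_compact:
  assumes "(A, A') \<in> compact_pairs G" "polyfun UNIV f"
  shows "mean (\<lambda>B B'. f (A ** B) (A' ** B')) = mean f"
proof -
  have A: "A \<in> compact_form G" "A' = map_matrix cnj A" using assms(1) by (auto simp: compact_pairs_def)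
  have "mean f = (LINT M|distr \<mu> \<mu> (\<lambda>B. A ** B). f M (map_matrix cnj M))"
    using haar A(1) by (simp add: normalised_haar_measure_def mean_def)
  also have "\<dots> = (LINT B|\<mu>. f (A ** B) (map_matrix cnj (A ** B)))"
    using integrable_polyfun[OF assms(2)]
    by (intro integral_distr measurable_translate A) auto
  finally show ?thesis by (simp add: mean_def A map_matrix_cnj_mult)
qed

lemma compact_pairs_inverse:
  assumes "(A, B) \<in> compact_pairs G"
  shows "transpose B ** A = mat 1" "transpose A ** B = mat 1" "A ** transpose B = mat 1" "B ** transpose A = mat 1"
proof -
  show 1: "transpose B ** A = mat 1" using assms compact_form_unitary by (auto simp: compact_pairs_def)
  then show 2: "A ** transpose B = mat 1" using matrix_left_right_inverse by blast
  show "transpose A ** B = mat 1" using arg_cong[OF 1, of transpose] by (simp add: matrix_transpose_mul)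
  then show "B ** transpose A = mat 1" using matrix_left_right_inverse by blast
qed

text \<open>
  Both sides equal the double mean of \<open>f(A\<^sup>-\<^sup>1 B)\<close>: the inner mean is independent of the outer
  variable by left invariance, in either order of integration.
\<close>

lemma mean_inverse:
  assumes f: "polyfun UNIV f"
  shows "mean (\<lambda>A B. f (transpose B) (transpose A)) = mean f"
proof -
  obtain xs where xs: "\<forall>(g, b)\<in>set xs. polyfun UNIV g"
    and eq: "\<And>A B A' B'. f (transpose B ** A') (transpose A ** B') = (\<Sum>(g, b)\<leftarrow>xs. g A B * mono_val A' B' b)"
    using separable_translate(3)[OF _ _ f] unfolding separable_def by auto
  let ?m = "\<lambda>b. mean (\<lambda>A B. mono_val A B b)"
  have f': "polyfun UNIV (\<lambda>A B. f (transpose B ** A') (transpose A ** B'))" for A' B'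
    unfolding eq by (rule polyfun_sum_list) (use xs in auto)
  have "(\<Sum>(g, b)\<leftarrow>xs. g A B * ?m b) = mean f" if AB: "(A, B) \<in> compact_pairs G" for A B
  proof -
    have "mean f = mean (\<lambda>A' B'. f (transpose B ** A') (transpose A ** B'))"
    proof -
      have "mean (\<lambda>A' B'. f (transpose B ** A') (transpose A ** B')) =
          mean (\<lambda>A' B'. f (transpose B ** (A ** A')) (transpose A ** (B ** B')))"
        by (rule mean_left_compact[symmetric, OF AB]) (rule polyfun_translate_left[OF f])
      also have "\<dots> = mean f"
        by (simp add: matrix_mul_assoc compact_pairs_inverse[OF AB])
      finally show ?thesis by simp
    qed
    also have "\<dots> = (\<Sum>(g, b)\<leftarrow>xs. g A B * ?m b)"
      unfolding eq by (rule mean_sum_list_right)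
    finally show ?thesis by simp
  qed
  then have "mean (\<lambda>A B. \<Sum>(g, b)\<leftarrow>xs. g A B * ?m b) = mean (\<lambda>A B. mean f)"
    by (rule mean_cong)
  then have 1: "(\<Sum>(g, b)\<leftarrow>xs. mean g * ?m b) = mean f"
    by (simp add: mean_sum_list_left[OF xs])
  have "(\<Sum>(g, b)\<leftarrow>xs. mean g * mono_val A' B' b) = mean (\<lambda>A B. f (transpose B) (transpose A))"
    if AB: "(A', B') \<in> compact_pairs G" for A' B'
  proof -
    have "(\<Sum>(g, b)\<leftarrow>xs. mean g * mono_val A' B' b) = mean (\<lambda>A B. f (transpose B ** A') (transpose A ** B'))"
      unfolding eq by (rule mean_sum_list_left[OF xs, symmetric])
    also have "\<dots> = mean (\<lambda>A B. f (transpose (B' ** B) ** A') (transpose (A' ** A) ** B'))"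
      by (rule mean_left_compact[OF AB f', symmetric])
    also have "\<dots> = mean (\<lambda>A B. f (transpose B) (transpose A))"
      by (simp add: matrix_transpose_mul matrix_mul_assoc[symmetric] compact_pairs_inverse[OF AB])
    finally show ?thesis .
  qed
  then have "mean (\<lambda>A' B'. \<Sum>(g, b)\<leftarrow>xs. mean g * mono_val A' B' b) =
      mean (\<lambda>A' B'. mean (\<lambda>A B. f (transpose B) (transpose A)))"
    by (rule mean_cong)
  then show ?thesis
    using 1 by (simp add: mean_sum_list_right)
qed

text \<open>Inversion preserves the mean and exchanges right with left translation. The compact form
  has to be closed under inverses for this, which is checked group by group.\<close>

lemma mean_right_compact:
  assumes AB: "(A, B) \<in> compact_pairs G" and f: "polyfun UNIV f"
  shows "mean (\<lambda>A' B'. f (A' ** A) (B' ** B)) = mean f"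
proof -
  have inv: "(transpose B, transpose A) \<in> compact_pairs G"
  proof -
    have A: "A \<in> compact_form G" "B = map_matrix cnj A" using AB by (auto simp: compact_pairs_def)
    have tB: "transpose B \<in> unitary_group"
      by (rule unitaryI) (use compact_pairs_inverse[OF AB] A(2) in \<open>simp add: transpose_def map_matrix_def\<close>)
    have inv: "invertible (transpose B)" using tB by (simp add: unitary_group_def)
    have "transpose B \<in> classical_group G"
    proof -
      have A': "A \<in> classical_group G" using A by (simp add: compact_form_def)
      show ?thesis
      proof (cases G)
        case GL
        then show ?thesis using inv by simp
      next
        case SL
        then have "det A = 1" using A' by simp
        then show ?thesis
          using SL inv det_inverse_transpose[OF compact_pairs_inverse(1)[OF AB]] by simp
      next
        case Orth
        then have "transpose A ** A = mat 1" using A' by simp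
        then have "B = A" using inverse_transpose_unique compact_pairs_inverse(1)[OF AB] by blast
        then show ?thesis using Orth inv compact_pairs_inverse[OF AB] by simp
      next
        case Symp
        then have "transpose A ** Omega ** A = Omega" using A' by simp
        then have "B ** (transpose A ** Omega ** A) ** transpose B = B ** Omega ** transpose B" by simp
        also have "B ** (transpose A ** Omega ** A) ** transpose B =
            (B ** transpose A) ** Omega ** (A ** transpose B)"
          by (simp only: matrix_mul_assoc)
        finally show ?thesis using Symp inv compact_pairs_inverse[OF AB] by simp
      qed
    qed
    moreover have "transpose A = map_matrix cnj (transpose B)"
      by (simp add: A(2) transpose_def vec_eq_iff)
    ultimately show ?thesis
      using tB by (auto simp: compact_pairs_def compact_form_def)
  qed
  let ?f = "\<lambda>A B. f (transpose B) (transpose A)"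
  have f': "polyfun UNIV ?f"
    by (rule polyfun_subst[OF f]) (auto simp: transpose_def intro: polyfun.intros)
  have "mean (\<lambda>A' B'. f (A' ** A) (B' ** B)) = mean (\<lambda>A' B'. f (transpose B' ** A) (transpose A' ** B))"
    using mean_inverse[OF polyfun_translate_right[OF f, of A B]] by simp
  also have "\<dots> = mean (\<lambda>A' B'. ?f (transpose B ** A') (transpose A ** B'))"
    by (simp add: matrix_transpose_mul)
  also have "\<dots> = mean ?f" by (rule mean_left_compact[OF inv f'])
  also have "\<dots> = mean f" by (rule mean_inverse[OF f])
  finally show ?thesis .
qed

text \<open>After separation the defect of invariance is a polynomial function of the translating
  pair. It vanishes on the compact form, hence at rational points.\<close>

lemma mean_left_rational:
  assumes "(A, B) \<in> rational_pairs G" and f: "polyfun UNIV f"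
  shows "mean (\<lambda>A' B'. f (A ** A') (B ** B')) = mean f"
proof -
  obtain xs where xs: "\<forall>(g, b)\<in>set xs. polyfun UNIV g"
    and eq: "\<And>A B A' B'. f (A ** A') (B ** B') = (\<Sum>(g, b)\<leftarrow>xs. g A B * mono_val A' B' b)"
    using separable_translate(1)[OF _ _ f] unfolding separable_def by auto
  let ?h = "\<lambda>A B. mean (\<lambda>A' B'. f (A ** A') (B ** B')) - mean f"
  have "polyfun UNIV ?h"
    unfolding eq mean_sum_list_right
    by (intro polyfun_diff polyfun_sum_list polyfun.const) (use xs in auto)
  moreover have "vanishes_on ?h (compact_pairs G)"
    using mean_left_compact[OF _ f] unfolding vanishes_on_def by auto
  ultimately have "vanishes_on ?h (rational_pairs G)"
    using compact_pairs_dense even by blast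
  then show ?thesis using assms(1) unfolding vanishes_on_def by auto
qed

lemma mean_right_rational:
  assumes "(A, B) \<in> rational_pairs G" and f: "polyfun UNIV f"
  shows "mean (\<lambda>A' B'. f (A' ** A) (B' ** B)) = mean f"
proof -
  obtain xs where xs: "\<forall>(g, b)\<in>set xs. polyfun UNIV g"
    and eq: "\<And>A B A' B'. f (A' ** A) (B' ** B) = (\<Sum>(g, b)\<leftarrow>xs. g A B * mono_val A' B' b)"
    using separable_translate(2)[OF _ _ f] unfolding separable_def by auto
  let ?h = "\<lambda>A B. mean (\<lambda>A' B'. f (A' ** A) (B' ** B)) - mean f"
  have "polyfun UNIV ?h"
    unfolding eq mean_sum_list_right
    by (intro polyfun_diff polyfun_sum_list polyfun.const) (use xs in auto)
  moreover have "vanishes_on ?h (compact_pairs G)"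
    using mean_right_compact[OF _ f] unfolding vanishes_on_def by auto
  ultimately have "vanishes_on ?h (rational_pairs G)"
    using compact_pairs_dense even by blast
  then show ?thesis using assms(1) unfolding vanishes_on_def by auto
qed

lemma moment_eq_mean: "moment \<mu> I J = mean (\<lambda>A B. mono_val A B (I, J))"
  by (simp add: moment_def mean_def mono_val_def case_prod_unfold)

end


section \<open>Cubature at rational group elements\<close>

text \<open>The double annihilator in finite dimension: m lies in the span of the vectors w p as
  soon as every linear relation satisfied by all of them holds for m.\<close>

lemma finite_duality:
  fixes w :: "'p \<Rightarrow> 'i \<Rightarrow> 'a::field"
  assumes A: "finite A"
    and orth: "\<And>c. (\<And>p. p \<in> P \<Longrightarrow> (\<Sum>a\<in>A. c a * w p a) = 0) \<Longrightarrow> (\<Sum>a\<in>A. c a * m a) = 0"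
  shows "\<exists>T lam. finite T \<and> T \<subseteq> P \<and> (\<forall>a\<in>A. m a = (\<Sum>p\<in>T. lam p * w p a))"
proof -
  define scale where "scale = (\<lambda>(c::'a) (f::'i \<Rightarrow> 'a) a. c * f a)"
  interpret V: vector_space scale
    by standard (auto simp: scale_def algebra_simps fun_eq_iff)
  interpret VP: vector_space_pair scale "(*) :: 'a \<Rightarrow> 'a \<Rightarrow> 'a"
    by standard (auto simp: algebra_simps)
  \<comment> \<open>Truncation outside A embeds the finite-dimensional space of functions on
    A.\<close>
  define r where "r f = (\<lambda>a. if a \<in> A then f a else 0)" for f :: "'i \<Rightarrow> 'a"
  show ?thesis
  proof (cases "r m \<in> V.span ((\<lambda>p. r (w p)) ` P)")
    case True
    then obtain S u where S: "finite S" "S \<subseteq> (\<lambda>p. r (w p)) ` P" and m: "r m = (\<Sum>v\<in>S. scale (u v) v)"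
      unfolding V.span_explicit by blast
    obtain T where T: "T \<subseteq> P" "inj_on (\<lambda>p. r (w p)) T" "S = (\<lambda>p. r (w p)) ` T"
      using S(2) unfolding subset_image_inj by blast
    have "finite T" using S(1) T(2,3) finite_imageD by blast
    moreover have "m a = (\<Sum>p\<in>T. u (r (w p)) * w p a)" if "a \<in> A" for a
    proof -
      have "r m a = (\<Sum>p\<in>T. scale (u (r (w p))) (r (w p))) a"
        unfolding m T(3) by (subst sum.reindex[OF T(2)]) (simp add: o_def)
      also have "\<dots> = (\<Sum>p\<in>T. scale (u (r (w p))) (r (w p)) a)"
        by (induction T rule: infinite_finite_induct) auto
      finally show ?thesis using that by (simp add: r_def scale_def)
    qed
    ultimately show ?thesis
      using T(1) by (intro exI[of _ T] exI[of _ "\<lambda>p. u (r (w p))"]) auto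
  next
    case False
    \<comment> \<open>A functional that is 1 on m and 0 on a basis of the span has coefficients on A
      contradicting the hypothesis.\<close>
    obtain B where B: "B \<subseteq> (\<lambda>p. r (w p)) ` P" "V.independent B"
      "(\<lambda>p. r (w p)) ` P \<subseteq> V.span B"
      using V.maximal_independent_subset by blast
    have notin: "r m \<notin> V.span B"
      using False V.span_mono[OF B(1)] by blast
    then have "V.independent (insert (r m) B)"
      using B(2) V.independent_insertI by blast
    then obtain g where g: "Vector_Spaces.linear scale (*) g"
      and gB: "\<forall>x\<in>insert (r m) B. g x = (if x = r m then 1 else 0)"
      using VP.linear_independent_extend[of "insert (r m) B" "\<lambda>x. if x = r m then 1 else 0"] by blast
    interpret g: Vector_Spaces.linear scale "(*)" g by (rule g)
    have "r m \<notin> B" using notin V.span_base by blast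
    then have g0: "g x = 0" if "x \<in> V.span B" for x
      using VP.linear_eq_0_on_span[OF g _ that] gB by (metis insertCI)
    define c where "c a = g (\<lambda>b. if b = a then 1 else 0)" for a
    have gr: "g (r f) = (\<Sum>a\<in>A. c a * f a)" for f
    proof -
      have "r f = (\<Sum>a\<in>A. scale (f a) (\<lambda>b. if b = a then 1 else 0))"
      proof
        fix b
        have "(\<Sum>a\<in>A. scale (f a) (\<lambda>b. if b = a then 1 else 0)) b = (\<Sum>a\<in>A. scale (f a) (\<lambda>b. if b = a then 1 else 0) b)"
          by (induction A rule: infinite_finite_induct) auto
        then show "r f b = (\<Sum>a\<in>A. scale (f a) (\<lambda>b. if b = a then 1 else 0)) b"
          using A by (simp add: scale_def r_def if_distrib[of "\<lambda>z. _ * z"] cong: if_cong)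
      qed
      then show ?thesis by (simp add: g.sum g.scale c_def mult.commute)
    qed
    have "(\<Sum>a\<in>A. c a * w p a) = 0" if "p \<in> P" for p
      using g0[of "r (w p)"] B(3) that by (auto simp: gr)
    then have "g (r m) = 0" using orth gr by metis
    then show ?thesis using gB by simp
  qed
qed

text \<open>Extends the identity of Q to a linear functional on the Q-vector space \<complex>. It
  produces rational numbers from the moments before these are known to be rational.\<close>

lemma ex_rational_projection:
  "\<exists>\<pi>::complex \<Rightarrow> rat. (\<forall>x y. \<pi> (x + y) = \<pi> x + \<pi> y) \<and> (\<forall>q x. \<pi> (of_rat q * x) = q * \<pi> x) \<and> \<pi> 1 = 1"
proof -
  define scale where "scale = (\<lambda>q (z::complex). of_rat q * z)"
  interpret V: vector_space scale
    by standard (auto simp: scale_def algebra_simps of_rat_add of_rat_mult)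
  interpret VP: vector_space_pair scale "(*) :: rat \<Rightarrow> rat \<Rightarrow> rat"
    by standard (auto simp: algebra_simps)
  have "V.independent {1}" by (rule V.independent_insertI) (auto simp: V.independent_empty)
  then obtain g where g: "Vector_Spaces.linear scale (*) g" "\<forall>x\<in>{1}. g x = 1"
    using VP.linear_independent_extend[of "{1}" "\<lambda>_. 1"] by blast
  interpret g: Vector_Spaces.linear scale "(*)" g by (rule g)
  show ?thesis
    using g.add g.scale g(2) by (intro exI[of _ g]) (auto simp: scale_def)
qed

section \<open>Rational matrices inside an arbitrary field of characteristic zero\<close>

definition inv_transpose :: "'a::field^'t^'t \<Rightarrow> 'a^'t^'t" where
  "inv_transpose M = transpose (matrix_inv M)"

lemma transpose_inv_transpose_mult:
  assumes "invertible M"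
  shows "transpose (inv_transpose M) ** M = mat 1"
  using someI_ex[of "\<lambda>A'. M ** A' = mat 1 \<and> A' ** M = mat 1"] assms
  by (auto simp: inv_transpose_def matrix_inv_def invertible_def)

lemma inv_transpose_eqI:
  assumes "transpose B ** A = mat 1"
  shows "inv_transpose A = B"
  using inverse_transpose_unique[OF transpose_inv_transpose_mult assms]
    inverse_transpose_invertible[OF assms] by blast

lemma inv_transpose_mult:
  assumes "invertible A" "invertible B"
  shows "inv_transpose (A ** B) = inv_transpose A ** inv_transpose B"
  by (intro inv_transpose_eqI inverse_transpose_mult transpose_inv_transpose_mult assms)

abbreviation of_rat_mat :: "rat^'t^'t \<Rightarrow> 'a::field_char_0^'t^'t" where
  "of_rat_mat \<equiv> map_matrix of_rat"

lemma of_rat_mat_mult: "of_rat_mat (A ** B) = of_rat_mat A ** of_rat_mat B"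
  by (simp add: vec_eq_iff matrix_matrix_mult_def of_rat_sum of_rat_mult)

lemma of_rat_mat_transpose: "of_rat_mat (transpose A) = transpose (of_rat_mat A)"
  by (simp add: vec_eq_iff transpose_def)

lemma of_rat_mat_1: "of_rat_mat (mat 1) = mat 1"
  by (simp add: vec_eq_iff mat_def)

lemma of_rat_mat_Omega: "of_rat_mat Omega = Omega"
  by (simp add: vec_eq_iff Omega_def)

lemma of_rat_mat_eq_iff: "of_rat_mat A = of_rat_mat B \<longleftrightarrow> A = B"
  by (simp add: vec_eq_iff)

lemma det_of_rat_mat: "det (of_rat_mat A) = of_rat (det A)"
  by (simp add: det_def of_rat_sum of_rat_mult of_rat_prod)

lemma classical_group_of_rat_mat:
  "of_rat_mat M \<in> (classical_group G :: (('a::field_char_0, 't::{finite,linorder}) sqmat) set)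
    \<longleftrightarrow> M \<in> classical_group G"
proof -
  have inv: "invertible (of_rat_mat M :: ('a, 't) sqmat) \<longleftrightarrow> invertible M"
    by (simp add: invertible_det_nz det_of_rat_mat)
  have "transpose (of_rat_mat M) ** of_rat_mat M = (mat 1 :: ('a, 't) sqmat)
      \<longleftrightarrow> transpose M ** M = mat 1"
    unfolding of_rat_mat_eq_iff[of "transpose M ** M" "mat 1", symmetric, where 'a = 'a]
    by (simp only: of_rat_mat_transpose of_rat_mat_mult of_rat_mat_1)
  moreover have "transpose (of_rat_mat M) ** Omega ** of_rat_mat M = (Omega :: ('a, 't) sqmat)
      \<longleftrightarrow> transpose M ** Omega ** M = Omega"
    unfolding of_rat_mat_eq_iff[of "transpose M ** Omega ** M" Omega, symmetric, where 'a = 'a]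
    by (simp only: of_rat_mat_transpose of_rat_mat_mult of_rat_mat_Omega)
  ultimately show ?thesis using inv by (cases G) (auto simp: det_of_rat_mat)
qed

lemma of_rat_mat_inv_transpose:
  assumes "invertible M"
  shows "transpose (of_rat_mat (inv_transpose M)) ** of_rat_mat M = mat 1"
  unfolding of_rat_mat_transpose[symmetric] of_rat_mat_mult[symmetric] transpose_inv_transpose_mult[OF assms]
  by (rule of_rat_mat_1)

text \<open>Over every field the rational points are the image of the same group of rational
  matrices; identities between rational polynomials pass from \<complex> to k through this
  description.\<close>

lemma rational_pairs_eq:
  "(rational_pairs G :: ((('a::field_char_0, 't::{finite,linorder}) sqmat) \<times> (('a, 't) sqmat)) set) =
    (\<lambda>M. (of_rat_mat M, of_rat_mat (inv_transpose M))) ` classical_group G"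
proof (intro equalityI subsetI)
  fix x :: "(('a, 't) sqmat) \<times> (('a, 't) sqmat)"
  assume x: "x \<in> rational_pairs G"
  obtain A B where AB: "x = (A, B)" by (cases x)
  have "\<forall>i j. \<exists>q. A $ i $ j = of_rat q"
    using x AB unfolding rational_pairs_def by (auto elim!: Rats_cases)
  then obtain h where h: "\<And>i j. A $ i $ j = of_rat (h i j)" by metis
  define M where "M = (\<chi> i j. h i j)"
  have A: "A = of_rat_mat M" by (simp add: M_def vec_eq_iff h)
  have "A \<in> classical_group G" "transpose B ** A = mat 1"
    using x AB by (auto simp: rational_pairs_def group_pairs_def)
  moreover from this(1) have M: "M \<in> classical_group G" by (simp add: A classical_group_of_rat_mat)
  moreover have "transpose (of_rat_mat (inv_transpose M)) ** A = mat 1"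
    unfolding A by (rule of_rat_mat_inv_transpose[OF classical_group_invertible[OF M]])
  ultimately have "B = of_rat_mat (inv_transpose M)" using inverse_transpose_unique by blast
  then show "x \<in> (\<lambda>M. (of_rat_mat M, of_rat_mat (inv_transpose M))) ` classical_group G"
    using M A AB by blast
next
  fix x :: "(('a, 't) sqmat) \<times> (('a, 't) sqmat)"
  assume "x \<in> (\<lambda>M. (of_rat_mat M, of_rat_mat (inv_transpose M))) ` classical_group G"
  then obtain M where "M \<in> classical_group G" "x = (of_rat_mat M, of_rat_mat (inv_transpose M))" by blast
  then show "x \<in> rational_pairs G"
    by (simp add: rational_pairs_def group_pairs_def classical_group_of_rat_mat
        of_rat_mat_inv_transpose classical_group_invertible)
qed

lemma monom_eval_of_rat: "monom_eval (\<lambda>v. of_rat (x v)) e = of_rat (monom_eval x e)"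
  by (simp add: monom_eval_def of_rat_prod of_rat_power)

lemma mono_val_of_rat: "mono_val (of_rat_mat A) (of_rat_mat B) a = of_rat (mono_val A B a)"
  by (simp add: mono_val_def of_rat_mult case_prod_unfold flip: monom_eval_of_rat)

context haar
begin

lemma rational_dense:
  fixes f :: "('a::field_char_0, 't) sqmat \<Rightarrow> ('a, 't) sqmat \<Rightarrow> 'a"
  assumes "polyfun UNIV f" "vanishes_on f (rational_pairs G)"
  shows "vanishes_on f (group_pairs G)"
  by (rule rational_pairs_dense[OF _ assms]) (rule even)

text \<open>By duality, only rational relations between monomials on G(Q) matter. Such a relation
  extends to G(\<complex>) by density, so it holds for the means, and \<pi> preserves it.\<close>

lemma ex_cubature_projection:
  assumes A: "finite A" and add: "\<And>x y. \<pi> (x + y) = \<pi> x + \<pi> y"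
    and scale: "\<And>q x. \<pi> (of_rat q * x) = (q::rat) * \<pi> x"
  shows "\<exists>T lam. finite T \<and> T \<subseteq> classical_group G \<and>
    (\<forall>a\<in>A. \<pi> (mean (\<lambda>A B. mono_val A B a)) = (\<Sum>M\<in>T. lam M * mono_val M (inv_transpose M) a))"
proof (rule finite_duality[OF A])
  fix c :: "'t multi_index \<times> 't multi_index \<Rightarrow> rat" assume c: "\<And>M. M \<in> classical_group G \<Longrightarrow> (\<Sum>a\<in>A. c a * mono_val M (inv_transpose M) a) = 0"
  let ?f = "\<lambda>X Y. \<Sum>a\<in>A. of_rat (c a) * mono_val X Y a :: complex"
  have mono: "polyfun UNIV (\<lambda>X Y. of_rat (c a) * mono_val X Y a :: complex)" for a
    by (intro polyfun.mult polyfun.const polyfun_mono_val) auto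
  have f: "polyfun UNIV ?f" by (intro polyfun_sum mono A) auto
  have \<pi>_sum: "\<pi> (\<Sum>i\<in>S. h i) = (\<Sum>i\<in>S. \<pi> (h i))" for S :: "('t multi_index \<times> 't multi_index) set" and h
    using scale[of 0 0] by (induction S rule: infinite_finite_induct) (auto simp: add)
  have "vanishes_on ?f (rational_pairs G)"
    unfolding rational_pairs_eq vanishes_on_def
  proof clarify
    fix M :: "(rat, 't) sqmat" assume "M \<in> classical_group G"
    then have "of_rat (\<Sum>a\<in>A. c a * mono_val M (inv_transpose M) a) = (0::complex)"
      using c by simp
    then show "?f (of_rat_mat M) (of_rat_mat (inv_transpose M)) = 0"
      by (simp add: mono_val_of_rat of_rat_sum of_rat_mult)
  qed
  then have "vanishes_on ?f (group_pairs G)" by (rule rational_dense[OF f])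
  then have "mean ?f = 0"
    using compact_pairs_subset_group_pairs[of G] by (intro mean_eq_0) (auto simp: vanishes_on_def)
  then have "(\<Sum>a\<in>A. of_rat (c a) * mean (\<lambda>X Y. mono_val X Y a)) = 0"
    by (subst (asm) mean_sum[OF mono]) (simp only: mean_cmult)
  then have "\<pi> (\<Sum>a\<in>A. of_rat (c a) * mean (\<lambda>X Y. mono_val X Y a)) = \<pi> 0" by simp
  then show "(\<Sum>a\<in>A. c a * \<pi> (mean (\<lambda>X Y. mono_val X Y a))) = 0"
    using scale[of 0 0] by (simp add: \<pi>_sum scale)
qed

text \<open>
  The functional \<open>\<pi> \<circ> mean\<close> is right invariant and the mean is left invariant. Convolving the
  former, written as a rational cubature, with the latter shows that they coincide.
\<close>

lemma mean_eq_projection: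
  assumes add: "\<And>x y. \<pi> (x + y) = \<pi> x + \<pi> y" and scale: "\<And>q x. \<pi> (of_rat q * x) = (q::rat) * \<pi> x"
    and one: "\<pi> 1 = 1"
  shows "mean (\<lambda>A B. mono_val A B a) = of_rat (\<pi> (mean (\<lambda>A B. mono_val A B a)))"
proof -
  let ?f = "\<lambda>A B. mono_val A B a :: complex" and ?m = "\<lambda>b. mean (\<lambda>A B. mono_val A B b)"
  have fR: "polyfun \<rat> ?f" by (rule polyfun_mono_val) simp
  have f: "polyfun UNIV ?f" by (rule polyfun_mono_val) simp
  obtain xs where xs: "\<forall>(g, b)\<in>set xs. polyfun \<rat> g"
    and eq: "\<And>A B A' B'. ?f (A' ** A) (B' ** B) = (\<Sum>(g, b)\<leftarrow>xs. g A B * mono_val A' B' b)"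
    using separable_translate(2)[OF _ _ fR] unfolding separable_def by auto
  have xs': "\<forall>(g, b)\<in>set xs. polyfun UNIV g" using xs by (auto intro: polyfun_mono)
  let ?h = "\<lambda>A B. (\<Sum>(g, b)\<leftarrow>xs. g A B * of_rat (\<pi> (?m b)))"
  have h: "polyfun UNIV ?h" by (rule polyfun_sum_list) (use xs' in auto)
  \<comment> \<open>At a rational pair the coefficients \<open>g A B\<close> are rational, so \<pi>
    passes through the expansion of the right translate of \<open>?f\<close>, whose mean is that of
    \<open>?f\<close>.\<close>
  have "?h A B = of_rat (\<pi> (mean ?f))" if AB: "(A, B) \<in> rational_pairs G" for A B
  proof -
    have "mean ?f = (\<Sum>(g, b)\<leftarrow>xs. g A B * ?m b)"
      using mean_right_rational[OF AB f] unfolding eq mean_sum_list_right by simp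
    moreover have "of_rat (\<pi> (\<Sum>(g, b)\<leftarrow>xs. g A B * ?m b)) = ?h A B"
      using xs
    proof (induction xs)
      case Nil
      then show ?case using scale[of 0 0] by simp
    next
      case (Cons x xs)
      obtain g b where x: "x = (g, b)" by (cases x)
      have "g A B \<in> \<rat>"
        using Cons.prems x AB by - (rule polyfun_Rats[of g], auto simp: rational_pairs_def)
      then obtain q where "g A B = of_rat q" by (rule Rats_cases)
      then show ?case using Cons x by (simp add: add scale of_rat_add of_rat_mult)
    qed
    ultimately show ?thesis by simp
  qed
  then have "vanishes_on (\<lambda>A B. ?h A B - of_rat (\<pi> (mean ?f))) (rational_pairs G)"
    unfolding vanishes_on_def by auto
  \<comment> \<open>By density \<open>?h\<close> is constant on the complex group, so its mean is
    that constant.\<close>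
  then have "vanishes_on (\<lambda>A B. ?h A B - of_rat (\<pi> (mean ?f))) (group_pairs G)"
    by (intro rational_dense polyfun_diff polyfun.const h) auto
  then have "mean ?h = mean (\<lambda>A B. of_rat (\<pi> (mean ?f)))"
    using compact_pairs_subset_group_pairs[of G] by (intro mean_cong) (auto simp: vanishes_on_def)
  then have 1: "mean ?h = of_rat (\<pi> (mean ?f))" by simp
  \<comment> \<open>The exponent 0 is included because exactness there says that the weights sum to
    \<pi> 1 = 1.\<close>
  obtain T lam where T: "finite T" "T \<subseteq> classical_group G"
    and lam: "\<forall>b\<in>insert 0 (snd ` set xs). \<pi> (?m b) = (\<Sum>M\<in>T. lam M * mono_val M (inv_transpose M) b)"
    using ex_cubature_projection[OF _ add scale, of "insert 0 (snd ` set xs)"] by auto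
  have "(\<Sum>M\<in>T. lam M) = 1" using lam one by (simp add: mono_val_def)
  \<comment> \<open>Read through the cubature, \<open>?h\<close> is a weighted sum of left
    translates of \<open>?f\<close>, each with the mean of \<open>?f\<close>.\<close>
  have "?h A B = (\<Sum>M\<in>T. of_rat (lam M) * ?f (of_rat_mat M ** A) (of_rat_mat (inv_transpose M) ** B))" for A B
  proof -
    have "?h A B = (\<Sum>(g, b)\<leftarrow>xs. \<Sum>M\<in>T. of_rat (lam M) * (g A B * mono_val (of_rat_mat M) (of_rat_mat (inv_transpose M)) b))"
    proof (intro arg_cong[of _ _ sum_list] map_cong refl, clarify)
      fix g b assume "(g, b) \<in> set xs"
      then have "\<pi> (?m b) = (\<Sum>M\<in>T. lam M * mono_val M (inv_transpose M) b)" using lam by force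
      then show "g A B * of_rat (\<pi> (?m b)) =
          (\<Sum>M\<in>T. of_rat (lam M) * (g A B * mono_val (of_rat_mat M) (of_rat_mat (inv_transpose M)) b))"
        by (simp add: of_rat_sum of_rat_mult mono_val_of_rat sum_distrib_left mult_ac)
    qed
    also have "\<dots> = (\<Sum>M\<in>T. \<Sum>(g, b)\<leftarrow>xs. of_rat (lam M) * (g A B * mono_val (of_rat_mat M) (of_rat_mat (inv_transpose M)) b))"
      by (induction xs) (auto simp: sum.distrib)
    also have "\<dots> = (\<Sum>M\<in>T. of_rat (lam M) * ?f (of_rat_mat M ** A) (of_rat_mat (inv_transpose M) ** B))"
      unfolding eq by (intro sum.cong refl) (simp add: sum_list_const_mult case_prod_unfold)
    finally show ?thesis .
  qed
  then have "mean ?h = mean (\<lambda>A B. \<Sum>M\<in>T. of_rat (lam M) * ?f (of_rat_mat M ** A) (of_rat_mat (inv_transpose M) ** B))"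
    by simp
  also have "\<dots> = (\<Sum>M\<in>T. of_rat (lam M) * mean (\<lambda>A B. ?f (of_rat_mat M ** A) (of_rat_mat (inv_transpose M) ** B)))"
    by (subst mean_sum) (auto simp: mean_cmult intro!: polyfun.mult polyfun.const polyfun_translate_left[OF f])
  also have "\<dots> = (\<Sum>M\<in>T. of_rat (lam M) * mean ?f)"
    using T(2) by (intro sum.cong refl arg_cong2[of _ _ _ _ "(*)"] mean_left_rational[OF _ f])
      (auto simp: rational_pairs_eq)
  also have "\<dots> = of_rat (\<Sum>M\<in>T. lam M) * mean ?f"
    by (simp add: of_rat_sum sum_distrib_right)
  also have "\<dots> = mean ?f" using \<open>(\<Sum>M\<in>T. lam M) = 1\<close> by simp
  finally show ?thesis using 1 by simp
qed

text \<open>Besides exactness, the invariance of the cubature under G(Q) on both sides is recorded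
  as an identity between rational numbers, the form in which it can be carried to k.\<close>

lemma ex_cubature:
  assumes A: "finite A"
  shows "\<exists>T lam. finite T \<and> T \<subseteq> classical_group G \<and> (\<forall>a\<in>A.
    mean (\<lambda>A B. mono_val A B a) = of_rat (\<Sum>M\<in>T. lam M * mono_val M (inv_transpose M) a) \<and>
    (\<forall>N\<in>classical_group G.
      (\<Sum>M\<in>T. lam M * mono_val (N ** M) (inv_transpose N ** inv_transpose M) a) =
        (\<Sum>M\<in>T. lam M * mono_val M (inv_transpose M) a) \<and>
      (\<Sum>M\<in>T. lam M * mono_val (M ** N) (inv_transpose M ** inv_transpose N) a) =
        (\<Sum>M\<in>T. lam M * mono_val M (inv_transpose M) a)))"
proof -
  obtain \<pi> :: "complex \<Rightarrow> rat" where \<pi>: "\<And>x y. \<pi> (x + y) = \<pi> x + \<pi> y"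
    "\<And>q x. \<pi> (of_rat q * x) = q * \<pi> x" "\<pi> 1 = 1"
    using ex_rational_projection by blast
  let ?m = "\<lambda>b. mean (\<lambda>A B. mono_val A B b)"
  have f: "polyfun UNIV (\<lambda>A B. mono_val A B a)" for a :: "'t multi_index \<times> 't multi_index"
    by (rule polyfun_mono_val) simp
  have "\<exists>xs. \<forall>A B A' B'. mono_val (A ** A') (B ** B') a = (\<Sum>(g, b)\<leftarrow>xs. g A B * (mono_val A' B' b :: complex))"
    for a :: "'t multi_index \<times> 't multi_index"
    using separable_translate(1)[OF _ _ f[of a]] unfolding separable_def by auto
  then have "\<forall>a :: 't multi_index \<times> 't multi_index. \<exists>xs. \<forall>A B A' B'.
      mono_val (A ** A') (B ** B') a = (\<Sum>(g, b)\<leftarrow>xs. g A B * (mono_val A' B' b :: complex))" by blast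
  from choice[OF this] obtain L where L: "\<And>(a :: 't multi_index \<times> 't multi_index) A B A' B'.
      mono_val (A ** A') (B ** B') a = (\<Sum>(g, b)\<leftarrow>L a. g A B * (mono_val A' B' b :: complex))" by blast
  have "\<exists>xs. \<forall>A B A' B'. mono_val (A' ** A) (B' ** B) a = (\<Sum>(g, b)\<leftarrow>xs. g A B * (mono_val A' B' b :: complex))"
    for a :: "'t multi_index \<times> 't multi_index"
    using separable_translate(2)[OF _ _ f[of a]] unfolding separable_def by auto
  then have "\<forall>a :: 't multi_index \<times> 't multi_index. \<exists>xs. \<forall>A B A' B'.
      mono_val (A' ** A) (B' ** B) a = (\<Sum>(g, b)\<leftarrow>xs. g A B * (mono_val A' B' b :: complex))" by blast
  from choice[OF this] obtain R where R: "\<And>(a :: 't multi_index \<times> 't multi_index) A B A' B'.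
      mono_val (A' ** A) (B' ** B) a = (\<Sum>(g, b)\<leftarrow>R a. g A B * (mono_val A' B' b :: complex))" by blast
  \<comment> \<open>The monomials in A together with all those occurring in their left and right
    translates. Exactness on A' lets the cubature inherit the invariance of the mean on A.\<close>
  define A' where "A' = A \<union> (\<Union>a\<in>A. snd ` set (L a)) \<union> (\<Union>a\<in>A. snd ` set (R a))"
  have "finite A'" using A by (simp add: A'_def)
  from ex_cubature_projection[OF this \<pi>(1,2)] obtain T lam where T: "finite T" "T \<subseteq> classical_group G"
    and lam: "\<And>b. b \<in> A' \<Longrightarrow> \<pi> (?m b) = (\<Sum>M\<in>T. lam M * mono_val M (inv_transpose M) b)" by blast
  have exact: "?m b = (\<Sum>M\<in>T. of_rat (lam M) * mono_val (of_rat_mat M) (of_rat_mat (inv_transpose M)) b)"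
    if "b \<in> A'" for b
    using mean_eq_projection[OF \<pi>, of b] lam[OF that] by (simp add: of_rat_sum of_rat_mult mono_val_of_rat)
  have exact_list: "(\<Sum>(g, b)\<leftarrow>xs. g X Y * ?m b) = (\<Sum>M\<in>T. of_rat (lam M) *
      (\<Sum>(g, b)\<leftarrow>xs. g X Y * mono_val (of_rat_mat M) (of_rat_mat (inv_transpose M)) b))"
    if "snd ` set xs \<subseteq> A'" for xs and X Y :: "(complex, 't) sqmat"
    using that
  proof (induction xs)
    case (Cons x xs)
    obtain g b where x: "x = (g, b)" by (cases x)
    have "(\<Sum>(g, b)\<leftarrow>x # xs. g X Y * ?m b) = g X Y * ?m b + (\<Sum>(g, b)\<leftarrow>xs. g X Y * ?m b)"
      by (simp add: x)
    also have "?m b = (\<Sum>M\<in>T. of_rat (lam M) * mono_val (of_rat_mat M) (of_rat_mat (inv_transpose M)) b)"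
      using Cons.prems x by (intro exact) auto
    finally show ?case
      using Cons x by (simp add: distrib_left sum.distrib sum_distrib_left mult_ac)
  qed simp
  have "mean (\<lambda>A B. mono_val A B a) = of_rat (\<Sum>M\<in>T. lam M * mono_val M (inv_transpose M) a)"
    if a: "a \<in> A" for a
    using exact[of a] a by (simp add: A'_def of_rat_sum of_rat_mult mono_val_of_rat)
  moreover have "(\<Sum>M\<in>T. lam M * mono_val (N ** M) (inv_transpose N ** inv_transpose M) a) =
        (\<Sum>M\<in>T. lam M * mono_val M (inv_transpose M) a)" (is "?l = ?r")
    if a: "a \<in> A" and N: "N \<in> classical_group G" for a N
  proof -
    have N': "(of_rat_mat N, of_rat_mat (inv_transpose N)) \<in> rational_pairs G"
      using N by (auto simp: rational_pairs_eq)
    have "of_rat ?r = ?m a" using exact[of a] a by (simp add: A'_def of_rat_sum of_rat_mult mono_val_of_rat)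
    also have "\<dots> = (\<Sum>(g, b)\<leftarrow>L a. g (of_rat_mat N) (of_rat_mat (inv_transpose N)) * ?m b)"
      using mean_left_rational[OF N' f[of a]] unfolding L mean_sum_list_right by simp
    also have "\<dots> = (\<Sum>M\<in>T. of_rat (lam M) *
        mono_val (of_rat_mat N ** of_rat_mat M) (of_rat_mat (inv_transpose N) ** of_rat_mat (inv_transpose M)) a)"
      unfolding L using a by (intro exact_list) (auto simp: A'_def)
    also have "\<dots> = of_rat ?l"
      by (simp add: of_rat_sum of_rat_mult mono_val_of_rat flip: of_rat_mat_mult)
    finally show ?thesis by simp
  qed
  moreover have "(\<Sum>M\<in>T. lam M * mono_val (M ** N) (inv_transpose M ** inv_transpose N) a) =
        (\<Sum>M\<in>T. lam M * mono_val M (inv_transpose M) a)" (is "?l = ?r")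
    if a: "a \<in> A" and N: "N \<in> classical_group G" for a N
  proof -
    have N': "(of_rat_mat N, of_rat_mat (inv_transpose N)) \<in> rational_pairs G"
      using N by (auto simp: rational_pairs_eq)
    have "of_rat ?r = ?m a" using exact[of a] a by (simp add: A'_def of_rat_sum of_rat_mult mono_val_of_rat)
    also have "\<dots> = (\<Sum>(g, b)\<leftarrow>R a. g (of_rat_mat N) (of_rat_mat (inv_transpose N)) * ?m b)"
      using mean_right_rational[OF N' f[of a]] unfolding R mean_sum_list_right by simp
    also have "\<dots> = (\<Sum>M\<in>T. of_rat (lam M) *
        mono_val (of_rat_mat M ** of_rat_mat N) (of_rat_mat (inv_transpose M) ** of_rat_mat (inv_transpose N)) a)"
      unfolding R using a by (intro exact_list) (auto simp: A'_def)
    also have "\<dots> = of_rat ?l"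
      by (simp add: of_rat_sum of_rat_mult mono_val_of_rat flip: of_rat_mat_mult)
    finally show ?thesis by simp
  qed
  ultimately show ?thesis using T by (intro exI[of _ T] exI[of _ lam]) blast
qed

end


section \<open>Substitution homomorphisms\<close>

definition semiring_hom :: "('a::semiring_1 \<Rightarrow> 'b::semiring_1) \<Rightarrow> bool" where
  "semiring_hom h \<longleftrightarrow> h 0 = 0 \<and> h 1 = 1 \<and> (\<forall>a b. h (a + b) = h a + h b) \<and> (\<forall>a b. h (a * b) = h a * h b)"

lemma semiring_homD:
  assumes "semiring_hom h"
  shows "h 0 = 0" "h 1 = 1" "h (a + b) = h a + h b" "h (a * b) = h a * h b"
  using assms by (auto simp: semiring_hom_def)

lemma semiring_hom_sum: "semiring_hom h \<Longrightarrow> h (\<Sum>i\<in>S. f i) = (\<Sum>i\<in>S. h (f i))"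
  by (induction S rule: infinite_finite_induct) (auto simp: semiring_homD)

lemma semiring_hom_power: "semiring_hom h \<Longrightarrow> h (a ^ n) = h a ^ n"
  by (induction n) (auto simp: semiring_homD)

lemma semiring_hom_prod:
  fixes h :: "'a::comm_semiring_1 \<Rightarrow> 'b::comm_semiring_1"
  shows "semiring_hom h \<Longrightarrow> h (\<Prod>i\<in>S. f i) = (\<Prod>i\<in>S. h (f i))"
  by (induction S rule: infinite_finite_induct) (auto simp: semiring_homD)

lemma semiring_hom_comp: "semiring_hom g \<Longrightarrow> semiring_hom h \<Longrightarrow> semiring_hom (\<lambda>x. g (h x))"
  by (simp add: semiring_hom_def)

text \<open>The exponents range over an arbitrary type, so that both substitution into k[X, Y] and
  evaluation of k[X, Y][U, Ubar], whose exponents are pairs, are instances.\<close>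

definition monoid_algebra_hom :: "('a::zero \<Rightarrow> 'b::comm_semiring_1) \<Rightarrow> ('e \<Rightarrow> 'b) \<Rightarrow> ('e \<Rightarrow>\<^sub>0 'a) \<Rightarrow> 'b" where
  "monoid_algebra_hom h x p = (\<Sum>e\<in>Poly_Mapping.keys p. h (Poly_Mapping.lookup p e) * x e)"

lemma monoid_algebra_hom_superset:
  assumes "finite S" "Poly_Mapping.keys p \<subseteq> S" "h 0 = 0"
  shows "monoid_algebra_hom h x p = (\<Sum>e\<in>S. h (Poly_Mapping.lookup p e) * x e)"
  unfolding monoid_algebra_hom_def using assms
  by (intro sum.mono_neutral_left) (auto simp: in_keys_iff)

lemma monoid_algebra_hom_single:
  assumes "h 0 = 0"
  shows "monoid_algebra_hom h x (Poly_Mapping.single e c) = h c * x e"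
  using monoid_algebra_hom_superset[of "{e}" "Poly_Mapping.single e c" h x] assms by simp

lemma monoid_algebra_hom_add:
  assumes "semiring_hom h"
  shows "monoid_algebra_hom h x (p + q) = monoid_algebra_hom h x p + monoid_algebra_hom h x q"
proof -
  let ?S = "Poly_Mapping.keys p \<union> Poly_Mapping.keys q"
  have "finite ?S" "Poly_Mapping.keys (p + q) \<subseteq> ?S"
    by (auto dest: subsetD[OF Poly_Mapping.keys_add])
  then show ?thesis
    by (simp add: monoid_algebra_hom_superset[of ?S] semiring_homD[OF assms] lookup_add
        distrib_right sum.distrib)
qed

lemma monoid_algebra_hom_sum:
  assumes "semiring_hom h"
  shows "monoid_algebra_hom h x (\<Sum>i\<in>S. p i) = (\<Sum>i\<in>S. monoid_algebra_hom h x (p i))"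
  by (induction S rule: infinite_finite_induct)
    (auto simp: monoid_algebra_hom_add[OF assms], auto simp: monoid_algebra_hom_def)

lemma poly_mapping_eq_sum_single:
  "p = (\<Sum>e\<in>Poly_Mapping.keys p. Poly_Mapping.single e (Poly_Mapping.lookup p e))"
  by (rule poly_mapping_eqI) (simp add: lookup_sum lookup_single when_def in_keys_iff)

lemma semiring_hom_monoid_algebra_hom:
  assumes h: "semiring_hom h" and x: "x 0 = 1" "\<And>d e. x (d + e) = x d * x e"
  shows "semiring_hom (monoid_algebra_hom h x)"
proof -
  let ?H = "monoid_algebra_hom h x"
  note single = monoid_algebra_hom_single[of h x, OF semiring_homD(1)[OF h]]
  have "?H (p * q) = ?H p * ?H q" for p q
  proof -
    let ?c = Poly_Mapping.lookup
    have "p * q = (\<Sum>d\<in>Poly_Mapping.keys p. \<Sum>e\<in>Poly_Mapping.keys q.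
        Poly_Mapping.single (d + e) (?c p d * ?c q e))"
      by (subst (1) poly_mapping_eq_sum_single[of p], subst (1) poly_mapping_eq_sum_single[of q])
        (simp add: sum_product mult_single)
    then have "?H (p * q) = (\<Sum>d\<in>Poly_Mapping.keys p. \<Sum>e\<in>Poly_Mapping.keys q.
        (h (?c p d) * x d) * (h (?c q e) * x e))"
      by (simp add: monoid_algebra_hom_sum[OF h] single semiring_homD[OF h] x mult_ac)
    also have "\<dots> = ?H p * ?H q"
      by (simp add: monoid_algebra_hom_def sum_product)
    finally show ?thesis .
  qed
  moreover have "?H 0 = 0" by (simp add: monoid_algebra_hom_def)
  moreover have "?H 1 = 1" using single[of 0 1] by (simp add: semiring_homD[OF h] x)
  ultimately show ?thesis
    using monoid_algebra_hom_add[OF h, of x] unfolding semiring_hom_def by blast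
qed

lemma poly_subst_eq: "poly_subst h x = monoid_algebra_hom h (monom_eval x)"
  by (simp add: fun_eq_iff poly_subst_def monoid_algebra_hom_def)

lemma semiring_hom_poly_subst: "semiring_hom h \<Longrightarrow> semiring_hom (poly_subst h x)"
  unfolding poly_subst_eq by (rule semiring_hom_monoid_algebra_hom) (auto simp: monom_eval_add)

lemma poly_subst_Const: "h 0 = 0 \<Longrightarrow> poly_subst h x (Const c) = h c"
  by (simp add: poly_subst_eq Const_def monoid_algebra_hom_single)

lemma poly_subst_Var: "semiring_hom h \<Longrightarrow> poly_subst h x (Var v) = x v"
  by (simp add: poly_subst_eq Var_def monoid_algebra_hom_single semiring_homD)

lemma semiring_hom_Const: "semiring_hom (Const :: 'a::comm_semiring_1 \<Rightarrow> 'e::comm_monoid_add \<Rightarrow>\<^sub>0 'a)"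
  by (simp add: semiring_hom_def Const_def single_add mult_single)

lemma Var_power: "Var v ^ n = Poly_Mapping.single (Poly_Mapping.single v n) (1::'a::comm_semiring_1)"
  by (induction n) (auto simp: Var_def mult_single simp flip: single_add)

lemma monom_eval_Var: "monom_eval Var e = Poly_Mapping.single e (1::'a::comm_semiring_1)"
proof -
  have "(\<Prod>v\<in>S. Poly_Mapping.single (f v) (1::'a)) = Poly_Mapping.single (\<Sum>v\<in>S. f v) 1" for S and f :: "_ \<Rightarrow> 'b \<Rightarrow>\<^sub>0 nat"
    by (induction S rule: infinite_finite_induct) (auto simp: mult_single)
  then have "monom_eval Var e = Poly_Mapping.single
      (\<Sum>v\<in>Poly_Mapping.keys e. Poly_Mapping.single v (Poly_Mapping.lookup e v)) (1::'a)"
    by (simp add: monom_eval_def Var_power)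
  then show ?thesis by (simp flip: poly_mapping_eq_sum_single)
qed

lemma semiring_hom_eq_poly_subst:
  fixes H :: "('v, 'a::comm_semiring_1) mpoly \<Rightarrow> 'b::comm_semiring_1"
  assumes H: "semiring_hom H"
  shows "H p = poly_subst (\<lambda>c. H (Const c)) (\<lambda>v. H (Var v)) p"
proof -
  have "H (Poly_Mapping.single e c) = H (Const c) * monom_eval (\<lambda>v. H (Var v)) e" for e c
  proof -
    have "Poly_Mapping.single e c = Const c * monom_eval Var e"
      by (simp add: monom_eval_Var Const_def mult_single)
    then show ?thesis
      by (simp add: semiring_homD[OF H] monom_eval_def semiring_hom_prod[OF H] semiring_hom_power[OF H])
  qed
  then show ?thesis
    by (subst (1) poly_mapping_eq_sum_single[of p]) (simp add: semiring_hom_sum[OF H] poly_subst_def)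
qed

lemma semiring_hom_mpoly_eqI:
  fixes H K :: "('v, 'a::comm_semiring_1) mpoly \<Rightarrow> 'b::comm_semiring_1"
  assumes "semiring_hom H" "semiring_hom K"
    "\<And>c. H (Const c) = K (Const c)" "\<And>v. H (Var v) = K (Var v)"
  shows "H p = K p"
proof -
  have "H p = poly_subst (\<lambda>c. H (Const c)) (\<lambda>v. H (Var v)) p"
    by (rule semiring_hom_eq_poly_subst[OF assms(1)])
  also have "\<dots> = poly_subst (\<lambda>c. K (Const c)) (\<lambda>v. K (Var v)) p"
    by (simp only: assms(3,4))
  also have "\<dots> = K p"
    by (rule semiring_hom_eq_poly_subst[OF assms(2), symmetric])
  finally show ?thesis .
qed


section \<open>The action and the coefficients of \<open>\<phi>\<close>\<close>

lemma semiring_hom_act: "semiring_hom (act M)"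
  unfolding act_def by (intro semiring_hom_poly_subst semiring_hom_Const)

lemmas act_simps = semiring_homD[OF semiring_hom_act] semiring_hom_sum[OF semiring_hom_act]

lemmas Const_simps = semiring_homD[OF semiring_hom_Const] semiring_hom_sum[OF semiring_hom_Const]

lemma act_Const: "act M (Const c) = Const c"
  by (simp add: act_def poly_subst_Const Const_simps)

lemma matrix_inv_eq: "matrix_inv M = transpose (inv_transpose M)"
  by (simp add: inv_transpose_def)

lemma act_XVar: "act M (Var (XVar i j)) = (\<Sum>l\<in>UNIV. Var (XVar i l) * Const (inv_transpose M $ j $ l))"
  by (simp add: act_def poly_subst_Var semiring_hom_Const matrix_matrix_mult_def X_mat_def
      matrix_inv_eq transpose_def)

lemma act_YVar: "act M (Var (YVar i j)) = (\<Sum>l\<in>UNIV. Const (M $ i $ l) * Var (YVar l j))"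
  by (simp add: act_def poly_subst_Var semiring_hom_Const matrix_matrix_mult_def Y_mat_def)

text \<open>Substitutions compose in the reverse order: X becomes X N^-1 M^-1 and Y becomes M N Y.
  With the conventions of \<open>act\<close> this is a right action, which decides whether left or
  right translations are used below.\<close>

lemma act_act:
  fixes M N :: "'k::field^'t^'t" and f :: "('m::finite, 't, 'n::finite, 'k) kXY"
  assumes "invertible M" "invertible N"
  shows "act N (act M f) = act (M ** N) f"
proof (rule semiring_hom_mpoly_eqI[of "\<lambda>f. act N (act M f)" "act (M ** N)"])
  show "semiring_hom (\<lambda>f. act N (act M f))"
    by (rule semiring_hom_comp[OF semiring_hom_act semiring_hom_act])
  show "semiring_hom (act (M ** N))" by (rule semiring_hom_act)
  show "act N (act M (Const c)) = act (M ** N) (Const c)" for c by (simp add: act_Const)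
  fix v :: "('m, 't, 'n) xy_var"
  show "act N (act M (Var v)) = act (M ** N) (Var v)"
  proof (cases v)
    case (XVar i j)
    have "act N (act M (Var v)) = (\<Sum>l\<in>UNIV. \<Sum>r\<in>UNIV.
        Var (XVar i r) * Const (inv_transpose N $ l $ r) * Const (inv_transpose M $ j $ l))"
      by (simp add: XVar act_XVar act_simps act_Const sum_distrib_right)
    also have "\<dots> = (\<Sum>r\<in>UNIV. \<Sum>l\<in>UNIV.
        Var (XVar i r) * Const (inv_transpose N $ l $ r) * Const (inv_transpose M $ j $ l))"
      by (rule sum.swap)
    also have "\<dots> = act (M ** N) (Var v)"
    proof -
      have "inv_transpose (M ** N) $ j $ r = (\<Sum>l\<in>UNIV. inv_transpose M $ j $ l * inv_transpose N $ l $ r)" for r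
        unfolding inv_transpose_mult[OF assms] by (simp add: matrix_matrix_mult_def)
      then show ?thesis
        by (simp add: XVar act_XVar Const_simps sum_distrib_left mult_ac)
    qed
    finally show ?thesis .
  next
    case (YVar i j)
    have "act N (act M (Var v)) = (\<Sum>l\<in>UNIV. \<Sum>r\<in>UNIV.
        Const (M $ i $ l) * (Const (N $ l $ r) * Var (YVar r j)))"
      by (simp add: YVar act_YVar act_simps act_Const sum_distrib_left)
    also have "\<dots> = (\<Sum>r\<in>UNIV. \<Sum>l\<in>UNIV.
        Const (M $ i $ l) * (Const (N $ l $ r) * Var (YVar r j)))"
      by (rule sum.swap)
    also have "\<dots> = act (M ** N) (Var v)"
      by (simp add: YVar act_YVar matrix_matrix_mult_def Const_simps sum_distrib_left sum_distrib_right mult_ac)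
    finally show ?thesis .
  qed
qed

text \<open>Setting U = M and Ubar = M^-tr in \<open>phi f\<close> yields the action of M, because
  the transpose of Ubar becomes the inverse of M. Both sides are homomorphisms, so variables and
  constants suffice.\<close>

lemma act_eq_sum_alpha:
  fixes M :: "'k::field^'t^'t" and f :: "('m::finite, 't, 'n::finite, 'k) kXY"
  shows "act M f = (\<Sum>a\<in>Poly_Mapping.keys (phi f).
    alpha (fst a) (snd a) f * Const (mono_val M (inv_transpose M) a))"
proof -
  let ?x = "\<lambda>a. Const (mono_val M (inv_transpose M) a) :: ('m, 't, 'n, 'k) kXY"
  \<comment> \<open>S is the evaluation at U = M, Ubar = M^-tr that is the identity on
    k[X, Y].\<close>
  define S where "S = monoid_algebra_hom (\<lambda>c::('m, 't, 'n, 'k) kXY. c) ?x"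
  have id: "semiring_hom (\<lambda>c::('m, 't, 'n, 'k) kXY. c)" by (simp add: semiring_hom_def)
  have S: "semiring_hom S"
    unfolding S_def by (rule semiring_hom_monoid_algebra_hom[OF id])
      (simp_all add: mono_val_add Const_simps)
  have CC: "semiring_hom (\<lambda>c::'k. Const (Const c) :: ('m, 't, 'n, 'k) kXYU)"
    by (rule semiring_hom_comp[OF semiring_hom_Const semiring_hom_Const])
  have S_single: "S (Poly_Mapping.single e c) = c * ?x e" for e c
    by (simp add: S_def monoid_algebra_hom_single)
  have S_Const: "S (Const c) = c" for c
    unfolding Const_def[of c] S_single by (simp add: Const_simps)
  have "S (phi f) = act M f"
  proof (rule semiring_hom_mpoly_eqI[of "\<lambda>f. S (phi f)" "act M"])
    show "semiring_hom (\<lambda>f. S (phi f))"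
      unfolding phi_def by (intro semiring_hom_comp[OF S] semiring_hom_poly_subst CC)
    show "semiring_hom (act M)" by (rule semiring_hom_act)
    show "S (phi (Const c)) = act M (Const c)" for c
      by (simp add: phi_def poly_subst_Const Const_simps S_Const act_Const)
    fix v :: "('m, 't, 'n) xy_var"
    have phi: "phi (Var v :: ('m, 't, 'n, 'k) kXY) = (case v of
       XVar i j \<Rightarrow> (map_matrix Const X_mat ** transpose Ubar_mat) $ i $ j
     | YVar i j \<Rightarrow> (U_mat ** map_matrix Const Y_mat) $ i $ j)"
      by (simp add: phi_def poly_subst_Var[OF CC])
    show "S (phi (Var v)) = act M (Var v)"
    proof (cases v)
      case (XVar i j)
      show ?thesis
        unfolding phi unfolding XVar
        by (simp add: matrix_matrix_mult_def transpose_def X_mat_def Ubar_mat_def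
            semiring_hom_sum[OF S] semiring_homD[OF S] S_Const S_single act_XVar mono_val_def)
    next
      case (YVar i j)
      show ?thesis
        unfolding phi unfolding YVar
        by (simp add: matrix_matrix_mult_def Y_mat_def U_mat_def
            semiring_hom_sum[OF S] semiring_homD[OF S] S_Const S_single act_YVar mono_val_def)
    qed
  qed
  then show ?thesis
    by (simp add: S_def monoid_algebra_hom_def alpha_def)
qed


section \<open>The Reynolds operator\<close>

lemma rational_in_of_rat: "rational_in (of_rat q) = of_rat q"
  unfolding rational_in_def by (rule arg_cong[of _ _ of_rat]) auto

context haar
begin

definition reynolds :: "('m::finite, 't, 'n::finite, 'k::field_char_0) kXY \<Rightarrow> ('m, 't, 'n, 'k) kXY" where
  "reynolds f = (\<Sum>(I, J)\<in>Poly_Mapping.keys (phi f).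
     alpha I J f * Const (rational_in (moment \<mu> I J)))"

text \<open>One cubature serves all of F, so relations between values of \<open>reynolds\<close>
  become relations between finite averages with the same nodes and weights. The translations N now
  range over G(k).\<close>

lemma ex_reynolds_cubature:
  fixes F :: "('m::finite, 't, 'n::finite, 'k::field_char_0) kXY set"
  assumes F: "finite F"
  shows "\<exists>T (lam :: (rat, 't) sqmat \<Rightarrow> 'k).
    finite T \<and> T \<subseteq> classical_group G \<and> sum lam T = 1 \<and> (\<forall>f\<in>F.
      reynolds f = (\<Sum>M\<in>T. Const (lam M) * act (of_rat_mat M) f) \<and>
      (\<forall>N\<in>classical_group G.
        (\<Sum>M\<in>T. Const (lam M) * act (N ** of_rat_mat M) f) = reynolds f \<and>
        (\<Sum>M\<in>T. Const (lam M) * act (of_rat_mat M ** N) f) = reynolds f))"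
proof -
  \<comment> \<open>Exactness at the exponent 0 makes the weights sum to 1.\<close>
  define A where "A = insert 0 (\<Union>f\<in>F. Poly_Mapping.keys (phi f))"
  have "finite A" using F by (simp add: A_def)
  from ex_cubature[OF this] obtain T lam where T: "finite T" "T \<subseteq> classical_group G"
    and cub: "\<forall>a\<in>A.
      mean (\<lambda>A B. mono_val A B a) = of_rat (\<Sum>M\<in>T. lam M * mono_val M (inv_transpose M) a) \<and>
      (\<forall>N\<in>classical_group G.
        (\<Sum>M\<in>T. lam M * mono_val (N ** M) (inv_transpose N ** inv_transpose M) a) =
          (\<Sum>M\<in>T. lam M * mono_val M (inv_transpose M) a) \<and>
        (\<Sum>M\<in>T. lam M * mono_val (M ** N) (inv_transpose M ** inv_transpose N) a) =
          (\<Sum>M\<in>T. lam M * mono_val M (inv_transpose M) a))"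
    by (elim exE conjE)
  note lam = cub[rule_format, THEN conjunct1]
    and left = cub[rule_format, THEN conjunct2, rule_format, THEN conjunct1]
    and right = cub[rule_format, THEN conjunct2, rule_format, THEN conjunct2]
  define c where "c a = (\<Sum>M\<in>T. lam M * mono_val M (inv_transpose M) a)" for a
  have "of_rat (c 0) = (1::complex)" using lam[of 0] by (simp add: A_def c_def)
  then have sum1: "sum lam T = 1" by (simp add: c_def)
  have T': "of_rat_mat M \<in> (classical_group G :: (('k, 't) sqmat) set)"
    if "M \<in> T" for M using that T(2) classical_group_of_rat_mat by blast
  have inv_of_rat: "inv_transpose (of_rat_mat M :: ('k, 't) sqmat) = of_rat_mat (inv_transpose M)"
    if "M \<in> T" for M
    using that T(2) by (intro inv_transpose_eqI of_rat_mat_inv_transpose) (auto dest: classical_group_invertible)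
  have reynolds: "reynolds f = (\<Sum>a\<in>Poly_Mapping.keys (phi f). alpha (fst a) (snd a) f * Const (of_rat (c a)))"
    if "f \<in> F" for f
    unfolding reynolds_def
  proof (intro sum.cong refl, clarify)
    fix I J assume "(I, J) \<in> Poly_Mapping.keys (phi f)"
    then have "(I, J) \<in> A" using that by (auto simp: A_def)
    then have "moment \<mu> I J = of_rat (c (I, J))" unfolding c_def moment_eq_mean by (rule lam)
    then show "alpha I J f * Const (rational_in (moment \<mu> I J)) =
        alpha (fst (I, J)) (snd (I, J)) f * Const (of_rat (c (I, J)))"
      by (simp add: rational_in_of_rat)
  qed
  have mono: "polyfun UNIV (\<lambda>A B. of_rat (lam M) * mono_val A B a :: 'k)" for M a
    by (intro polyfun.mult polyfun.const polyfun_mono_val) auto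
  \<comment> \<open>For rational N this is the invariance of the cubature. Both sides are polynomial
    in N and its inverse transpose, so density over k gives all of G(k).\<close>
  have left': "(\<Sum>M\<in>T. of_rat (lam M) * mono_val (N ** of_rat_mat M) (inv_transpose N ** of_rat_mat (inv_transpose M)) a) = of_rat (c a)"
    if a: "a \<in> A" and N: "N \<in> classical_group G" for a and N :: "('k, 't) sqmat"
  proof -
    let ?h = "\<lambda>X Y. (\<Sum>M\<in>T. of_rat (lam M) * mono_val (X ** of_rat_mat M) (Y ** of_rat_mat (inv_transpose M)) a) - (of_rat (c a) :: 'k)"
    have "polyfun UNIV ?h"
      by (intro polyfun_diff polyfun_sum T polyfun.const polyfun_translate_right[OF mono]) auto
    moreover have "vanishes_on ?h (rational_pairs G)"
      unfolding rational_pairs_eq vanishes_on_def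
      using left[OF a] by (auto simp: mono_val_of_rat c_def simp flip: of_rat_mat_mult of_rat_mult of_rat_sum)
    ultimately have "vanishes_on ?h (group_pairs G)" by (rule rational_dense)
    moreover have "(N, inv_transpose N) \<in> group_pairs G"
      using N by (simp add: group_pairs_def transpose_inv_transpose_mult classical_group_invertible)
    ultimately show ?thesis unfolding vanishes_on_def by auto
  qed
  have right': "(\<Sum>M\<in>T. of_rat (lam M) * mono_val (of_rat_mat M ** N) (of_rat_mat (inv_transpose M) ** inv_transpose N) a) = of_rat (c a)"
    if a: "a \<in> A" and N: "N \<in> classical_group G" for a and N :: "('k, 't) sqmat"
  proof -
    let ?h = "\<lambda>X Y. (\<Sum>M\<in>T. of_rat (lam M) * mono_val (of_rat_mat M ** X) (of_rat_mat (inv_transpose M) ** Y) a) - (of_rat (c a) :: 'k)"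
    have "polyfun UNIV ?h"
      by (intro polyfun_diff polyfun_sum T polyfun.const polyfun_translate_left[OF mono]) auto
    moreover have "vanishes_on ?h (rational_pairs G)"
      unfolding rational_pairs_eq vanishes_on_def
      using right[OF a] by (auto simp: mono_val_of_rat c_def simp flip: of_rat_mat_mult of_rat_mult of_rat_sum)
    ultimately have "vanishes_on ?h (group_pairs G)" by (rule rational_dense)
    moreover have "(N, inv_transpose N) \<in> group_pairs G"
      using N by (simp add: group_pairs_def transpose_inv_transpose_mult classical_group_invertible)
    ultimately show ?thesis unfolding vanishes_on_def by auto
  qed
  have sum_act: "(\<Sum>M\<in>T. Const (of_rat (lam M)) * act (P M) f) = reynolds f"
    if f: "f \<in> F" and P: "\<And>a. a \<in> A \<Longrightarrow> (\<Sum>M\<in>T. of_rat (lam M) * mono_val (P M) (inv_transpose (P M)) a) = of_rat (c a)"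
    for f and P :: "_ \<Rightarrow> ('k, 't) sqmat"
  proof -
    have "(\<Sum>M\<in>T. Const (of_rat (lam M)) * act (P M) f) =
        (\<Sum>M\<in>T. \<Sum>a\<in>Poly_Mapping.keys (phi f). alpha (fst a) (snd a) f *
          Const (of_rat (lam M) * mono_val (P M) (inv_transpose (P M)) a))"
      by (simp add: act_eq_sum_alpha sum_distrib_left Const_simps mult_ac)
    also have "\<dots> = (\<Sum>a\<in>Poly_Mapping.keys (phi f). alpha (fst a) (snd a) f *
          Const (\<Sum>M\<in>T. of_rat (lam M) * mono_val (P M) (inv_transpose (P M)) a))"
      by (subst sum.swap) (simp only: Const_simps sum_distrib_left)
    also have "\<dots> = reynolds f"
      unfolding reynolds[OF f]
      by (intro sum.cong refl arg_cong2[of _ _ _ _ "(*)"] arg_cong[of _ _ Const] P)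
        (use f in \<open>auto simp: A_def\<close>)
    finally show ?thesis .
  qed
  have "(\<Sum>M\<in>T. Const (of_rat (lam M)) * act (of_rat_mat M) f) = reynolds f" if "f \<in> F" for f
  proof (rule sum_act[OF that])
    fix a assume "a \<in> A"
    have "(\<Sum>M\<in>T. of_rat (lam M) * mono_val (of_rat_mat M) (inv_transpose (of_rat_mat M)) a) =
        (\<Sum>M\<in>T. of_rat (lam M * mono_val M (inv_transpose M) a) :: 'k)"
      by (intro sum.cong refl) (simp add: inv_of_rat mono_val_of_rat of_rat_mult)
    then show "(\<Sum>M\<in>T. of_rat (lam M) * mono_val (of_rat_mat M) (inv_transpose (of_rat_mat M)) a) = (of_rat (c a) :: 'k)"
      by (simp add: c_def of_rat_sum)
  qed
  moreover have "(\<Sum>M\<in>T. Const (of_rat (lam M)) * act (N ** of_rat_mat M) f) = reynolds f"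
    if "f \<in> F" and N: "N \<in> classical_group G" for f and N :: "('k, 't) sqmat"
  proof (rule sum_act[OF that(1)])
    fix a assume a: "a \<in> A"
    have "inv_transpose (N ** of_rat_mat M) = inv_transpose N ** of_rat_mat (inv_transpose M)" if "M \<in> T" for M
      using T'[OF that] N by (simp add: inv_transpose_mult classical_group_invertible flip: inv_of_rat[OF that])
    then show "(\<Sum>M\<in>T. of_rat (lam M) * mono_val (N ** of_rat_mat M) (inv_transpose (N ** of_rat_mat M)) a) = of_rat (c a)"
      using left'[OF a N] by simp
  qed
  moreover have "(\<Sum>M\<in>T. Const (of_rat (lam M)) * act (of_rat_mat M ** N) f) = reynolds f"
    if "f \<in> F" and N: "N \<in> classical_group G" for f and N :: "('k, 't) sqmat"
  proof (rule sum_act[OF that(1)])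
    fix a assume a: "a \<in> A"
    have "inv_transpose (of_rat_mat M ** N) = of_rat_mat (inv_transpose M) ** inv_transpose N" if "M \<in> T" for M
      using T'[OF that] N by (simp add: inv_transpose_mult classical_group_invertible flip: inv_of_rat[OF that])
    then show "(\<Sum>M\<in>T. of_rat (lam M) * mono_val (of_rat_mat M ** N) (inv_transpose (of_rat_mat M ** N)) a) = of_rat (c a)"
      using right'[OF a N] by simp
  qed
  moreover have "(\<Sum>M\<in>T. of_rat (lam M)) = (1::'k)"
    using sum1 by (metis of_rat_1 of_rat_sum)
  ultimately show ?thesis
    using T by (intro exI[of _ T] exI[of _ "\<lambda>M. of_rat (lam M)"]) auto
qed

lemma moment_rational: "moment \<mu> I J \<in> \<rat>"
proof -
  obtain T lam where "mean (\<lambda>A B. mono_val A B (I, J)) =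
      of_rat (\<Sum>M\<in>T. lam M * mono_val M (inv_transpose M) (I, J))"
    using ex_cubature[of "{(I, J)}"] by auto
  then show ?thesis by (simp add: moment_eq_mean)
qed

text \<open>Linearity follows from a cubature common to the polynomials involved. Since the action
  reverses products, invariance of the image uses right translates of the nodes, and compatibility
  with the action uses left translates.\<close>

lemma is_reynolds_operator_reynolds:
  "is_reynolds_operator (classical_group G)
    (reynolds :: ('m::finite, 't, 'n::finite, 'k::field_char_0) kXY \<Rightarrow> ('m, 't, 'n, 'k) kXY)"
  unfolding is_reynolds_operator_def
proof (intro conjI allI ballI)
  fix f g :: "('m, 't, 'n, 'k) kXY"
  show "reynolds (f + g) = reynolds f + reynolds g"
    using ex_reynolds_cubature[of "{f, g, f + g}"]
    by (auto simp: act_simps distrib_left sum.distrib)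
next
  fix c and f :: "('m, 't, 'n, 'k) kXY"
  show "reynolds (Const c * f) = Const c * reynolds f"
    using ex_reynolds_cubature[of "{f, Const c * f}"]
    by (auto simp: act_simps act_Const sum_distrib_left mult_ac)
next
  fix f :: "('m, 't, 'n, 'k) kXY"
  obtain T and lam :: "_ \<Rightarrow> 'k" where T: "T \<subseteq> classical_group G"
    and f: "reynolds f = (\<Sum>M\<in>T. Const (lam M) * act (of_rat_mat M) f)"
    and N: "\<And>N. N \<in> classical_group G \<Longrightarrow> (\<Sum>M\<in>T. Const (lam M) * act (of_rat_mat M ** N) f) = reynolds f"
    using ex_reynolds_cubature[of "{f}"] by auto
  show "reynolds f \<in> invariants (classical_group G)"
    unfolding invariants_def
  proof clarify
    fix N :: "('k, 't) sqmat" assume N': "N \<in> classical_group G"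
    have "act N (reynolds f) = (\<Sum>M\<in>T. Const (lam M) * act N (act (of_rat_mat M) f))"
      by (simp add: f act_simps act_Const)
    also have "\<dots> = (\<Sum>M\<in>T. Const (lam M) * act (of_rat_mat M ** N) f)"
    proof (intro sum.cong refl arg_cong2[of _ _ _ _ "(*)"] act_act)
      fix M assume "M \<in> T"
      then have "(of_rat_mat M :: ('k, 't) sqmat) \<in> classical_group G"
        using T classical_group_of_rat_mat by blast
      then show "invertible (of_rat_mat M :: ('k, 't) sqmat)"
        by (rule classical_group_invertible)
    qed (rule classical_group_invertible[OF N'])
    also have "\<dots> = reynolds f" by (rule N[OF N'])
    finally show "act N (reynolds f) = reynolds f" .
  qed
next
  fix f :: "('m, 't, 'n, 'k) kXY" assume inv: "f \<in> invariants (classical_group G)"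
  obtain T and lam :: "_ \<Rightarrow> 'k" where T: "T \<subseteq> classical_group G" "sum lam T = 1"
    and f: "reynolds f = (\<Sum>M\<in>T. Const (lam M) * act (of_rat_mat M) f)"
    using ex_reynolds_cubature[of "{f}"] by auto
  have "reynolds f = (\<Sum>M\<in>T. Const (lam M) * f)"
    unfolding f using inv T(1) classical_group_of_rat_mat unfolding invariants_def
    by (intro sum.cong refl arg_cong2[of _ _ _ _ "(*)"]) blast
  also have "\<dots> = Const (sum lam T) * f"
    by (simp add: Const_simps sum_distrib_right)
  finally show "reynolds f = f" using T(2) by (simp add: Const_simps)
next
  fix N :: "('k, 't) sqmat" and f :: "('m, 't, 'n, 'k) kXY"
  assume N: "N \<in> classical_group G"
  obtain T and lam :: "_ \<Rightarrow> 'k" where T: "T \<subseteq> classical_group G"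
    and f: "reynolds (act N f) = (\<Sum>M\<in>T. Const (lam M) * act (of_rat_mat M) (act N f))"
    and N': "(\<Sum>M\<in>T. Const (lam M) * act (N ** of_rat_mat M) f) = reynolds f"
    using ex_reynolds_cubature[of "{act N f, f}"] N by auto
  have "reynolds (act N f) = (\<Sum>M\<in>T. Const (lam M) * act (N ** of_rat_mat M) f)"
    unfolding f
  proof (intro sum.cong refl arg_cong2[of _ _ _ _ "(*)"] act_act)
    fix M assume "M \<in> T"
    then have "(of_rat_mat M :: ('k, 't) sqmat) \<in> classical_group G"
      using T classical_group_of_rat_mat by blast
    then show "invertible (of_rat_mat M :: ('k, 't) sqmat)"
      by (rule classical_group_invertible)
  qed (rule classical_group_invertible[OF N])
  then show "reynolds (act N f) = reynolds f" using N' by simp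
qed

text \<open>Apply R to \<open>reynolds f\<close>: the result is \<open>reynolds f\<close> because
  that is invariant, and R f because it is an average of translates of f with total weight
  1.\<close>

lemma reynolds_operator_unique:
  fixes R :: "('m::finite, 't, 'n::finite, 'k::field_char_0) kXY \<Rightarrow> ('m, 't, 'n, 'k) kXY"
  assumes "is_reynolds_operator (classical_group G) R"
  shows "R f = reynolds f"
proof -
  have add: "R (f + g) = R f + R g" and scale: "R (Const c * f) = Const c * R f"
    and fix_inv: "r \<in> invariants (classical_group G) \<Longrightarrow> R r = r"
    and act: "M \<in> classical_group G \<Longrightarrow> R (act M f) = R f" for f g c r M
    using assms unfolding is_reynolds_operator_def by blast+
  have zero: "R 0 = 0" using add[of 0 0] by simp
  have R_sum: "R (\<Sum>i\<in>S. h i) = (\<Sum>i\<in>S. R (h i))" for S and h :: "_ \<Rightarrow> ('m, 't, 'n, 'k) kXY"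
    by (induction S rule: infinite_finite_induct) (auto simp: add zero)
  obtain T and lam :: "_ \<Rightarrow> 'k" where T: "T \<subseteq> classical_group G" "sum lam T = 1"
    and f: "reynolds f = (\<Sum>M\<in>T. Const (lam M) * act (of_rat_mat M) f)"
    using ex_reynolds_cubature[of "{f}"] by auto
  have "reynolds f \<in> invariants (classical_group G)"
    using is_reynolds_operator_reynolds unfolding is_reynolds_operator_def by blast
  then have "reynolds f = R (reynolds f)" by (simp add: fix_inv)
  also have "\<dots> = (\<Sum>M\<in>T. Const (lam M) * R (act (of_rat_mat M) f))"
    by (simp add: f R_sum scale)
  also have "\<dots> = (\<Sum>M\<in>T. Const (lam M) * R f)"
    using T(1) classical_group_of_rat_mat by (intro sum.cong refl arg_cong2[of _ _ _ _ "(*)"] act) blast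
  also have "\<dots> = Const (sum lam T) * R f"
    by (simp add: Const_simps sum_distrib_right)
  finally show ?thesis using T(2) by (simp add: Const_simps)
qed

end


theorem mainTheorem2:
  fixes G :: classical_type
    and \<mu> :: "(complex^('t::{finite,linorder})^('t::{finite,linorder})) measure"
  assumes "G = Symp \<Longrightarrow> even CARD('t)"
    and "normalised_haar_measure (compact_form G) \<mu>"
  shows "(\<forall>I J. moment \<mu> I J \<in> \<rat>) \<and>
    (\<exists>!R :: ('m::finite, 't, 'n::finite, 'k::field_char_0) kXY \<Rightarrow> ('m, 't, 'n, 'k) kXY.
       is_reynolds_operator (classical_group G) R) \<and>
    (\<forall>(R :: ('m, 't, 'n, 'k) kXY \<Rightarrow> ('m, 't, 'n, 'k) kXY) f.
       is_reynolds_operator (classical_group G) R \<longrightarrow>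
       R f = (\<Sum>(I, J)\<in>Poly_Mapping.keys (phi f).
                alpha I J f * Const (rational_in (moment \<mu> I J))))"
proof -
  interpret haar G \<mu>
    using assms by unfold_locales
  have unique: "R = reynolds" if "is_reynolds_operator (classical_group G) R"
    for R :: "('m, 't, 'n, 'k) kXY \<Rightarrow> ('m, 't, 'n, 'k) kXY"
    using reynolds_operator_unique[OF that] by (rule ext)
  show ?thesis
  proof (intro conjI allI impI)
    show "moment \<mu> I J \<in> \<rat>" for I J by (rule moment_rational)
    show "\<exists>!R :: ('m, 't, 'n, 'k) kXY \<Rightarrow> ('m, 't, 'n, 'k) kXY.
        is_reynolds_operator (classical_group G) R"
      by (intro ex1I[of _ reynolds] is_reynolds_operator_reynolds unique)
    fix R :: "('m, 't, 'n, 'k) kXY \<Rightarrow> ('m, 't, 'n, 'k) kXY" and f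
    assume "is_reynolds_operator (classical_group G) R"
    then have "R = reynolds" by (rule unique)
    then show "R f = (\<Sum>(I, J)\<in>Poly_Mapping.keys (phi f).
        alpha I J f * Const (rational_in (moment \<mu> I J)))"
      by (simp only: reynolds_def)
  qed
qed

end
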